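(* Let $T>0$, $m\ge2$, $\varepsilon\in(0,1]$, and assume (A) and (B). Let $\Phi^n\in X_M$ be the time-splitting Fourier pseudospectral (TSFP) approximation (see context) with mesh size $h=(b-a)/M$ and time step $\tau$. Then $$\|\Phi(t_n,\cdot)-I_M\Phi^n\|_{L^2}\le C(t_n)(h^m+\tau^2),\qquad 0\le n\le\frac{T/\varepsilon}{\tau},$$ where $C(t)=C_0+C_1\varepsilon t\le C_0+C_1T$ with $C_0,C_1>0$ constants independent of $h,\tau,n,\varepsilon$.
   Context: Let $\Omega=(a,b)$ with periodic boundary conditions. Consider the 1D Dirac equation $i\partial_t\Phi=(-i\sigma_1\partial_x+\sigma_3)\Phi+\varepsilon(V(x)I_2-A_1(x)\sigma_1)\Phi$, $\Phi(t,a)=\Phi(t,b)$, $\Phi(0,x)=\Phi_0(x)$, for $\Phi\in\mathbb{C}^2$, with $V,A_1$ real-valued time-independent, $\varepsilon\in(0,1]$, $\sigma_1=\begin{pmatrix}0&1\\1&0\end{pmatrix}$, $\sigma_3=\begin{pmatrix}1&0\\0&-1\end{pmatrix}$. Let $\mathbf{T}:=-\sigma_1\partial_x-i\sigma_3$, $\mathbf{V}:=-i(V(x)I_2-A_1(x)\sigma_1)$, $t_n=n\tau$. Assumption (A): $V,A_1\in W^{m,\infty}_{\rm per}(\Omega)$. Assumption (B): $\|\Phi\|_{L^\infty([0,T/\varepsilon];(H^m_{\rm per}(\Omega))^2)}\le K$ with $K$ independent of $\varepsilon$ (periodic Sobolev spaces require equality of derivatives up to order $m-1$ at $a,b$). Discretization: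 $M$ a positive even integer, $h=(b-a)/M$, $x_j=a+jh$ ($0\le j\le M$); $X_M=\{U=(U_0,\dots,U_M)^T: U_j\in\mathbb{C}^2, U_0=U_M\}$; $\mathcal{T}_M=\{-M/2,\dots,M/2-1\}$, $\mu_l=2\pi l/(b-a)$; $Y_M=Z_M\times Z_M$ with $Z_M=\mathrm{span}\{e^{i\mu_l(x-a)}:l\in\mathcal{T}_M\}$. The interpolation $I_M U(x)=\sum_{l\in\mathcal{T}_M}\widetilde U_l e^{i\mu_l(x-a)}$, $\widetilde U_l=\frac1M\sum_{j=0}^{M-1}U_je^{-2ijl\pi/M}$ (with $U_j=U(x_j)$ for functions). TSFP scheme: $\Phi^0_j=\Phi_0(x_j)$; for $n\ge0$, $\Phi^{(1)}_j=(e^{\frac\tau2\mathbf{T}}I_M\Phi^n)(x_j)$, $\Phi^{(2)}_j=e^{-i\varepsilon\tau(V(x_j)I_2-A_1(x_j)\sigma_1)}\Phi^{(1)}_j$, $\Phi^{n+1}_j=(e^{\frac\tau2\mathbf{T}}I_M\Phi^{(2)})(x_j)$. (Here $e^{s\mathbf{T}}$ acts on $\sum_l\widehat U_le^{i\mu_l(x-a)}$ by $\widehat U_l\mapsto e^{-is(\mu_l\sigma_1+\sigma_3)}\widehat U_l$.) *)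

theory Defs
  imports "HOL-Analysis.Analysis"
begin

type_synonym cvec = "complex ^ 2"
type_synonym cmat = "complex ^ 2 ^ 2"

definition sigma1 :: cmat where
  "sigma1 = (\<chi> i j. if i = j then 0 else 1)"

definition sigma3 :: cmat where
  "sigma3 = (\<chi> i j. if i = j then (if i = 1 then 1 else -1) else 0)"

definition smat :: "complex \<Rightarrow> cmat \<Rightarrow> cmat" where
  "smat c B = (\<chi> i j. c * B $ i $ j)"

fun mpow :: "cmat \<Rightarrow> nat \<Rightarrow> cmat" where
  "mpow B 0 = mat 1"
| "mpow B (Suc k) = B ** mpow B k"

definition mexp :: "cmat \<Rightarrow> cmat" where
  "mexp B = (\<Sum>k. (1 / fact k) *\<^sub>R mpow B k)"

text \<open>Periodic W^{m,infinity} on the torus of length b-a (= C^{m-1,1}, periodic).\<close>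
definition W_inf_per :: "real \<Rightarrow> real \<Rightarrow> nat \<Rightarrow> (real \<Rightarrow> real) \<Rightarrow> bool" where
  "W_inf_per a b m f \<longleftrightarrow>
     (\<forall>x. f (x + (b - a)) = f x) \<and>
     (\<exists>D :: nat \<Rightarrow> real \<Rightarrow> real. D 0 = f \<and>
        (\<forall>k < m - 1. \<forall>x. (D k has_real_derivative D (Suc k) x) (at x)) \<and>
        (\<exists>L. \<forall>x y. \<bar>D (m - 1) x - D (m - 1) y\<bar> \<le> L * \<bar>x - y\<bar>))"

text \<open>u (periodic, viewed on the real line) lies in (H^m_per)^2 with norm at most K, where
  the norm is (sum_{k<=m} ||d^k u||_{L^2(a,b)}^2)^{1/2}; derivatives up to order m-1 are
  classical (hence periodic), the m-th one is a weak derivative in L^2.\<close>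
definition H_per_bounded :: "real \<Rightarrow> real \<Rightarrow> nat \<Rightarrow> real \<Rightarrow> (real \<Rightarrow> cvec) \<Rightarrow> bool" where
  "H_per_bounded a b m K u \<longleftrightarrow>
     (\<forall>x. u (x + (b - a)) = u x) \<and>
     (\<exists>D :: nat \<Rightarrow> real \<Rightarrow> cvec. D 0 = u \<and>
        (\<forall>k < m - 1. \<forall>x. (D k has_vector_derivative D (Suc k) x) (at x)) \<and>
        D m integrable_on {a..b} \<and>
        (\<lambda>x. (norm (D m x))\<^sup>2) integrable_on {a..b} \<and>
        (\<forall>x\<in>{a..b}. D (m - 1) x = D (m - 1) a + integral {a..x} (D m)) \<and>
        (\<Sum>k\<le>m. integral {a..b} (\<lambda>x. (norm (D k x))\<^sup>2)) \<le> K\<^sup>2)"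

definition dirac_solution ::
  "real \<Rightarrow> real \<Rightarrow> real \<Rightarrow> (real \<Rightarrow> real) \<Rightarrow> (real \<Rightarrow> real) \<Rightarrow> real \<Rightarrow>
   (real \<Rightarrow> cvec) \<Rightarrow> (real \<Rightarrow> real \<Rightarrow> cvec) \<Rightarrow> bool" where
  "dirac_solution a b \<epsilon> V A1 Tend Phi0 Phi \<longleftrightarrow>
     (\<forall>x. Phi 0 x = Phi0 x) \<and>
     (\<forall>t\<in>{0..Tend}. \<forall>x. Phi t (x + (b - a)) = Phi t x) \<and>
     (\<forall>t\<in>{0..Tend}. \<forall>x. \<exists>Dt Dx.
        ((\<lambda>s. Phi s x) has_vector_derivative Dt) (at t within {0..Tend}) \<and>
        (Phi t has_vector_derivative Dx) (at x) \<and>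
        \<i> *s Dt = (- \<i>) *s (sigma1 *v Dx) + sigma3 *v Phi t x
                  + \<epsilon> *\<^sub>R ((V x *\<^sub>R mat 1 - A1 x *\<^sub>R sigma1) *v Phi t x))"

definition mu :: "real \<Rightarrow> real \<Rightarrow> int \<Rightarrow> real" where
  "mu a b l = 2 * pi * real_of_int l / (b - a)"

definition modes :: "nat \<Rightarrow> int set" where
  "modes M = {- (int M div 2) ..< int M div 2}"

definition grid :: "real \<Rightarrow> real \<Rightarrow> nat \<Rightarrow> nat \<Rightarrow> real" where
  "grid a b M j = a + real j * ((b - a) / real M)"

text \<open>Discrete Fourier coefficients of U = (U_0,...,U_M) in X_M (U_M = U_0).\<close>
definition dft :: "nat \<Rightarrow> (nat \<Rightarrow> cvec) \<Rightarrow> int \<Rightarrow> cvec" where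
  "dft M U l = (\<Sum>j<M. (exp (- 2 * \<i> * of_nat j * of_int l * of_real pi / of_nat M) / of_nat M) *s U j)"

definition interp :: "real \<Rightarrow> real \<Rightarrow> nat \<Rightarrow> (nat \<Rightarrow> cvec) \<Rightarrow> real \<Rightarrow> cvec" where
  "interp a b M U x = (\<Sum>l\<in>modes M. exp (\<i> * of_real (mu a b l * (x - a))) *s dft M U l)"

definition free_flow :: "real \<Rightarrow> real \<Rightarrow> nat \<Rightarrow> real \<Rightarrow> (nat \<Rightarrow> cvec) \<Rightarrow> real \<Rightarrow> cvec" where
  "free_flow a b M s U x = (\<Sum>l\<in>modes M. exp (\<i> * of_real (mu a b l * (x - a))) *s
      (mexp (smat (- \<i> * of_real s) (mu a b l *\<^sub>R sigma1 + sigma3)) *v dft M U l))"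

definition tsfp_step ::
  "real \<Rightarrow> real \<Rightarrow> nat \<Rightarrow> real \<Rightarrow> real \<Rightarrow> (real \<Rightarrow> real) \<Rightarrow> (real \<Rightarrow> real) \<Rightarrow>
   (nat \<Rightarrow> cvec) \<Rightarrow> (nat \<Rightarrow> cvec)" where
  "tsfp_step a b M \<epsilon> \<tau> V A1 U =
     (let U1 = (\<lambda>j. free_flow a b M (\<tau> / 2) U (grid a b M j));
          U2 = (\<lambda>j. mexp (smat (- \<i> * of_real (\<epsilon> * \<tau>))
                   (V (grid a b M j) *\<^sub>R mat 1 - A1 (grid a b M j) *\<^sub>R sigma1)) *v U1 j)
      in (\<lambda>j. free_flow a b M (\<tau> / 2) U2 (grid a b M j)))"

definition tsfp ::
  "real \<Rightarrow> real \<Rightarrow> nat \<Rightarrow> real \<Rightarrow> real \<Rightarrow> (real \<Rightarrow> real) \<Rightarrow> (real \<Rightarrow> real) \<Rightarrow>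
   (real \<Rightarrow> cvec) \<Rightarrow> nat \<Rightarrow> (nat \<Rightarrow> cvec)" where
  "tsfp a b M \<epsilon> \<tau> V A1 Phi0 n = (tsfp_step a b M \<epsilon> \<tau> V A1 ^^ n) (\<lambda>j. Phi0 (grid a b M j))"

definition L2_norm :: "real \<Rightarrow> real \<Rightarrow> (real \<Rightarrow> cvec) \<Rightarrow> real" where
  "L2_norm a b u = sqrt (integral {a..b} (\<lambda>x. (norm (u x))\<^sup>2))"

end

theory Submission
  imports Defs "HOL-Library.Function_Algebras"
begin

text \<open>
  No Fourier integral is used: the exact solution is sampled on a fine grid with \<open>N = q M\<close> points,
  and \<open>q\<close> tends to infinity only at the very end.  The discrete Fourier coefficients
  \<open>\<psi>(t)\<close> of the sampled solution, restricted to the \<open>M\<close> modes of the scheme, satisfy the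
  pseudospectral system \<open>\<psi>' = T \<psi> + \<epsilon> V \<psi> + \<epsilon> r + \<rho>\<close>, where the aliasing error \<open>r\<close> is
  \<open>O(h ^ m)\<close> and \<open>\<rho>\<close> vanishes as \<open>q\<close> tends to infinity.  Since the free flow is integrated
  exactly, every local error carries a factor \<open>\<epsilon> \<tau>\<close>, and since all the flows are unitary,
  the local errors just add up.

  The splitting error is that of the exponential midpoint rule in the interaction picture.  It only
  requires the discrete potential to be bounded on the Sobolev scale up to order two; this,
  as well as the regularity of the solution, is measured by finite differences, for which
  the Leibniz rule is elementary.
\<close>

subsection \<open>Matrix exponentials through their eigenbasis\<close>

text \<open>The order of the limits is dictated by \<open>rho\<close>: replacing the sampled
  x-derivative by multiplication with the frequency is accurate only at frequencies that stay fixed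
  while the fine grid is refined. Hence \<open>M\<close> is frozen and \<open>rho\<close> is summed
  over \<open>modes M\<close> alone. All other constants are uniform in both grids, because the
  passages between grid differences and Fourier weights (\<open>symbol_bounds\<close>) cost factors
  independent of the number of points. The Sobolev weight \<open>om\<close> is taken equal to the
  frequency of the free Dirac flow, so that \<open>F s - 1\<close> costs one weight with constant 1.
  In the final bound, the terms without epsilon occur once each and do not accumulate: aliasing of
  the initial data and truncation at the final time. The m-th derivative of the solution is merely
  square integrable, so m-th differences are controlled in the mean over the grid and not pointwise;
  this is the reason for the energy functions on two periods.\<close>

lemma norm_cvec_sq: "(norm (v::cvec))\<^sup>2 = (cmod (v$1))\<^sup>2 + (cmod (v$2))\<^sup>2"
  by (simp add: norm_vec_def L2_set_def sum_2)

lemma cvec_eqI: "v$1 = w$1 \<Longrightarrow> v$2 = w$2 \<Longrightarrow> v = (w::cvec)"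
  by (simp add: vec_eq_iff forall_2)

lemma norm_vmult: "norm (c *s (v::cvec)) = cmod c * norm v"
proof -
  have "(norm (c *s v))\<^sup>2 = (cmod c * norm v)\<^sup>2"
    by (simp add: norm_cvec_sq norm_mult power_mult_distrib algebra_simps)
  then show ?thesis
    by (smt (verit) norm_ge_zero power2_eq_iff mult_nonneg_nonneg)
qed

lemma bounded_bilinear_vmult: "bounded_bilinear (\<lambda>(c::complex) (v::cvec). c *s v)"
proof
  show "\<exists>K. \<forall>a b. norm (a *s b :: cvec) \<le> norm a * norm b * K"
    by (intro exI[of _ 1]) (simp add: norm_vmult)
qed (auto simp: vec_eq_iff algebra_simps)

lemma scaleR_vmult: "r *\<^sub>R (v::cvec) = of_real r *s v"
  unfolding vec_eq_iff by (simp add: scaleR_conv_of_real[where 'a=complex])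

lemma scaleR_matrix_vmult: "(r *\<^sub>R (X::cmat)) *v u = of_real r *s (X *v u)"
  by (rule cvec_eqI) (simp_all add: matrix_vector_mult_def sum_2 scaleR_conv_of_real[where 'a=complex] algebra_simps)

interpretation vmult: bounded_bilinear "\<lambda>(c::complex) (v::cvec). c *s v"
  by (rule bounded_bilinear_vmult)

text \<open>The coordinates of \<open>v\<close> in the orthonormal basis (cos t, sin t), (- sin t,
  cos t). Real rotations suffice, since the matrices to be diagonalised are combinations of the
  identity, \<open>sigma1\<close> and \<open>sigma3\<close> that are real symmetric up to a scalar
  factor.\<close>

definition rotv :: "real \<Rightarrow> cvec \<Rightarrow> cvec" where
  "rotv t v = (\<chi> i. if i = 1 then of_real (cos t) * v$1 + of_real (sin t) * v$2
                     else - of_real (sin t) * v$1 + of_real (cos t) * v$2)"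

lemma rotv_nth [simp]:
  "rotv t v $ 1 = of_real (cos t) * v$1 + of_real (sin t) * v$2"
  "rotv t v $ 2 = - of_real (sin t) * v$1 + of_real (cos t) * v$2"
  by (simp_all add: rotv_def)

lemma rotv_minus [simp]: "rotv (-t) (rotv t v) = v" "rotv t (rotv (-t) v) = v"
proof -
  have cs: "complex_of_real (cos t) * of_real (cos t) = 1 - of_real (sin t) * of_real (sin t)"
    by (metis of_real_1 of_real_diff of_real_mult power2_eq_square cos_squared_eq)
  have *: "c * (c * p + s * q) + - s * (- s * p + c * q) = p"
    "s * (c * p + s * q) + c * (- s * p + c * q) = q"
    "c * (c * p + - s * q) + s * (s * p + c * q) = p"
    "- s * (c * p + - s * q) + c * (s * p + c * q) = q"
    if "c * c = 1 - s * s" for c s p q :: complex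
    using that by algebra+
  show "rotv (-t) (rotv t v) = v" "rotv t (rotv (-t) v) = v"
    by (rule cvec_eqI; use *[OF cs] in simp)+
qed

lemma norm_rotv [simp]: "norm (rotv t v) = norm v"
proof -
  have le: "norm (rotv t v) \<le> norm v" for t v
  proof -
    have "(cmod (of_real c * p + of_real s * q))\<^sup>2 + (cmod (- of_real s * p + of_real c * q))\<^sup>2
       = (c\<^sup>2 + s\<^sup>2) * ((cmod p)\<^sup>2 + (cmod q)\<^sup>2)" for c s p q
      unfolding cmod_power2 by (simp add: power2_eq_square algebra_simps)
    then have "(norm (rotv t v))\<^sup>2 = (norm v)\<^sup>2"
      by (simp add: norm_cvec_sq)
    then show ?thesis by simp
  qed
  show ?thesis using le[of t v] le[of "-t" "rotv t v"] by simp
qed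

text \<open>The operator with eigenvalues \<open>x\<close>, \<open>y\<close> and orthonormal eigenvectors
  \<open>(cos t, sin t)\<close>, \<open>(- sin t, cos t)\<close>.\<close>

definition spec :: "real \<Rightarrow> complex \<Rightarrow> complex \<Rightarrow> cvec \<Rightarrow> cvec" where
  "spec t x y v = rotv (-t) (\<chi> i. if i = 1 then x * rotv t v $ 1 else y * rotv t v $ 2)"

lemma spec_spec [simp]: "spec t x y (spec t x' y' v) = spec t (x * x') (y * y') v"
proof -
  have "((\<chi> i. if i = 1 then x * rotv t (spec t x' y' v) $ 1 else y * rotv t (spec t x' y' v) $ 2) :: cvec)
      = (\<chi> i. if i = 1 then (x * x') * rotv t v $ 1 else (y * y') * rotv t v $ 2)"
    unfolding spec_def rotv_minus
    by (rule cvec_eqI) (simp_all add: mult.assoc)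
  then show ?thesis unfolding spec_def by simp
qed

lemma spec_1 [simp]: "spec t 1 1 v = v"
proof -
  have "(\<chi> i. if i = 1 then 1 * rotv t v $ 1 else 1 * rotv t v $ 2) = rotv t v"
    by (rule cvec_eqI) simp_all
  then show ?thesis unfolding spec_def by simp
qed

lemma spec_add: "spec t x y (v + w) = spec t x y v + spec t x y w"
  and spec_diff: "spec t x y (v - w) = spec t x y v - spec t x y w"
  and spec_scale: "spec t x y (c *s v) = c *s spec t x y v"
  and spec_add_eigen: "spec t (x + x') (y + y') v = spec t x y v + spec t x' y' v"
  and spec_diff_eigen: "spec t (x - x') (y - y') v = spec t x y v - spec t x' y' v"
  and spec_scale_eigen: "spec t (c * x) (c * y) v = c *s spec t x y v"
  unfolding spec_def by (rule cvec_eqI; simp add: algebra_simps)+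

lemma spec_split: "spec t x y v = x *s spec t 1 0 v + y *s spec t 0 1 v"
  unfolding spec_def by (rule cvec_eqI; simp add: algebra_simps)

lemma norm_spec_le:
  assumes "cmod x \<le> c" "cmod y \<le> c"
  shows "norm (spec t x y v) \<le> c * norm v"
proof -
  have c: "0 \<le> c" using assms(1) norm_ge_zero order_trans by blast
  have "(norm (spec t x y v))\<^sup>2 = (cmod x * cmod (rotv t v $ 1))\<^sup>2 + (cmod y * cmod (rotv t v $ 2))\<^sup>2"
    unfolding spec_def norm_rotv norm_cvec_sq by (simp del: rotv_nth add: norm_mult)
  also have "\<dots> \<le> (c * cmod (rotv t v $ 1))\<^sup>2 + (c * cmod (rotv t v $ 2))\<^sup>2"
    by (intro add_mono power_mono mult_right_mono assms) auto
  also have "\<dots> = (c * norm (rotv t v))\<^sup>2"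
    by (simp del: rotv_nth norm_rotv add: power_mult_distrib norm_cvec_sq algebra_simps)
  finally show ?thesis using c by (simp add: power2_le_iff_abs_le)
qed

text \<open>The operator with the reciprocal eigenvalues is the inverse and gives the reverse
  inequality.\<close>

lemma norm_spec_unit:
  assumes "cmod x = 1" "cmod y = 1"
  shows "norm (spec t x y v) = norm v"
proof (rule antisym)
  show "norm (spec t x y v) \<le> norm v"
    using norm_spec_le[of x 1 y t v] assms by simp
  have "norm (spec t (inverse x) (inverse y) (spec t x y v)) \<le> 1 * norm (spec t x y v)"
    by (rule norm_spec_le) (use assms in \<open>simp_all add: norm_inverse\<close>)
  moreover have "inverse x * x = 1" "inverse y * y = 1" using assms by (metis left_inverse norm_zero zero_neq_one)+
  ultimately show "norm v \<le> norm (spec t x y v)" by simp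
qed

lemma bounded_linear_spec: "bounded_linear (spec t x y)"
proof
  show "\<exists>K. \<forall>v. norm (spec t x y v) \<le> norm v * K"
    by (intro exI[of _ "max (cmod x) (cmod y)"])
       (metis norm_spec_le max.cobounded1 max.cobounded2 mult.commute)
  show "spec t x y (v + w) = spec t x y v + spec t x y w" for v w by (rule spec_add)
  show "spec t x y (r *\<^sub>R v) = r *\<^sub>R spec t x y v" for r v
    by (simp add: scaleR_vmult spec_scale)
qed

text \<open>With Q squared equal to 1, B has the eigenvalues \<alpha> + \<beta> and \<alpha> -
  \<beta> with spectral projections (1 + Q) / 2 and (1 - Q) / 2, so all powers and the series are
  explicit. Both matrix exponentials of the scheme have this form.\<close>

lemma mexp_involution:
  assumes Q: "Q ** Q = mat 1" and B: "B = smat \<alpha> (mat 1) + smat \<beta> Q"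
  shows "mexp B = smat ((exp (\<alpha> + \<beta>) + exp (\<alpha> - \<beta>)) / 2) (mat 1)
                + smat ((exp (\<alpha> + \<beta>) - exp (\<alpha> - \<beta>)) / 2) Q"
proof -
  have sm: "smat c X ** Y = smat c (X ** Y)" "X ** smat c Y = smat c (X ** Y)"
    "smat c (smat d X) = smat (c * d) X" "smat (c + d) X = smat c X + smat d X"
    "smat c (X + Y) = smat c X + smat c Y" "(X + Z) ** Y = X ** Y + Z ** Y" for c d X Y Z
    by (simp_all add: smat_def matrix_matrix_mult_def vec_eq_iff sum_distrib_left sum.distrib algebra_simps)
  have pw: "mpow B k = smat (((\<alpha> + \<beta>) ^ k + (\<alpha> - \<beta>) ^ k) / 2) (mat 1)
                + smat (((\<alpha> + \<beta>) ^ k - (\<alpha> - \<beta>) ^ k) / 2) Q" for k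
  proof (induction k)
    case 0
    show ?case by (simp add: smat_def vec_eq_iff)
  next
    case (Suc k)
    let ?p = "((\<alpha> + \<beta>) ^ k + (\<alpha> - \<beta>) ^ k) / 2" and ?q = "((\<alpha> + \<beta>) ^ k - (\<alpha> - \<beta>) ^ k) / 2"
    have "mpow B (Suc k) = (smat \<alpha> (mat 1) + smat \<beta> Q) ** (smat ?p (mat 1) + smat ?q Q)"
      using Suc B by simp
    also have "\<dots> = smat (\<alpha> * ?p + \<beta> * ?q) (mat 1) + smat (\<alpha> * ?q + \<beta> * ?p) Q"
      by (simp add: matrix_add_ldistrib sm Q algebra_simps)
    also have "\<alpha> * ?p + \<beta> * ?q = ((\<alpha> + \<beta>) ^ Suc k + (\<alpha> - \<beta>) ^ Suc k) / 2"
      by (simp add: field_simps)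
    also have "\<alpha> * ?q + \<beta> * ?p = ((\<alpha> + \<beta>) ^ Suc k - (\<alpha> - \<beta>) ^ Suc k) / 2"
      by (simp add: field_simps)
    finally show ?case .
  qed
  have e: "(\<lambda>k. (1 / fact k) *\<^sub>R z ^ k) sums exp z" for z :: complex
    using exp_converges[of z] by (simp add: inverse_eq_divide)
  have "(\<lambda>k. ((1 / fact k) *\<^sub>R mpow B k) $ i $ j) sums
      ((exp (\<alpha> + \<beta>) + exp (\<alpha> - \<beta>)) / 2 * mat 1 $ i $ j
        + (exp (\<alpha> + \<beta>) - exp (\<alpha> - \<beta>)) / 2 * Q $ i $ j)" for i j
  proof -
    have "(\<lambda>k. ((1 / fact k) *\<^sub>R (\<alpha> + \<beta>) ^ k + (1 / fact k) *\<^sub>R (\<alpha> - \<beta>) ^ k) / 2 * mat 1 $ i $ j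
             + ((1 / fact k) *\<^sub>R (\<alpha> + \<beta>) ^ k - (1 / fact k) *\<^sub>R (\<alpha> - \<beta>) ^ k) / 2 * Q $ i $ j)
        sums ((exp (\<alpha> + \<beta>) + exp (\<alpha> - \<beta>)) / 2 * mat 1 $ i $ j
        + (exp (\<alpha> + \<beta>) - exp (\<alpha> - \<beta>)) / 2 * Q $ i $ j)"
      by (intro sums_add sums_mult2 sums_divide sums_diff e)
    then show ?thesis
      by (simp add: pw smat_def scaleR_conv_of_real[where 'a=complex] algebra_simps add_divide_distrib diff_divide_distrib)
  qed
  then have "(\<lambda>k. (1 / fact k) *\<^sub>R mpow B k) sums
     (smat ((exp (\<alpha> + \<beta>) + exp (\<alpha> - \<beta>)) / 2) (mat 1)
                + smat ((exp (\<alpha> + \<beta>) - exp (\<alpha> - \<beta>)) / 2) Q)"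
    unfolding sums_def
    by (intro vec_tendstoI) (simp add: smat_def sum_component)
  then show ?thesis unfolding mexp_def by (rule sums_unique[symmetric])
qed

text \<open>The reflection that fixes (cos t, sin t) and negates (- sin t, cos t).\<close>

definition reflm :: "real \<Rightarrow> cmat" where
  "reflm t = cos (2*t) *\<^sub>R sigma3 + sin (2*t) *\<^sub>R sigma1"

lemma reflm_nth [simp]:
  "reflm t $ 1 $ 1 = of_real (cos (2*t))" "reflm t $ 1 $ 2 = of_real (sin (2*t))"
  "reflm t $ 2 $ 1 = of_real (sin (2*t))" "reflm t $ 2 $ 2 = - of_real (cos (2*t))"
  by (simp_all add: reflm_def sigma1_def sigma3_def) (simp_all add: scaleR_conv_of_real)

lemma reflm_involution: "reflm t ** reflm t = mat 1"
proof -
  have cs: "complex_of_real (cos (2*t)) * of_real (cos (2*t)) + of_real (sin (2*t)) * of_real (sin (2*t)) = 1"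
    by (metis of_real_1 of_real_add of_real_mult power2_eq_square sin_cos_squared_add2)
  show ?thesis
    by (simp add: vec_eq_iff forall_2 matrix_matrix_mult_def sum_2 mat_def cs)
       (use cs in \<open>simp add: algebra_simps\<close>)
qed

lemma spec_reflm: "spec t x y v = ((x + y) / 2) *s v + ((x - y) / 2) *s (reflm t *v v)"
proof -
  have c: "complex_of_real (cos (2*t)) = of_real (cos t) * of_real (cos t) - of_real (sin t) * of_real (sin t)"
    by (metis cos_double of_real_diff of_real_mult power2_eq_square)
  have s: "complex_of_real (sin (2*t)) = 2 * of_real (sin t) * of_real (cos t)"
    by (metis sin_double of_real_mult of_real_numeral)
  have o: "complex_of_real (cos t) * of_real (cos t) = 1 - of_real (sin t) * of_real (sin t)"
    by (metis of_real_1 of_real_diff of_real_mult power2_eq_square cos_squared_eq)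
  \<comment> \<open>Each coordinate, doubled, is a polynomial identity modulo cos^2 + sin^2 = 1 and
    the double-angle formulas; \<open>h\<close> undoes the doubling.\<close>
  have *: "2 * (c * (x * (c * p + s * q)) + - s * (y * (- s * p + c * q))) =
      (x + y) * p + (x - y) * (c2 * p + s2 * q)"
    "2 * (s * (x * (c * p + s * q)) + c * (y * (- s * p + c * q))) =
      (x + y) * q + (x - y) * (s2 * p - c2 * q)"
    if "c * c = 1 - s * s" "c2 = c * c - s * s" "s2 = 2 * s * c" for c s c2 s2 p q :: complex
    using that by algebra+
  have h: "z = p * r / 2 + q * w / 2" if "2 * z = p * r + q * w" for z p q r w :: complex
    using that by (simp add: field_simps)
  show ?thesis
    unfolding spec_def
    apply (rule cvec_eqI; simp add: matrix_vector_mult_def sum_2 del: mult_minus_left)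
     apply (rule h, use *(1)[OF o c s, of "v$1" "v$2"] in simp)
    by (rule h, use *(2)[OF o c s, of "v$1" "v$2"] in simp)
qed

lemma mexp_spec:
  assumes "B = smat \<alpha> (mat 1) + smat \<beta> (reflm t)"
  shows "mexp B *v v = spec t (exp (\<alpha> + \<beta>)) (exp (\<alpha> - \<beta>)) v"
  unfolding mexp_involution[OF reflm_involution assms] spec_reflm
  by (simp add: smat_def matrix_vector_mult_def vec_eq_iff forall_2 sum_2 mat_def algebra_simps)

text \<open>Origin of the angle pi/4 in all potential operators: they have the same eigenvectors at
  every grid point, whatever the values of V and A1.\<close>

lemma sigma1_reflm: "sigma1 = reflm (pi/4)"
  by (simp add: reflm_def)

lemma norm_sigma1: "norm (sigma1 *v v) = norm v"
proof -
  have "spec (pi/4) 1 (-1) v = sigma1 *v v"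
    by (simp add: spec_reflm sigma1_reflm)
  then show ?thesis using norm_spec_unit[of 1 "-1" "pi/4" v] by simp
qed

section \<open>One-parameter unitary groups on a single coefficient or grid value\<close>

definition gen :: "real \<Rightarrow> real \<Rightarrow> real \<Rightarrow> cvec \<Rightarrow> cvec" where
  "gen t \<alpha> \<beta> = spec t (\<i> * of_real \<alpha>) (\<i> * of_real \<beta>)"

text \<open>The exponential of \<open>s\<close> times \<open>gen t \<alpha> \<beta>\<close>. The
  free flow at one frequency and the potential flow at one grid point are both instances.\<close>

definition grp :: "real \<Rightarrow> real \<Rightarrow> real \<Rightarrow> real \<Rightarrow> cvec \<Rightarrow> cvec" where
  "grp t \<alpha> \<beta> s = spec t (cis (\<alpha> * s)) (cis (\<beta> * s))"

lemma grp_add: "grp t \<alpha> \<beta> s (grp t \<alpha> \<beta> s' v) = grp t \<alpha> \<beta> (s + s') v"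
  by (simp add: grp_def cis_mult algebra_simps)

lemma grp_0 [simp]: "grp t \<alpha> \<beta> 0 v = v"
  by (simp add: grp_def)

lemma norm_grp [simp]: "norm (grp t \<alpha> \<beta> s v) = norm v"
  by (simp add: grp_def norm_spec_unit)

lemma norm_gen_le:
  assumes "\<bar>\<alpha>\<bar> \<le> c" "\<bar>\<beta>\<bar> \<le> c"
  shows "norm (gen t \<alpha> \<beta> v) \<le> c * norm v"
  unfolding gen_def by (rule norm_spec_le) (use assms in \<open>simp_all add: norm_mult\<close>)

lemma cmod_cis_minus_1: "cmod (cis x - 1) = 2 * \<bar>sin (x/2)\<bar>"
proof -
  have "(cmod (cis x - 1))\<^sup>2 = (2 * sin (x/2))\<^sup>2"
  proof -
    have "(cmod (cis x - 1))\<^sup>2 = 2 - 2 * cos x"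
      using sin_cos_squared_add[of x]
      by (simp add: cmod_power2 power2_diff)
    also have "\<dots> = (2 * sin (x/2))\<^sup>2"
      using cos_double_sin[of "x/2"] by (simp add: power_mult_distrib)
    finally show ?thesis .
  qed
  then show ?thesis
    by (smt (verit) norm_ge_zero power2_eq_iff)
qed

lemma cmod_cis_diff_1: "cmod (cis x - 1) \<le> \<bar>x\<bar>"
  using abs_sin_x_le_abs_x[of "x/2"] by (simp add: cmod_cis_minus_1)

lemma norm_grp_diff_le:
  assumes "\<bar>\<alpha>\<bar> \<le> c" "\<bar>\<beta>\<bar> \<le> c"
  shows "norm (grp t \<alpha> \<beta> s v - v) \<le> \<bar>s\<bar> * c * norm v"
proof -
  have *: "cmod (cis (\<gamma> * s) - 1) \<le> \<bar>s\<bar> * c" if "\<bar>\<gamma>\<bar> \<le> c" for \<gamma>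
    using cmod_cis_diff_1[of "\<gamma> * s"] mult_right_mono[OF that, of "\<bar>s\<bar>"]
    by (simp add: abs_mult mult.commute)
  have "grp t \<alpha> \<beta> s v - v = spec t (cis (\<alpha> * s) - 1) (cis (\<beta> * s) - 1) v"
    by (simp add: grp_def spec_diff_eigen)
  then show ?thesis using norm_spec_le[OF *[OF assms(1)] *[OF assms(2)]] by metis
qed

lemma has_vector_derivative_cis: "(cis has_vector_derivative \<i> * cis x) (at x within S)"
  unfolding cis_conv_exp
  by (auto intro!: derivative_eq_intros has_vector_derivative_real_field simp: algebra_simps)

text \<open>Product and chain rule on each eigenvector. With the group pulled to the front and g' =
  -1, the generator inside f' cancels: this is the interaction picture.\<close>

lemma has_vector_derivative_grp:
  assumes f: "(f has_vector_derivative f') (at x within S)"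
    and g: "(g has_real_derivative g') (at x within S)"
  shows "((\<lambda>x. grp t \<alpha> \<beta> (g x) (f x)) has_vector_derivative
     grp t \<alpha> \<beta> (g x) (f' + g' *\<^sub>R gen t \<alpha> \<beta> (f x))) (at x within S)"
proof -
  have c: "((\<lambda>x. cis (\<gamma> * g x)) has_vector_derivative (\<i> * of_real \<gamma> * of_real g') * cis (\<gamma> * g x)) (at x within S)" for \<gamma>
  proof -
    have "((\<lambda>x. cis (\<gamma> * g x)) has_vector_derivative ((\<gamma> * g') *\<^sub>R (\<i> * cis (\<gamma> * g x)))) (at x within S)"
    proof -
      have 1: "((\<lambda>x. \<gamma> * g x) has_vector_derivative \<gamma> * g') (at x within S)"
        using DERIV_cmult[OF g, of \<gamma>] by (simp add: has_real_derivative_iff_has_vector_derivative)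
      show ?thesis using vector_diff_chain_within[OF 1 has_vector_derivative_cis] by (simp add: o_def)
    qed
    then show ?thesis by (simp add: scaleR_conv_of_real algebra_simps)
  qed
  have p: "((\<lambda>x. spec t u v (f x)) has_vector_derivative spec t u v f') (at x within S)" for u v
    by (rule bounded_linear.has_vector_derivative[OF bounded_linear_spec f])
  have "((\<lambda>x. cis (\<alpha> * g x) *s spec t 1 0 (f x) + cis (\<beta> * g x) *s spec t 0 1 (f x)) has_vector_derivative
     (cis (\<alpha> * g x) *s spec t 1 0 f' + (\<i> * of_real \<alpha> * of_real g' * cis (\<alpha> * g x)) *s spec t 1 0 (f x))
   + (cis (\<beta> * g x) *s spec t 0 1 f' + (\<i> * of_real \<beta> * of_real g' * cis (\<beta> * g x)) *s spec t 0 1 (f x)))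
     (at x within S)"
    by (intro has_vector_derivative_add vmult.has_vector_derivative c p)
  moreover have "grp t \<alpha> \<beta> (g x) (f' + g' *\<^sub>R gen t \<alpha> \<beta> (f x)) =
     (cis (\<alpha> * g x) *s spec t 1 0 f' + (\<i> * of_real \<alpha> * of_real g' * cis (\<alpha> * g x)) *s spec t 1 0 (f x))
   + (cis (\<beta> * g x) *s spec t 0 1 f' + (\<i> * of_real \<beta> * of_real g' * cis (\<beta> * g x)) *s spec t 0 1 (f x))"
  proof -
    have "grp t \<alpha> \<beta> (g x) (f' + g' *\<^sub>R gen t \<alpha> \<beta> (f x)) = spec t (cis (\<alpha> * g x)) (cis (\<beta> * g x)) f'
       + spec t (of_real g' * (cis (\<alpha> * g x) * (\<i> * of_real \<alpha>))) (of_real g' * (cis (\<beta> * g x) * (\<i> * of_real \<beta>))) (f x)"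
      unfolding grp_def gen_def spec_add scaleR_vmult spec_scale spec_spec spec_scale_eigen[of t "of_real g'"] ..
    also have "\<dots> = cis (\<alpha> * g x) *s spec t 1 0 f' + cis (\<beta> * g x) *s spec t 0 1 f'
       + ((of_real g' * (cis (\<alpha> * g x) * (\<i> * of_real \<alpha>))) *s spec t 1 0 (f x)
         + (of_real g' * (cis (\<beta> * g x) * (\<i> * of_real \<beta>))) *s spec t 0 1 (f x))"
      by (rule arg_cong2[where f="(+)"]; rule spec_split)
    finally show ?thesis by (simp add: mult_ac add_ac)
  qed
  ultimately show ?thesis
    unfolding grp_def by (subst spec_split) simp
qed

subsection \<open>Discrete Fourier transform\<close>

text \<open>The character exp(2 pi i k / M) of the integers modulo M.\<close>

definition rt :: "nat \<Rightarrow> int \<Rightarrow> complex" where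
  "rt M k = cis (2 * pi * real_of_int k / real M)"

lemma rt_add: "rt M (j + k) = rt M j * rt M k"
  by (simp add: rt_def cis_mult add_divide_distrib distrib_left)

lemma rt_0 [simp]: "rt M 0 = 1"
  by (simp add: rt_def)

lemma norm_rt [simp]: "cmod (rt M k) = 1"
  by (simp add: rt_def)

lemma cnj_rt: "cnj (rt M k) = rt M (- k)"
  by (simp add: rt_def cis_cnj)

lemma rt_power: "rt M (int j * k) = rt M k ^ j"
  by (induction j) (simp_all add: rt_add distrib_right)

lemma rt_scale: "q > 0 \<Longrightarrow> rt (q * M) (int q * k) = rt M k"
  by (simp add: rt_def mult.assoc)

lemma rt_eq_1_iff:
  assumes "M > 0"
  shows "rt M k = 1 \<longleftrightarrow> int M dvd k"
proof
  assume "rt M k = 1"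
  then have "cos (2 * pi * real_of_int k / real M) = 1"
    by (metis rt_def cis.simps(1) one_complex.simps(1))
  then obtain n :: int where "2 * pi * real_of_int k / real M = real_of_int n * 2 * pi"
    using cos_one_2pi_int by blast
  then have "real_of_int k = real_of_int (n * int M)"
    using assms by (simp add: field_simps)
  then have "k = n * int M" using of_int_eq_iff by blast
  then show "int M dvd k" by simp
next
  assume "int M dvd k"
  then obtain n where "k = int M * n" by (elim dvdE)
  then have "rt M k = cis (2 * pi * real_of_int n)" using assms by (simp add: rt_def field_simps)
  then show "rt M k = 1" by (simp add: cis_multiple_2pi)
qed

lemma sum_rt:
  assumes "M > 0"
  shows "(\<Sum>j<M. rt M (int j * k)) = (if int M dvd k then of_nat M else 0)"
proof (cases "int M dvd k")
  case True
  then show ?thesis using assms by (simp add: rt_power rt_eq_1_iff[THEN iffD2])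
next
  case False
  then have "rt M k \<noteq> 1" using rt_eq_1_iff[OF assms] by blast
  moreover have "rt M k ^ M = 1"
    unfolding rt_power[symmetric] using rt_eq_1_iff[OF assms] by simp
  ultimately show ?thesis using False by (simp add: rt_power geometric_sum)
qed

lemma finite_modes [simp]: "finite (modes M)"
  by (simp add: modes_def)

lemma mem_modes: "l \<in> modes M \<Longrightarrow> 2 * \<bar>l\<bar> \<le> int M"
  by (auto simp: modes_def)

lemma modes_cong_unique:
  assumes "even M" "l \<in> modes M" "l' \<in> modes M" "int M dvd l' - l"
  shows "l' = l"
proof -
  have "\<bar>l' - l\<bar> < int M" using assms(1-3) by (auto simp: modes_def)
  then show ?thesis using assms(4) zdvd_not_zless
    by (metis abs_0_eq abs_ge_zero dvd_abs_iff eq_iff_diff_eq_0 order_le_less)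
qed

lemma sum_rt_modes:
  assumes "M > 0" "even M"
  shows "(\<Sum>l\<in>modes M. rt M (l * k)) = (if int M dvd k then of_nat M else 0)"
proof -
  let ?H = "int M div 2"
  have "(\<Sum>l\<in>modes M. rt M (l * k)) = (\<Sum>j<M. rt M ((int j - ?H) * k))"
  proof (rule sum.reindex_bij_witness[where j="\<lambda>l. nat (l + ?H)" and i="\<lambda>j. int j - ?H"])
  qed (use assms in \<open>auto simp: modes_def\<close>)
  also have "\<dots> = rt M (- ?H * k) * (\<Sum>j<M. rt M (int j * k))"
    by (simp add: sum_distrib_left flip: rt_add) (simp add: algebra_simps)
  also have "\<dots> = (if int M dvd k then of_nat M else 0)"
  proof (cases "int M dvd k")
    case True
    then have "rt M (- ?H * k) = 1" using rt_eq_1_iff[OF assms(1)] by auto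
    then show ?thesis using True by (simp add: sum_rt[OF assms(1)])
  qed (simp add: sum_rt[OF assms(1)])
  finally show ?thesis .
qed

lemma dft_rt: "dft M U l = (\<Sum>j<M. (rt M (- (int j * l)) / of_nat M) *s U j)"
proof -
  have "exp (- 2 * \<i> * of_nat j * of_int l * of_real pi / of_nat M) = rt M (- (int j * l))" for j
    unfolding rt_def cis_conv_exp by (rule arg_cong[where f=exp]) (simp add: field_simps)
  then show ?thesis unfolding dft_def by simp
qed

text \<open>Grid values of the trigonometric polynomial with coefficients \<open>g\<close>; inverse
  to \<open>dft\<close> by \<open>dft_ev\<close> and \<open>ev_dft\<close>.\<close>

definition ev :: "nat \<Rightarrow> (int \<Rightarrow> cvec) \<Rightarrow> nat \<Rightarrow> cvec" where
  "ev M g j = (\<Sum>l\<in>modes M. rt M (int j * l) *s g l)"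

text \<open>Orthogonality of characters keeps exactly the frequencies that the M-point grid cannot
  distinguish from l. With S = \<open>modes M\<close> this inverts the transform; with the modes of
  a finer grid it is the aliasing formula.\<close>

lemma dft_trig_sum:
  assumes M: "M > 0" and S: "finite S"
  shows "dft M (\<lambda>j. \<Sum>l'\<in>S. rt M (int j * l') *s c l') l = (\<Sum>l'\<in>{l'\<in>S. int M dvd l' - l}. c l')"
proof -
  have "dft M (\<lambda>j. \<Sum>l'\<in>S. rt M (int j * l') *s c l') l
      = (\<Sum>j<M. \<Sum>l'\<in>S. (rt M (int j * (l' - l)) / of_nat M) *s c l')"
    unfolding dft_rt vmult.sum_right
    by (intro sum.cong refl) (simp add: vector_smult_assoc algebra_simps flip: rt_add)
  also have "\<dots> = (\<Sum>l'\<in>S. ((\<Sum>j<M. rt M (int j * (l' - l))) / of_nat M) *s c l')"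
    by (subst sum.swap) (simp add: sum_divide_distrib vmult.sum_left)
  also have "\<dots> = (\<Sum>l'\<in>S. if int M dvd l' - l then c l' else 0)"
    by (intro sum.cong refl) (use M in \<open>simp add: sum_rt\<close>)
  also have "\<dots> = (\<Sum>l'\<in>{l'\<in>S. int M dvd l' - l}. c l')"
    using S by (simp add: sum.inter_filter)
  finally show ?thesis .
qed

lemma dft_ev:
  assumes "M > 0" "even M" "l \<in> modes M"
  shows "dft M (ev M g) l = g l"
proof -
  have "{l'\<in>modes M. int M dvd l' - l} = {l}"
    using modes_cong_unique[OF assms(2,3)] assms(3) by auto
  then show ?thesis
    unfolding ev_def dft_trig_sum[OF assms(1) finite_modes] by simp
qed

lemma ev_dft:
  assumes "M > 0" "even M" "j < M"
  shows "ev M (dft M U) j = U j"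
proof -
  have "ev M (dft M U) j = (\<Sum>l\<in>modes M. \<Sum>j'<M. (rt M (l * (int j - int j')) / of_nat M) *s U j')"
    unfolding ev_def dft_rt vmult.sum_right
    by (intro sum.cong refl) (simp add: vector_smult_assoc algebra_simps flip: rt_add)
  also have "\<dots> = (\<Sum>j'<M. ((\<Sum>l\<in>modes M. rt M (l * (int j - int j'))) / of_nat M) *s U j')"
    by (subst sum.swap) (simp add: sum_divide_distrib vmult.sum_left)
  also have "\<dots> = (\<Sum>j'<M. if j' = j then U j' else 0)"
  proof (intro sum.cong refl)
    fix j' assume "j' \<in> {..<M}"
    then have "\<bar>int j - int j'\<bar> < int M" using assms(3) by auto
    then have "int M dvd int j - int j' \<longleftrightarrow> j' = j"
      by (metis abs_0_eq abs_ge_zero dvd_0_right dvd_abs_iff eq_iff_diff_eq_0 of_nat_eq_iff order_le_less zdvd_not_zless)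
    then show "((\<Sum>l\<in>modes M. rt M (l * (int j - int j'))) / of_nat M) *s U j' = (if j' = j then U j' else 0)"
      using assms(1,2) by (simp add: sum_rt_modes)
  qed
  also have "\<dots> = U j" using assms(3) by simp
  finally show ?thesis .
qed

lemma dft_cong: "(\<And>j. j < M \<Longrightarrow> U j = U' j) \<Longrightarrow> dft M U l = dft M U' l"
  unfolding dft_rt by (intro sum.cong) auto

lemma dft_add: "dft M (\<lambda>j. U j + U' j) l = dft M U l + dft M U' l"
  by (simp add: dft_rt vmult.add_right sum.distrib)

lemma dft_diff: "dft M (\<lambda>j. U j - U' j) l = dft M U l - dft M U' l"
  by (simp add: dft_rt vmult.diff_right sum_subtractf)

lemma dft_scale: "dft M (\<lambda>j. c *s U j) l = c *s dft M U l"
  by (simp add: dft_rt vmult.sum_right vector_smult_assoc mult_ac)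

lemma ev_add: "ev M (\<lambda>j. U j + U' j) l = ev M U l + ev M U' l"
  by (simp add: ev_def vmult.add_right sum.distrib)

lemma ev_diff: "ev M (\<lambda>j. U j - U' j) l = ev M U l - ev M U' l"
  by (simp add: ev_def vmult.diff_right sum_subtractf)

lemma ev_periodic: "M > 0 \<Longrightarrow> ev M g (j + M) = ev M g j"
proof -
  assume M: "M > 0"
  have "rt M (int (j + M) * l) = rt M (int j * l)" for l
    using rt_eq_1_iff[OF M, of "int M * l"] by (simp add: distrib_right rt_add)
  then show ?thesis by (simp add: ev_def)
qed

text \<open>In the sum of \<open>cnj c * c\<close> only the conjugated factor is expanded by
  definition; the inversion formula then resums the other one. The normalisation of
  \<open>dft\<close> is the source of the factors \<open>sqrt N\<close> in all later grid
  bounds.\<close>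

lemma parseval:
  assumes "M > 0" "even M"
  shows "L2_set (\<lambda>l. norm (dft M U l)) (modes M) = L2_set (\<lambda>j. norm (U j)) {..<M} / sqrt (real M)"
proof -
  have comp: "(\<Sum>l\<in>modes M. (cmod (dft M U l $ i))\<^sup>2) = (\<Sum>j<M. (cmod (U j $ i))\<^sup>2) / real M" for i
  proof -
    have cnj_dft: "cnj (dft M U l $ i) = (\<Sum>j<M. rt M (int j * l) / of_nat M * cnj (U j $ i))" for l
      by (simp add: dft_rt sum_component cnj_rt)
    have inv: "(\<Sum>l\<in>modes M. rt M (int j * l) * dft M U l $ i) = U j $ i" if "j < M" for j
      using arg_cong[OF ev_dft[OF assms that, of U], of "\<lambda>v. v $ i"]
      by (simp add: ev_def sum_component)
    have "complex_of_real (\<Sum>l\<in>modes M. (cmod (dft M U l $ i))\<^sup>2)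
        = (\<Sum>l\<in>modes M. \<Sum>j<M. rt M (int j * l) / of_nat M * cnj (U j $ i) * dft M U l $ i)"
      by (simp add: complex_norm_square cnj_dft sum_distrib_left mult.commute del: of_real_power)
    also have "\<dots> = (\<Sum>j<M. cnj (U j $ i) / of_nat M * (\<Sum>l\<in>modes M. rt M (int j * l) * dft M U l $ i))"
      by (subst sum.swap) (simp add: sum_distrib_left mult_ac)
    also have "\<dots> = (\<Sum>j<M. cnj (U j $ i) / of_nat M * U j $ i)"
      by (intro sum.cong refl) (simp add: inv)
    also have "\<dots> = complex_of_real ((\<Sum>j<M. (cmod (U j $ i))\<^sup>2) / real M)"
      by (simp add: complex_norm_square sum_divide_distrib mult.commute del: of_real_power)
    finally show ?thesis using of_real_eq_iff by blast
  qed
  have "(\<Sum>l\<in>modes M. (norm (dft M U l))\<^sup>2) = (\<Sum>j<M. (norm (U j))\<^sup>2) / real M"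
    by (simp add: norm_cvec_sq sum.distrib comp add_divide_distrib)
  then show ?thesis by (simp add: L2_set_def real_sqrt_divide)
qed

lemma L2_ev:
  assumes "M > 0" "even M"
  shows "L2_set (\<lambda>j. norm (ev M g j)) {..<M} = sqrt (real M) * L2_set (\<lambda>l. norm (g l)) (modes M)"
proof -
  have "L2_set (\<lambda>l. norm (g l)) (modes M) = L2_set (\<lambda>l. norm (dft M (ev M g) l)) (modes M)"
    by (intro L2_set_cong refl) (simp add: dft_ev assms)
  then show ?thesis using assms by (simp add: parseval)
qed

subsection \<open>Forward differences\<close>

text \<open>Differences are left undivided; smoothness is expressed by explicit factors h ^ k in the
  bounds.\<close>

definition dd :: "(nat \<Rightarrow> 'a::ab_group_add) \<Rightarrow> nat \<Rightarrow> 'a" where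
  "dd U j = U (Suc j) - U j"

lemma dd_pow_periodic:
  assumes "\<And>j. U (j + N) = U j"
  shows "(dd ^^ k) U (j + N) = (dd ^^ k) U j"
proof (induction k arbitrary: j)
  case (Suc k)
  show ?case using Suc[of j] Suc[of "Suc j"] by (simp add: dd_def)
qed (simp add: assms)

lemma dd_pow_shift: "(dd ^^ k) (\<lambda>j. U (Suc j)) j = (dd ^^ k) U (Suc j)"
  by (induction k arbitrary: j) (simp_all add: dd_def)

lemma dd_pow_add: "(dd ^^ k) (\<lambda>j. U j + U' j) j = (dd ^^ k) U j + (dd ^^ k) U' j"
  by (induction k arbitrary: j) (simp_all add: dd_def)

lemma dd_pow_linear:
  assumes "linear f"
  shows "(dd ^^ k) (\<lambda>j. f (U j)) j = f ((dd ^^ k) U j)"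
  by (induction k arbitrary: j) (simp_all add: dd_def linear_diff[OF assms])

lemma L2_norm_triangle:
  "L2_set (\<lambda>j. norm (f j + g j)) J \<le> L2_set (\<lambda>j. norm (f j)) J + L2_set (\<lambda>j. norm (g j)) J"
  by (rule order_trans[OF L2_set_mono L2_set_triangle_ineq]) (auto intro: norm_triangle_ineq)

text \<open>In the product rule the index shift is put on \<open>c\<close>, whose bound is uniform
  in j, so the index set J of the mean-square norm never moves. Each application doubles the number
  of terms, whence 2 ^ k.\<close>

lemma dd_pow_leibniz:
  fixes c :: "nat \<Rightarrow> real" and U :: "nat \<Rightarrow> 'a::real_normed_vector"
  assumes "\<And>i j. i \<le> k \<Longrightarrow> \<bar>(dd ^^ i) c j\<bar> \<le> A * h ^ i"
    and "\<And>i. i \<le> k \<Longrightarrow> L2_set (\<lambda>j. norm ((dd ^^ i) U j)) J \<le> B * h ^ i"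
    and h: "0 \<le> h"
  shows "L2_set (\<lambda>j. norm ((dd ^^ k) (\<lambda>j. c j *\<^sub>R U j) j)) J \<le> 2 ^ k * A * B * h ^ k"
  using assms(1,2)
proof (induction k arbitrary: c U A B)
  case 0
  have A: "\<bar>c j\<bar> \<le> A" for j using 0(1)[of 0 j] by simp
  then have "0 \<le> A" using order_trans[OF abs_ge_zero] by blast
  have "L2_set (\<lambda>j. norm (c j *\<^sub>R U j)) J \<le> L2_set (\<lambda>j. A * norm (U j)) J"
    by (intro L2_set_mono) (auto intro: mult_right_mono A)
  also have "\<dots> = A * L2_set (\<lambda>j. norm (U j)) J"
    using \<open>0 \<le> A\<close> by (simp add: L2_set_right_distrib)
  also have "\<dots> \<le> A * B" using 0(2)[of 0] \<open>0 \<le> A\<close> by (intro mult_left_mono) auto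
  finally show ?case by simp
next
  case (Suc k)
  have sw: "(dd ^^ Suc i) W = (dd ^^ i) (dd W)" for i and W :: "nat \<Rightarrow> 'b::ab_group_add"
    by (simp add: funpow_swap1)
  have prod: "dd (\<lambda>j. c j *\<^sub>R U j) = (\<lambda>j. c (Suc j) *\<^sub>R dd U j + dd c j *\<^sub>R U j)"
    by (auto simp: dd_def algebra_simps)
  have 1: "L2_set (\<lambda>j. norm ((dd ^^ k) (\<lambda>j. c (Suc j) *\<^sub>R dd U j) j)) J \<le> 2 ^ k * A * (B * h) * h ^ k"
  proof (rule Suc.IH)
    show "\<bar>(dd ^^ i) (\<lambda>j. c (Suc j)) j\<bar> \<le> A * h ^ i" if "i \<le> k" for i j
      unfolding dd_pow_shift using Suc.prems(1)[of i] that by auto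
    show "L2_set (\<lambda>j. norm ((dd ^^ i) (dd U) j)) J \<le> B * h * h ^ i" if "i \<le> k" for i
      using Suc.prems(2)[of "Suc i"] that by (simp add: sw mult_ac del: funpow.simps)
  qed
  have 2: "L2_set (\<lambda>j. norm ((dd ^^ k) (\<lambda>j. dd c j *\<^sub>R U j) j)) J \<le> 2 ^ k * (A * h) * B * h ^ k"
  proof (rule Suc.IH)
    show "\<bar>(dd ^^ i) (dd c) j\<bar> \<le> A * h * h ^ i" if "i \<le> k" for i j
      using Suc.prems(1)[of "Suc i" j] that by (simp add: sw mult_ac del: funpow.simps)
    show "L2_set (\<lambda>j. norm ((dd ^^ i) U j)) J \<le> B * h ^ i" if "i \<le> k" for i
      using Suc.prems(2)[of i] that by simp
  qed
  show ?case
    unfolding sw prod dd_pow_add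
    using L2_norm_triangle[of "(dd ^^ k) (\<lambda>j. c (Suc j) *\<^sub>R dd U j)" "(dd ^^ k) (\<lambda>j. dd c j *\<^sub>R U j)" J] 1 2
    by (simp add: mult_ac)
qed

text \<open>Summation by parts; periodicity cancels the boundary term.\<close>

lemma dft_dd:
  assumes M: "M > 0" and per: "\<And>j. U (j + M) = U j"
  shows "dft M (dd U) l = (rt M l - 1) *s dft M U l"
proof -
  let ?f = "\<lambda>j. (rt M (- (int j * l)) / of_nat M) *s U j"
  have f: "?f M = ?f 0"
    using per[of 0] rt_eq_1_iff[OF M, of "- (int M * l)"] by simp
  have "(\<Sum>j<M. (rt M (- (int j * l)) / of_nat M) *s U (Suc j)) = (\<Sum>j<M. rt M l *s ?f (Suc j))"
    by (intro sum.cong refl) (simp add: vector_smult_assoc algebra_simps flip: rt_add)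
  also have "\<dots> = rt M l *s (\<Sum>j<M. ?f (Suc j))" by (simp add: vmult.sum_right)
  also have "(\<Sum>j<M. ?f (Suc j)) = (\<Sum>j<M. ?f j)"
    using sum.lessThan_Suc[of ?f M] sum.lessThan_Suc_shift[of ?f M] f by simp
  finally show ?thesis
    by (simp add: dd_def[abs_def] dft_diff) (simp add: dft_rt vmult.diff_left)
qed

lemma norm_dft_dd_pow:
  assumes M: "M > 0" and per: "\<And>j. U (j + M) = U j"
  shows "norm (dft M ((dd ^^ k) U) l) = cmod (rt M l - 1) ^ k * norm (dft M U l)"
proof (induction k)
  case (Suc k)
  have "dft M ((dd ^^ Suc k) U) l = (rt M l - 1) *s dft M ((dd ^^ k) U) l"
    using dft_dd[OF M, of "(dd ^^ k) U" l] dd_pow_periodic[of U M k] per by simp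
  then show ?case using Suc by (simp only: norm_vmult power_Suc mult.assoc)
qed simp

text \<open>By concavity the sine lies above its chord from 0 to pi / 2.\<close>

lemma jordan_sin:
  assumes "0 \<le> x" "x \<le> pi / 2"
  shows "2 * x / pi \<le> sin x"
proof -
  have c: "concave_on {0..pi} sin"
    by (rule f''_le0_imp_concave[where f'=cos and f''="\<lambda>x. - sin x"])
       (auto intro!: derivative_eq_intros sin_ge_zero)
  have "(1 - 2*x/pi) * sin 0 + (2*x/pi) * sin (pi/2) \<le> sin ((1 - 2*x/pi) *\<^sub>R 0 + (2*x/pi) *\<^sub>R (pi/2))"
    by (rule concave_onD[OF c]) (use assms in \<open>auto simp: field_simps\<close>)
  then show ?thesis by simp
qed

text \<open>The symbol has modulus 2 sin(pi |l| / M), and on \<open>modes M\<close> the argument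
  stays in [0, pi / 2]. There sine is comparable to its argument, so grid differences and frequency
  weights are equivalent uniformly in M.\<close>

lemma symbol_bounds:
  assumes M: "M > 0" and l: "l \<in> modes M"
  shows "4 * \<bar>real_of_int l\<bar> / real M \<le> cmod (rt M l - 1)"
    and "cmod (rt M l - 1) \<le> 2 * pi * \<bar>real_of_int l\<bar> / real M"
proof -
  let ?x = "pi * \<bar>real_of_int l\<bar> / real M"
  have "2 * \<bar>real_of_int l\<bar> \<le> real M" using mem_modes[OF l] by linarith
  then have x: "0 \<le> ?x" "?x \<le> pi / 2" using M by (auto simp: field_simps)
  have e: "cmod (rt M l - 1) = 2 * sin ?x"
  proof -
    have "\<bar>sin (2 * pi * real_of_int l / real M / 2)\<bar> = \<bar>sin ?x\<bar>"
      by (cases "l \<ge> 0") (simp_all)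
    then show ?thesis using x sin_ge_zero[of ?x] by (simp add: rt_def cmod_cis_minus_1)
  qed
  show "4 * \<bar>real_of_int l\<bar> / real M \<le> cmod (rt M l - 1)"
    unfolding e using jordan_sin[OF x] M by (simp add: field_simps)
  show "cmod (rt M l - 1) \<le> 2 * pi * \<bar>real_of_int l\<bar> / real M"
    unfolding e using sin_x_le_x[OF x(1)] by simp
qed

subsection \<open>Sobolev norms of trigonometric polynomials\<close>

text \<open>The matrix -i (v I - w sigma1): on the eigenvectors of \<open>sigma1\<close> with
  eigenvalues 1 and -1 it acts as i (w - v) and i (- v - w).\<close>

definition pot :: "real \<Rightarrow> real \<Rightarrow> cvec \<Rightarrow> cvec" where
  "pot v w = gen (pi/4) (w - v) (- v - w)"

lemma pot_sigma1: "pot v w u = (- \<i>) *s (v *\<^sub>R u) + \<i> *s (w *\<^sub>R (sigma1 *v u))"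
proof -
  have "(\<i> * of_real (w - v) + \<i> * of_real (- v - w)) / 2 = - \<i> * of_real v"
    "(\<i> * of_real (w - v) - \<i> * of_real (- v - w)) / 2 = \<i> * of_real w"
    by (simp_all add: algebra_simps)
  then show ?thesis
    by (simp add: pot_def gen_def spec_reflm sigma1_reflm scaleR_vmult vector_smult_assoc)
qed

lemma linear_vmult: "linear (\<lambda>u::cvec. c *s u)"
  by (intro linearI) (simp_all add: scaleR_vmult vector_smult_assoc mult.commute vmult.add_right)

lemma linear_sigma1: "linear (\<lambda>u::cvec. sigma1 *v u)"
  by (intro linearI) (simp_all add: matrix_vector_right_distrib scaleR_vmult matrix_vector_mult_scaleR vec.scale)

lemma dd_pow_pot:
  assumes v: "\<And>i j. i \<le> k \<Longrightarrow> \<bar>(dd ^^ i) v j\<bar> \<le> A * h ^ i"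
    and w: "\<And>i j. i \<le> k \<Longrightarrow> \<bar>(dd ^^ i) w j\<bar> \<le> A * h ^ i"
    and U: "\<And>i. i \<le> k \<Longrightarrow> L2_set (\<lambda>j. norm ((dd ^^ i) U j)) J \<le> B * h ^ i"
    and h: "0 \<le> h"
  shows "L2_set (\<lambda>j. norm ((dd ^^ k) (\<lambda>j. pot (v j) (w j) (U j)) j)) J \<le> 2 ^ Suc k * A * B * h ^ k"
proof -
  have U': "L2_set (\<lambda>j. norm ((dd ^^ i) (\<lambda>j. sigma1 *v U j) j)) J \<le> B * h ^ i" if "i \<le> k" for i
    using U[OF that] by (simp add: dd_pow_linear[OF linear_sigma1] norm_sigma1)
  have "L2_set (\<lambda>j. norm ((dd ^^ k) (\<lambda>j. pot (v j) (w j) (U j)) j)) J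
     \<le> L2_set (\<lambda>j. norm ((dd ^^ k) (\<lambda>j. (- \<i>) *s (v j *\<^sub>R U j)) j)) J
      + L2_set (\<lambda>j. norm ((dd ^^ k) (\<lambda>j. \<i> *s (w j *\<^sub>R (sigma1 *v U j))) j)) J"
    unfolding pot_sigma1 dd_pow_add by (rule L2_norm_triangle)
  also have "\<dots> = L2_set (\<lambda>j. norm ((dd ^^ k) (\<lambda>j. v j *\<^sub>R U j) j)) J
      + L2_set (\<lambda>j. norm ((dd ^^ k) (\<lambda>j. w j *\<^sub>R (sigma1 *v U j)) j)) J"
    unfolding dd_pow_linear[OF linear_vmult] norm_vmult by simp
  also have "\<dots> \<le> 2 ^ k * A * B * h ^ k + 2 ^ k * A * B * h ^ k"
    by (intro add_mono dd_pow_leibniz v w U U' h)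
  finally show ?thesis by (simp add: mult_ac)
qed

section \<open>Weighted norms of Fourier coefficients and pointwise multiplication\<close>

locale torus =
  fixes a b :: real
  assumes ab: "a < b"
begin

text \<open>Both the Sobolev weight and the modulus of the eigenvalues of mu sigma1 + sigma3, see
  \<open>om_reflm\<close>.\<close>

definition om :: "int \<Rightarrow> real" where
  "om l = sqrt (1 + (mu a b l)\<^sup>2)"

text \<open>The H^k norm of a trigonometric polynomial. Only \<open>modes M\<close> are seen, so
  inserting the coefficients of a finer transform amounts to truncating it.\<close>

definition nrm :: "nat \<Rightarrow> nat \<Rightarrow> (int \<Rightarrow> cvec) \<Rightarrow> real" where
  "nrm M k g = L2_set (\<lambda>l. om l ^ k * norm (g l)) (modes M)"

lemma om_ge_1: "1 \<le> om l"
  by (simp add: om_def)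

lemma om_ge_mu: "\<bar>mu a b l\<bar> \<le> om l"
  by (simp add: om_def real_le_rsqrt)

lemma om_le: "om l \<le> 1 + \<bar>mu a b l\<bar>"
  unfolding om_def by (rule real_le_lsqrt) (auto simp: power2_eq_square algebra_simps)

lemma om_pow_le: "om l ^ k \<le> 2 ^ k * (1 + \<bar>mu a b l\<bar> ^ k)"
proof -
  have "om l ^ k \<le> (2 * max 1 \<bar>mu a b l\<bar>) ^ k"
    using om_le[of l] om_ge_1[of l] by (intro power_mono) auto
  also have "\<dots> \<le> 2 ^ k * (1 + \<bar>mu a b l\<bar> ^ k)"
    unfolding power_mult_distrib by (intro mult_left_mono) (auto simp: max_def)
  finally show ?thesis .
qed

lemma nrm_nonneg [simp]: "0 \<le> nrm M k g"
  by (simp add: nrm_def)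

lemma nrm_0: "nrm M 0 g = L2_set (\<lambda>l. norm (g l)) (modes M)"
  by (simp add: nrm_def)

lemma nrm_cong: "(\<And>l. l \<in> modes M \<Longrightarrow> norm (g l) = norm (g' l)) \<Longrightarrow> nrm M k g = nrm M k g'"
  unfolding nrm_def by (intro L2_set_cong) auto

lemma nrm_le:
  assumes "\<And>l. l \<in> modes M \<Longrightarrow> om l ^ k * norm (g l) \<le> c * (om l ^ k' * norm (g' l))" "0 \<le> c"
  shows "nrm M k g \<le> c * nrm M k' g'"
proof -
  have "nrm M k g \<le> L2_set (\<lambda>l. c * (om l ^ k' * norm (g' l))) (modes M)"
    unfolding nrm_def using om_ge_1 by (intro L2_set_mono assms) (auto simp: order_trans[OF zero_le_one])
  then show ?thesis using assms(2) by (simp add: nrm_def L2_set_right_distrib)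
qed

lemma nrm_mono: "k \<le> k' \<Longrightarrow> nrm M k g \<le> nrm M k' g"
  using nrm_le[of M k g 1 k' g] by (simp add: mult_right_mono power_increasing om_ge_1)

lemma nrm_triangle: "nrm M k (f + g) \<le> nrm M k f + nrm M k g"
proof -
  have "nrm M k (f + g) \<le> L2_set (\<lambda>l. om l ^ k * norm (f l) + om l ^ k * norm (g l)) (modes M)"
    unfolding nrm_def using om_ge_1
    by (intro L2_set_mono)
       (auto simp: order_trans[OF zero_le_one] norm_triangle_ineq simp flip: distrib_left
             intro!: mult_left_mono)
  also have "\<dots> \<le> nrm M k f + nrm M k g"
    unfolding nrm_def by (rule L2_set_triangle_ineq)
  finally show ?thesis .
qed

lemma nrm_scale: "nrm M k (\<lambda>l. r *\<^sub>R g l) = \<bar>r\<bar> * nrm M k g"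
  unfolding nrm_def by (simp add: L2_set_right_distrib mult_ac)

lemma nrm_minus_commute: "nrm M k (f - g) = nrm M k (g - f)"
  by (intro nrm_cong) (simp add: norm_minus_commute)

lemma nrm_triangle3: "nrm M k (f - g) \<le> nrm M k (f - e) + nrm M k (e - g)"
  using nrm_triangle[of M k "f - e" "e - g"] by simp

text \<open>By \<open>symbol_bounds\<close> one power of |l| is worth N / 4 differences, and each
  difference is worth (b - a) / N; N cancels, so the bound does not see the fine grid.\<close>

lemma sobolev_dft_weight:
  assumes N: "N > 0" "even N" and per: "\<And>j. U (j + N) = U j"
    and U: "L2_set (\<lambda>j. norm ((dd ^^ k) U j)) {..<N} \<le> B * sqrt N * ((b - a) / N) ^ k"
  shows "L2_set (\<lambda>l. \<bar>real_of_int l\<bar> ^ k * norm (dft N U l)) (modes N) \<le> B * ((b - a) / 4) ^ k"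
proof -
  have "L2_set (\<lambda>l. \<bar>real_of_int l\<bar> ^ k * norm (dft N U l)) (modes N)
      \<le> L2_set (\<lambda>l. (N / 4) ^ k * norm (dft N ((dd ^^ k) U) l)) (modes N)"
  proof (rule L2_set_mono)
    fix l assume l: "l \<in> modes N"
    have "\<bar>real_of_int l\<bar> \<le> N / 4 * cmod (rt N l - 1)"
      using symbol_bounds(1)[OF N(1) l] N by (simp add: field_simps)
    then have "\<bar>real_of_int l\<bar> ^ k \<le> (N / 4) ^ k * cmod (rt N l - 1) ^ k"
      unfolding power_mult_distrib[symmetric] by (intro power_mono) auto
    then show "\<bar>real_of_int l\<bar> ^ k * norm (dft N U l) \<le> (N / 4) ^ k * norm (dft N ((dd ^^ k) U) l)"
      unfolding norm_dft_dd_pow[OF N(1), of U, OF per]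
      by (metis mult.assoc mult_right_mono norm_ge_zero)
  qed auto
  also have "\<dots> = (N / 4) ^ k * L2_set (\<lambda>l. norm (dft N ((dd ^^ k) U) l)) (modes N)"
    by (simp add: L2_set_right_distrib)
  also have "\<dots> = (N / 4) ^ k * (L2_set (\<lambda>j. norm ((dd ^^ k) U j)) {..<N} / sqrt N)"
    by (simp add: parseval[OF N])
  also have "\<dots> \<le> (N / 4) ^ k * (B * ((b - a) / N) ^ k)"
    using U N by (intro mult_left_mono) (auto simp: field_simps)
  also have "\<dots> = B * ((N / 4) * ((b - a) / N)) ^ k"
    by (simp only: power_mult_distrib mult_ac)
  also have "(N / 4) * ((b - a) / N) = (b - a) / 4" using N by simp
  finally show ?thesis .
qed

text \<open>The weight \<open>om l ^ k\<close> is dominated by 1 and the k-th power of the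
  frequency, so only the differences of order 0 and k are needed. The ratio pi / 2 is (2 pi / (b -
  a)) * ((b - a) / 4).\<close>

lemma sobolev_dft:
  assumes N: "N > 0" "even N" and per: "\<And>j. U (j + N) = U j"
    and U0: "L2_set (\<lambda>j. norm (U j)) {..<N} \<le> B * sqrt N"
    and U: "L2_set (\<lambda>j. norm ((dd ^^ k) U j)) {..<N} \<le> B * sqrt N * ((b - a) / N) ^ k"
  shows "nrm N k (dft N U) \<le> 2 ^ k * (1 + (pi / 2) ^ k) * B"
proof -
  let ?c = "(2 * pi / (b - a)) ^ k"
  have mu: "\<bar>mu a b l\<bar> ^ k = ?c * \<bar>real_of_int l\<bar> ^ k" for l
    using ab by (simp add: mu_def abs_mult flip: power_mult_distrib)
  have "nrm N k (dft N U) \<le> L2_set (\<lambda>l. 2 ^ k * (norm (dft N U l) + ?c * (\<bar>real_of_int l\<bar> ^ k * norm (dft N U l)))) (modes N)"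
    unfolding nrm_def
  proof (rule L2_set_mono)
    fix l
    show "om l ^ k * norm (dft N U l) \<le> 2 ^ k * (norm (dft N U l) + ?c * (\<bar>real_of_int l\<bar> ^ k * norm (dft N U l)))"
      using mult_right_mono[OF om_pow_le[of l k], of "norm (dft N U l)"]
      by (simp add: mu algebra_simps)
  qed (use om_ge_1 in \<open>auto simp: order_trans[OF zero_le_one]\<close>)
  also have "\<dots> = 2 ^ k * L2_set (\<lambda>l. norm (dft N U l) + ?c * (\<bar>real_of_int l\<bar> ^ k * norm (dft N U l))) (modes N)"
    by (simp add: L2_set_right_distrib)
  also have "\<dots> \<le> 2 ^ k * (L2_set (\<lambda>l. norm (dft N U l)) (modes N)
       + L2_set (\<lambda>l. ?c * (\<bar>real_of_int l\<bar> ^ k * norm (dft N U l))) (modes N))"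
    by (intro mult_left_mono L2_set_triangle_ineq) auto
  also have "L2_set (\<lambda>l. ?c * (\<bar>real_of_int l\<bar> ^ k * norm (dft N U l))) (modes N)
      = ?c * L2_set (\<lambda>l. \<bar>real_of_int l\<bar> ^ k * norm (dft N U l)) (modes N)"
    using ab by (subst L2_set_right_distrib) auto
  also have "2 ^ k * (L2_set (\<lambda>l. norm (dft N U l)) (modes N) + \<dots>) \<le> 2 ^ k * (B + ?c * (B * ((b - a) / 4) ^ k))"
  proof (intro mult_left_mono add_mono sobolev_dft_weight[OF N per U])
    show "L2_set (\<lambda>l. norm (dft N U l)) (modes N) \<le> B"
      unfolding parseval[OF N] using U0 N by (simp add: field_simps)
  qed (use ab in auto)
  also have "?c * (B * ((b - a) / 4) ^ k) = B * (2 * pi / (b - a) * ((b - a) / 4)) ^ k"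
    by (simp only: power_mult_distrib mult_ac)
  also have "2 * pi / (b - a) * ((b - a) / 4) = pi / 2" using ab by simp
  finally show ?thesis by (simp add: algebra_simps)
qed

text \<open>The converse passage, from weights back to differences, through the upper bound for the
  symbol.\<close>

lemma L2_dd_ev:
  assumes M: "M > 0" "even M" and "i \<le> k"
  shows "L2_set (\<lambda>j. norm ((dd ^^ i) (ev M g) j)) {..<M} \<le> nrm M k g * sqrt M * ((b - a) / M) ^ i"
proof -
  note per = ev_periodic[OF M(1), of g]
  have "L2_set (\<lambda>j. norm ((dd ^^ i) (ev M g) j)) {..<M}
      = sqrt M * L2_set (\<lambda>l. norm (dft M ((dd ^^ i) (ev M g)) l)) (modes M)"
    unfolding parseval[OF M] using M by simp
  also have "L2_set (\<lambda>l. norm (dft M ((dd ^^ i) (ev M g)) l)) (modes M)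
      \<le> L2_set (\<lambda>l. ((b - a) / M) ^ i * (om l ^ k * norm (g l))) (modes M)"
  proof (rule L2_set_mono)
    fix l assume l: "l \<in> modes M"
    have "cmod (rt M l - 1) \<le> (b - a) / M * \<bar>mu a b l\<bar>"
      using symbol_bounds(2)[OF M(1) l] ab by (simp add: mu_def abs_mult)
    also have "\<dots> \<le> (b - a) / M * om l"
      using ab om_ge_mu by (intro mult_left_mono) auto
    finally have "cmod (rt M l - 1) ^ i \<le> ((b - a) / M) ^ i * om l ^ i"
      unfolding power_mult_distrib[symmetric] by (intro power_mono) auto
    also have "\<dots> \<le> ((b - a) / M) ^ i * om l ^ k"
      using ab om_ge_1 assms(3) by (intro mult_left_mono power_increasing) auto
    finally show "norm (dft M ((dd ^^ i) (ev M g)) l) \<le> ((b - a) / M) ^ i * (om l ^ k * norm (g l))"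
      unfolding norm_dft_dd_pow[OF M(1), of "ev M g", OF per] dft_ev[OF M l]
      by (metis mult.assoc mult_right_mono norm_ge_zero)
  qed auto
  also have "\<dots> = ((b - a) / M) ^ i * nrm M k g"
    unfolding nrm_def using ab by (subst L2_set_right_distrib) auto
  finally show ?thesis using M by (simp add: mult_ac mult_left_mono)
qed

text \<open>Pseudospectral multiplication: products are formed at the grid points, so frequencies
  beyond \<open>modes M\<close> are folded back.\<close>

definition Vop :: "nat \<Rightarrow> (nat \<Rightarrow> real) \<Rightarrow> (nat \<Rightarrow> real) \<Rightarrow> (int \<Rightarrow> cvec) \<Rightarrow> int \<Rightarrow> cvec" where
  "Vop M v w g = dft M (\<lambda>j. pot (v j) (w j) (ev M g j))"

text \<open>Weights are turned into differences, the discrete Leibniz rule is applied, and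
  differences are turned back into weights of the same order. No derivative is lost, and the folding
  of frequencies never has to be examined.\<close>

lemma nrm_Vop_le:
  assumes M: "M > 0" "even M" and k: "k \<le> 2"
    and per: "\<And>j. v (j + M) = v j" "\<And>j. w (j + M) = w j"
    and v: "\<And>i j. i \<le> 2 \<Longrightarrow> \<bar>(dd ^^ i) v j\<bar> \<le> A * ((b - a) / M) ^ i"
    and w: "\<And>i j. i \<le> 2 \<Longrightarrow> \<bar>(dd ^^ i) w j\<bar> \<le> A * ((b - a) / M) ^ i"
  shows "nrm M k (Vop M v w g) \<le> 160 * A * nrm M k g"
proof -
  have A: "0 \<le> A" using v[of 0 0] by (simp add: order_trans[OF abs_ge_zero])
  let ?U = "\<lambda>j. pot (v j) (w j) (ev M g j)" and ?B = "nrm M k g"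
  have h: "0 \<le> (b - a) / M" using ab by simp
  have L: "L2_set (\<lambda>j. norm ((dd ^^ i) ?U j)) {..<M} \<le> 2 ^ Suc i * A * (?B * sqrt M) * ((b - a) / M) ^ i"
    if "i \<le> k" for i
    by (rule dd_pow_pot[OF v w _ h]) (use that k in \<open>auto intro!: L2_dd_ev[OF M]\<close>)
  have "nrm M k (dft M ?U) \<le> 2 ^ k * (1 + (pi / 2) ^ k) * (2 ^ Suc k * A * ?B)"
  proof (rule sobolev_dft[OF M])
    show "pot (v (j + M)) (w (j + M)) (ev M g (j + M)) = pot (v j) (w j) (ev M g j)" for j
      by (simp add: per ev_periodic[OF M(1)])
    show "L2_set (\<lambda>j. norm ((dd ^^ k) ?U j)) {..<M} \<le> 2 ^ Suc k * A * ?B * sqrt M * ((b - a) / M) ^ k"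
      using L[of k] by (simp add: mult_ac)
    have "(2::real) ^ Suc 0 * (A * (?B * sqrt M)) \<le> 2 ^ Suc k * (A * (?B * sqrt M))"
      using A by (intro mult_right_mono power_increasing) auto
    then show "L2_set (\<lambda>j. norm (?U j)) {..<M} \<le> 2 ^ Suc k * A * ?B * sqrt M"
      using L[of 0] by (simp add: mult_ac)
  qed
  also have "\<dots> = (2 ^ k * (1 + (pi / 2) ^ k) * 2 ^ Suc k) * (A * ?B)" by simp
  also have "\<dots> \<le> 160 * (A * ?B)"
  proof (rule mult_right_mono)
    \<comment> \<open>For k <= 2 the factors are at most 4, 1 + 4 and 8, which gives 160.\<close>
    have "(pi / 2) ^ k \<le> 2 ^ k" using pi_less_4 by (intro power_mono) auto
    also have "(2::real) ^ k \<le> 2 ^ 2" using k by (intro power_increasing) auto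
    finally have "(pi / 2) ^ k \<le> 4" by simp
    moreover have "(2::real) ^ k \<le> 2 ^ 2" "(2::real) ^ Suc k \<le> 2 ^ Suc 2" using k by (intro power_increasing; simp)+
    ultimately have "2 ^ k * (1 + (pi / 2) ^ k) * 2 ^ Suc k \<le> 4 * 5 * 8"
      by (intro mult_mono) auto
    then show "2 ^ k * (1 + (pi / 2) ^ k) * 2 ^ Suc k \<le> 160" by simp
  qed (use A in auto)
  finally show ?thesis by (simp add: Vop_def mult_ac)
qed

end

subsection \<open>Aliasing\<close>

text \<open>Telescoping of 1 / k^2 <= 1 / (k - 1) - 1 / k. The step to n = 1 is separate, since 1 /
  0 is 0 there.\<close>

lemma sum_inverse_squares_nat: "(\<Sum>k=1..n. 1 / (real k)\<^sup>2) \<le> 2 - 1 / real n"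
proof (induction n)
  case (Suc n)
  show ?case
  proof (cases "n = 0")
    case False
    then have "1 / (real n + 1)\<^sup>2 \<le> 1 / (real n * (real n + 1))"
      by (intro divide_left_mono) (auto simp: power2_eq_square)
    also have "\<dots> = 1 / real n - 1 / (real n + 1)"
      using False by (simp add: field_simps)
    finally show ?thesis using Suc by (simp add: add.commute)
  qed simp
qed simp

lemma sum_inverse_squares_int:
  assumes "finite K" "0 \<notin> K"
  shows "(\<Sum>k\<in>K. 1 / (real_of_int k)\<^sup>2) \<le> 4"
proof -
  have half: "(\<Sum>k\<in>K. 1 / (real_of_int k)\<^sup>2) \<le> 2" if K: "finite K" and inj: "inj_on abs K" and "0 \<notin> K" for K
  proof -
    obtain n where n: "\<And>k. k \<in> K \<Longrightarrow> nat \<bar>k\<bar> \<le> n"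
      using K by (metis finite_nat_set_iff_bounded_le finite_imageI imageI)
    have "(\<Sum>k\<in>K. 1 / (real_of_int k)\<^sup>2) = (\<Sum>k\<in>(\<lambda>k. nat \<bar>k\<bar>) ` K. 1 / (real k)\<^sup>2)"
      using inj by (subst sum.reindex) (auto simp: inj_on_def eq_nat_nat_iff)
    also have "\<dots> \<le> (\<Sum>k=1..n. 1 / (real k)\<^sup>2)"
    proof (rule sum_mono2)
      show "(\<lambda>k. nat \<bar>k\<bar>) ` K \<subseteq> {1..n}"
        using n that(3) by (force simp: Suc_le_eq)
    qed auto
    also have "\<dots> \<le> 2" using sum_inverse_squares_nat[of n] by (simp add: order_trans)
    finally show ?thesis .
  qed
  have "k \<noteq> 0" if "k \<in> K" for k using that assms(2) by metis
  then have "k \<in> K \<longleftrightarrow> k \<in> {k\<in>K. 0 < k} \<union> {k\<in>K. k < 0}" for k by force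
  then have "K = {k\<in>K. 0 < k} \<union> {k\<in>K. k < 0}" by blast
  then have "(\<Sum>k\<in>K. 1 / (real_of_int k)\<^sup>2) = (\<Sum>k\<in>{k\<in>K. 0 < k}. 1 / (real_of_int k)\<^sup>2) + (\<Sum>k\<in>{k\<in>K. k < 0}. 1 / (real_of_int k)\<^sup>2)"
    using assms(1) sum.union_disjoint[of "{k\<in>K. 0 < k}" "{k\<in>K. k < 0}"] by force
  also have "\<dots> \<le> 2 + 2"
    by (intro add_mono half) (use assms(1) in \<open>auto simp: inj_on_def\<close>)
  finally show ?thesis by simp
qed

lemma modes_subset: "q > 0 \<Longrightarrow> modes M \<subseteq> modes (q * M)"
proof -
  assume "q > 0"
  then have "M \<le> q * M" by simp
  then have "int M div 2 \<le> int (q * M) div 2" by (intro zdiv_mono1) (auto simp del: of_nat_mult)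
  then show ?thesis by (auto simp: modes_def)
qed

lemma not_in_modes: "even M \<Longrightarrow> l \<notin> modes M \<Longrightarrow> int M \<le> 2 * \<bar>l\<bar>"
  by (auto simp: modes_def)

text \<open>Outside \<open>modes M\<close> the inequality 2 |l| >= M trades m powers of the
  frequency for (2 / M) ^ m.\<close>

lemma dft_tail:
  assumes M: "M > 0" "even M"
    and W: "L2_set (\<lambda>l. \<bar>real_of_int l\<bar> ^ m * norm (c l)) (modes N) \<le> W"
  shows "L2_set (\<lambda>l. norm (c l)) (modes N - modes M) \<le> (2 / M) ^ m * W"
proof -
  have "L2_set (\<lambda>l. norm (c l)) (modes N - modes M)
      \<le> L2_set (\<lambda>l. (2 / M) ^ m * (\<bar>real_of_int l\<bar> ^ m * norm (c l))) (modes N - modes M)"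
  proof (rule L2_set_mono)
    fix l assume "l \<in> modes N - modes M"
    then have "real M \<le> 2 * \<bar>real_of_int l\<bar>" using not_in_modes[OF M(2)] by force
    then have "1 \<le> (2 / M) * \<bar>real_of_int l\<bar>" using M by (simp add: field_simps)
    then have "1 \<le> (2 / M) ^ m * \<bar>real_of_int l\<bar> ^ m"
      by (metis one_le_power power_mult_distrib)
    then show "norm (c l) \<le> (2 / M) ^ m * (\<bar>real_of_int l\<bar> ^ m * norm (c l))"
      by (metis mult.assoc mult_1 mult_right_mono norm_ge_zero)
  qed auto
  also have "\<dots> = (2 / M) ^ m * L2_set (\<lambda>l. \<bar>real_of_int l\<bar> ^ m * norm (c l)) (modes N - modes M)"
    by (subst L2_set_right_distrib) auto
  also have "L2_set (\<lambda>l. \<bar>real_of_int l\<bar> ^ m * norm (c l)) (modes N - modes M)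
      \<le> L2_set (\<lambda>l. \<bar>real_of_int l\<bar> ^ m * norm (c l)) (modes N)"
    unfolding L2_set_def by (intro real_sqrt_le_mono sum_mono2) auto
  finally show ?thesis using W M
    by (smt (verit) mult_left_mono divide_nonneg_nonneg of_nat_0_le_iff zero_le_power)
qed

text \<open>The error at l is the sum over the other frequencies of its residue class modulo M.
  Cauchy-Schwarz with the weights |l'| ^ m and their reciprocals separates a factor O(M ^ -m) from a
  weighted sum over the class; the classes are disjoint, so the weighted sums add up to at most W.
  The factor 2 is the root of the bound 4 for the inverse squares.\<close>

lemma dft_alias:
  assumes M: "M > 0" "even M" and q: "q > 0" and m: "m \<ge> 1"
    and W: "L2_set (\<lambda>l. \<bar>real_of_int l\<bar> ^ m * norm (dft (q * M) U l)) (modes (q * M)) \<le> W"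
  shows "L2_set (\<lambda>l. norm (dft M (\<lambda>j. U (q * j)) l - dft (q * M) U l)) (modes M) \<le> 2 * (2 / M) ^ m * W"
proof -
  let ?N = "q * M"
  let ?c = "dft ?N U"
  define R where "R l = {l'\<in>modes ?N. int M dvd l' - l} - {l}" for l
  define g where "g l = \<bar>real_of_int l\<bar> ^ m * norm (?c l)" for l
  have N: "?N > 0" "even ?N" using M q by auto
  have W0: "0 \<le> W" using W by (rule order_trans[OF L2_set_nonneg])
  have diff: "dft M (\<lambda>j. U (q * j)) l - ?c l = (\<Sum>l'\<in>R l. ?c l')" if l: "l \<in> modes M" for l
  proof -
    have "dft M (\<lambda>j. U (q * j)) l = dft M (\<lambda>j. \<Sum>l'\<in>modes ?N. rt M (int j * l') *s ?c l') l"
    proof (rule dft_cong)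
      fix j assume "j < M"
      then have "U (q * j) = ev ?N ?c (q * j)" using ev_dft[OF N, of "q * j" U] q by simp
      also have "\<dots> = (\<Sum>l'\<in>modes ?N. rt M (int j * l') *s ?c l')"
        unfolding ev_def by (intro sum.cong refl) (simp add: mult.assoc rt_scale[OF q])
      finally show "U (q * j) = (\<Sum>l'\<in>modes ?N. rt M (int j * l') *s ?c l')" .
    qed
    also have "\<dots> = (\<Sum>l'\<in>{l'\<in>modes ?N. int M dvd l' - l}. ?c l')"
      by (rule dft_trig_sum[OF M(1) finite_modes])
    also have "\<dots> = ?c l + (\<Sum>l'\<in>R l. ?c l')"
      unfolding R_def by (rule sum.remove) (use l modes_subset[OF q] in auto)
    finally show ?thesis by simp
  qed
  have Rnm: "real M \<le> 2 * \<bar>real_of_int l'\<bar>" if "l \<in> modes M" "l' \<in> R l" for l l'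
  proof -
    have "l' \<notin> modes M" using that modes_cong_unique[OF M(2) that(1)] by (auto simp: R_def)
    then show ?thesis using not_in_modes[OF M(2)] by force
  qed
  have inv: "L2_set (\<lambda>l'. 1 / \<bar>real_of_int l'\<bar> ^ m) (R l) \<le> 2 * (2 / M) ^ m" if l: "l \<in> modes M" for l
  proof -
    let ?k = "\<lambda>l'. (l' - l) div int M"
    have "(1 / \<bar>real_of_int l'\<bar> ^ m)\<^sup>2 \<le> ((2 / M) ^ m)\<^sup>2 * (1 / (real_of_int (?k l'))\<^sup>2)" if l': "l' \<in> R l" for l'
    proof -
      obtain k where k: "l' = l + int M * k" "k \<noteq> 0" using l' by (auto simp: R_def dvd_def algebra_simps)
      have kk: "?k l' = k" using k M by simp
      \<comment> \<open>M |k| = |l' - l| <= |l'| + M / 2 <= 2 |l'|, since l' lies outside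
        \<open>modes M\<close>.\<close>
      have "int M * \<bar>k\<bar> \<le> 2 * \<bar>l'\<bar>"
      proof -
        have "int M * \<bar>k\<bar> = \<bar>l' - l\<bar>" using k by (simp add: abs_mult)
        moreover have "2 * \<bar>l\<bar> \<le> int M" by (rule mem_modes[OF l])
        moreover have "int M \<le> 2 * \<bar>l'\<bar>" using Rnm[OF l l'] by linarith
        moreover have "int M * 1 \<le> int M * \<bar>k\<bar>" using k(2) by (intro mult_left_mono) auto
        ultimately show ?thesis by linarith
      qed
      then have "real M * \<bar>real_of_int k\<bar> \<le> 2 * \<bar>real_of_int l'\<bar>"
        by (metis (mono_tags, lifting) of_int_abs of_int_le_iff of_int_mult of_int_numeral of_int_of_nat_eq)
      moreover have pos: "0 < \<bar>real_of_int l'\<bar>" "0 < \<bar>real_of_int k\<bar>" using Rnm[OF l l'] M k(2) by auto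
      ultimately have "1 / \<bar>real_of_int l'\<bar> \<le> (2 / M) * (1 / \<bar>real_of_int k\<bar>)"
        using M by (simp add: field_simps)
      then have "(1 / \<bar>real_of_int l'\<bar>) ^ m \<le> ((2 / M) * (1 / \<bar>real_of_int k\<bar>)) ^ m"
        by (intro power_mono) auto
      also have "\<dots> = (2 / M) ^ m * (1 / \<bar>real_of_int k\<bar>) ^ m" by (rule power_mult_distrib)
      \<comment> \<open>All decay in k beyond the first power is given away; after squaring, inverse
        squares are summable.\<close>
      also have "\<dots> \<le> (2 / M) ^ m * (1 / \<bar>real_of_int k\<bar>) ^ 1"
        using k(2) m by (intro mult_left_mono power_decreasing) auto
      finally have "1 / \<bar>real_of_int l'\<bar> ^ m \<le> (2 / M) ^ m * (1 / \<bar>real_of_int k\<bar>)"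
        by (simp add: power_one_over)
      then have "(1 / \<bar>real_of_int l'\<bar> ^ m)\<^sup>2 \<le> ((2 / M) ^ m * (1 / \<bar>real_of_int k\<bar>))\<^sup>2"
        by (intro power_mono) auto
      then show ?thesis unfolding kk by (simp add: power_mult_distrib power_divide)
    qed
    then have "(\<Sum>l'\<in>R l. (1 / \<bar>real_of_int l'\<bar> ^ m)\<^sup>2) \<le> (\<Sum>l'\<in>R l. ((2 / M) ^ m)\<^sup>2 * (1 / (real_of_int (?k l'))\<^sup>2))"
      by (rule sum_mono)
    also have "\<dots> = ((2 / M) ^ m)\<^sup>2 * (\<Sum>k\<in>?k ` R l. 1 / (real_of_int k)\<^sup>2)"
    proof -
      have "inj_on ?k (R l)"
        using M by (auto simp: inj_on_def R_def elim!: dvdE)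
      then show ?thesis by (simp add: sum.reindex sum_distrib_left)
    qed
    also have "\<dots> \<le> ((2 / M) ^ m)\<^sup>2 * 4"
      by (intro mult_left_mono sum_inverse_squares_int) (use M in \<open>auto simp: R_def elim!: dvdE\<close>)
    finally have "(\<Sum>l'\<in>R l. (1 / \<bar>real_of_int l'\<bar> ^ m)\<^sup>2) \<le> (2 * (2 / M) ^ m)\<^sup>2"
      by (simp add: power_mult_distrib mult_ac)
    then show ?thesis unfolding L2_set_def by (intro real_le_lsqrt) (auto intro: sum_nonneg)
  qed
  have le: "norm (dft M (\<lambda>j. U (q * j)) l - ?c l) \<le> 2 * (2 / M) ^ m * L2_set g (R l)" if l: "l \<in> modes M" for l
  proof -
    have "norm (\<Sum>l'\<in>R l. ?c l') \<le> (\<Sum>l'\<in>R l. \<bar>1 / \<bar>real_of_int l'\<bar> ^ m\<bar> * \<bar>g l'\<bar>)"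
    proof (rule sum_norm_le)
      fix l' assume "l' \<in> R l"
      then have "0 < \<bar>real_of_int l'\<bar>" using Rnm[OF l] M by force
      then show "norm (?c l') \<le> \<bar>1 / \<bar>real_of_int l'\<bar> ^ m\<bar> * \<bar>g l'\<bar>" by (simp add: g_def)
    qed
    also have "\<dots> \<le> L2_set (\<lambda>l'. 1 / \<bar>real_of_int l'\<bar> ^ m) (R l) * L2_set g (R l)"
      by (rule L2_set_mult_ineq)
    also have "\<dots> \<le> 2 * (2 / M) ^ m * L2_set g (R l)"
      by (intro mult_right_mono inv l) auto
    finally show ?thesis unfolding diff[OF l] .
  qed
  have "L2_set (\<lambda>l. norm (dft M (\<lambda>j. U (q * j)) l - ?c l)) (modes M)
     \<le> L2_set (\<lambda>l. 2 * (2 / M) ^ m * L2_set g (R l)) (modes M)"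
    by (intro L2_set_mono le) auto
  also have "\<dots> = 2 * (2 / M) ^ m * L2_set (\<lambda>l. L2_set g (R l)) (modes M)"
    by (subst L2_set_right_distrib) auto
  also have "L2_set (\<lambda>l. L2_set g (R l)) (modes M) \<le> W"
  proof -
    have "(\<Sum>l\<in>modes M. (L2_set g (R l))\<^sup>2) = (\<Sum>l\<in>modes M. \<Sum>l'\<in>R l. (g l')\<^sup>2)"
      by (simp add: L2_set_def sum_nonneg)
    also have "\<dots> = (\<Sum>l'\<in>(\<Union>l\<in>modes M. R l). (g l')\<^sup>2)"
    proof (rule sum.UNION_disjoint[symmetric])
      show "\<forall>i\<in>modes M. \<forall>j\<in>modes M. i \<noteq> j \<longrightarrow> R i \<inter> R j = {}"
      proof (intro ballI impI, rule ccontr)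
        fix i j assume ij: "i \<in> modes M" "j \<in> modes M" "i \<noteq> j" "R i \<inter> R j \<noteq> {}"
        then obtain l' where "int M dvd l' - i" "int M dvd l' - j" by (auto simp: R_def)
        then have "int M dvd (l' - j) - (l' - i)" by (rule dvd_diff[rotated])
        then show False using modes_cong_unique[OF M(2) ij(2,1)] ij(3) by simp
      qed
    qed (auto simp: R_def)
    also have "\<dots> \<le> (\<Sum>l'\<in>modes ?N. (g l')\<^sup>2)"
      by (rule sum_mono2) (auto simp: R_def)
    finally have "L2_set (\<lambda>l. L2_set g (R l)) (modes M) \<le> L2_set g (modes ?N)"
      unfolding L2_set_def[of "\<lambda>l. L2_set g (R l)"] L2_set_def[of g "modes ?N"]
      by (rule real_sqrt_le_mono)
    then show ?thesis using W by (simp add: g_def[abs_def])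
  qed
  finally show ?thesis by (simp add: mult_left_mono)
qed

subsection \<open>Error of one Strang splitting step\<close>

text \<open>Pairing \<open>y s\<close> with the fixed total increment gives a real function
  \<open>\<phi>\<close> to which the scalar mean value theorem applies; Cauchy-Schwarz then removes
  one factor of the norm.\<close>

lemma L2_set_mean_value:
  fixes y :: "real \<Rightarrow> 'i \<Rightarrow> 'a::real_inner"
  assumes fin: "finite I" and uv: "u \<le> v"
    and c: "\<And>l. l \<in> I \<Longrightarrow> 0 \<le> c l"
    and d: "\<And>s l. s \<in> {u..v} \<Longrightarrow> l \<in> I \<Longrightarrow> ((\<lambda>s. y s l) has_vector_derivative y' s l) (at s within {u..v})"
    and B: "\<And>s. s \<in> {u..v} \<Longrightarrow> L2_set (\<lambda>l. c l * norm (y' s l)) I \<le> B"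
  shows "L2_set (\<lambda>l. c l * norm (y v l - y u l)) I \<le> (v - u) * B"
proof (cases "u = v")
  case True
  then show ?thesis by (simp add: L2_set_def)
next
  case False
  then have "u < v" using uv by simp
  define X where "X = L2_set (\<lambda>l. c l * norm (y v l - y u l)) I"
  define \<phi> where "\<phi> s = (\<Sum>l\<in>I. (c l)\<^sup>2 * ((y v l - y u l) \<bullet> y s l))" for s
  define \<phi>' where "\<phi>' s = (\<Sum>l\<in>I. (c l)\<^sup>2 * ((y v l - y u l) \<bullet> y' s l))" for s
  have der: "(\<phi> has_derivative (\<lambda>h. h * \<phi>' s)) (at s within {u..v})" if "s \<in> {u..v}" for s
  proof -
    have "(\<phi> has_vector_derivative \<phi>' s) (at s within {u..v})"
      unfolding \<phi>_def[abs_def] \<phi>'_def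
      by (intro has_vector_derivative_sum has_vector_derivative_mult_right
          bounded_linear.has_vector_derivative[OF bounded_linear_inner_right] d that)
    then show ?thesis by (simp add: has_vector_derivative_def mult.commute)
  qed
  obtain s where s: "s \<in> {u<..<v}" "\<phi> v - \<phi> u = (v - u) * \<phi>' s"
    using mvt_simple[OF \<open>u < v\<close>, of \<phi> "\<lambda>s h. h * \<phi>' s"] der by (metis atLeastAtMost_iff)
  have X2: "X\<^sup>2 = \<phi> v - \<phi> u"
  proof -
    have "X\<^sup>2 = (\<Sum>l\<in>I. (c l * norm (y v l - y u l))\<^sup>2)"
      unfolding X_def L2_set_def by (intro real_sqrt_pow2 sum_nonneg) auto
    also have "\<dots> = \<phi> v - \<phi> u"
      unfolding \<phi>_def sum_subtractf[symmetric]
      by (intro sum.cong refl)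
         (simp add: power_mult_distrib power2_norm_eq_inner inner_diff_right algebra_simps)
    finally show ?thesis .
  qed
  have "\<phi>' s \<le> (\<Sum>l\<in>I. \<bar>c l * norm (y v l - y u l)\<bar> * \<bar>c l * norm (y' s l)\<bar>)"
    unfolding \<phi>'_def
  proof (rule sum_mono)
    fix l assume l: "l \<in> I"
    have "(y v l - y u l) \<bullet> y' s l \<le> norm (y v l - y u l) * norm (y' s l)"
      by (rule norm_cauchy_schwarz)
    then have "(c l)\<^sup>2 * ((y v l - y u l) \<bullet> y' s l) \<le> (c l)\<^sup>2 * (norm (y v l - y u l) * norm (y' s l))"
      by (intro mult_left_mono) auto
    then show "(c l)\<^sup>2 * ((y v l - y u l) \<bullet> y' s l) \<le> \<bar>c l * norm (y v l - y u l)\<bar> * \<bar>c l * norm (y' s l)\<bar>"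
      using c[OF l] by (simp add: power2_eq_square mult_ac abs_mult)
  qed
  also have "\<dots> \<le> X * L2_set (\<lambda>l. c l * norm (y' s l)) I"
    unfolding X_def by (rule L2_set_mult_ineq)
  also have "\<dots> \<le> X * B"
    using B[of s] s(1) by (intro mult_left_mono) (auto simp: X_def)
  finally have "X\<^sup>2 \<le> (v - u) * (X * B)"
    unfolding X2 s(2) using \<open>u < v\<close> by simp
  moreover have "0 \<le> X" by (simp add: X_def)
  moreover have "0 \<le> B" using order_trans[OF L2_set_nonneg B[of u]] uv by simp
  ultimately have "X \<le> (v - u) * B"
    using \<open>u < v\<close> by (cases "X = 0") (auto simp: power2_eq_square mult_ac)
  then show ?thesis by (simp add: X_def)
qed

text \<open>The second difference factors into two first differences.\<close>

lemma cmod_cis_second_diff: "cmod (cis x + cis (- x) - 2) \<le> x\<^sup>2"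
proof -
  have "cis x + cis (- x) - 2 = (cis x - 1) * (1 - cis (- x))"
    by (simp add: algebra_simps cis_mult)
  then have "cmod (cis x + cis (- x) - 2) = cmod (cis x - 1) * cmod (cis (- x) - 1)"
    by (simp add: norm_mult norm_minus_commute)
  also have "\<dots> \<le> \<bar>x\<bar> * \<bar>-x\<bar>" by (intro mult_mono cmod_cis_diff_1) auto
  finally show ?thesis by (simp add: power2_eq_square)
qed

lemma norm_grp_second_diff:
  assumes "\<bar>\<alpha>\<bar> = c" "\<bar>\<beta>\<bar> = c"
  shows "norm (grp t \<alpha> \<beta> s v + grp t \<alpha> \<beta> (- s) v - v - v) \<le> s\<^sup>2 * c\<^sup>2 * norm v"
proof -
  have *: "cmod (cis (\<gamma> * s) + cis (\<gamma> * - s) - 1 - 1) \<le> s\<^sup>2 * c\<^sup>2" if "\<bar>\<gamma>\<bar> = c" for \<gamma>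
    using cmod_cis_second_diff[of "\<gamma> * s"] that by (auto simp: power_mult_distrib mult.commute)
  have "grp t \<alpha> \<beta> s v + grp t \<alpha> \<beta> (- s) v - v - v
    = spec t (cis (\<alpha> * s) + cis (\<alpha> * - s) - 1 - 1) (cis (\<beta> * s) + cis (\<beta> * - s) - 1 - 1) v"
    by (simp only: grp_def spec_diff_eigen spec_add_eigen spec_1)
  then show ?thesis using norm_spec_le[OF *[OF assms(1)] *[OF assms(2)]] by metis
qed

section \<open>The free Dirac flow in Fourier variables\<close>

context torus
begin

text \<open>Half the polar angle of (1, mu), because \<open>reflm\<close> doubles its argument; thus
  \<open>reflm (th l)\<close> is (sigma3 + mu sigma1) / om.\<close>

definition th :: "int \<Rightarrow> real" where
  "th l = arctan (mu a b l) / 2"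

definition F :: "real \<Rightarrow> (int \<Rightarrow> cvec) \<Rightarrow> int \<Rightarrow> cvec" where
  "F s g l = grp (th l) (- om l) (om l) s (g l)"

lemma om_reflm: "om l *\<^sub>R reflm (th l) = mu a b l *\<^sub>R sigma1 + sigma3"
proof -
  have "om l \<noteq> 0" using om_ge_1[of l] by linarith
  then have "om l * cos (arctan (mu a b l)) = 1" "om l * sin (arctan (mu a b l)) = mu a b l"
    by (simp_all add: cos_arctan sin_arctan om_def)
  then show ?thesis by (simp add: reflm_def th_def scaleR_add_right)
qed

lemma mexp_F:
  "mexp (smat (- \<i> * of_real s) (mu a b l *\<^sub>R sigma1 + sigma3)) *v g l = F s g l"
proof -
  have "smat (- \<i> * of_real s) (mu a b l *\<^sub>R sigma1 + sigma3)
      = smat 0 (mat 1) + smat (- \<i> * of_real (s * om l)) (reflm (th l))"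
    unfolding om_reflm[symmetric] by (simp add: smat_def vec_eq_iff) (simp add: scaleR_conv_of_real)
  from mexp_spec[OF this] show ?thesis
    unfolding F_def grp_def cis_conv_exp by (simp add: mult_ac)
qed

lemma gen_F: "gen (th l) (- om l) (om l) u = (- \<i>) *s ((mu a b l *\<^sub>R sigma1 + sigma3) *v u)"
  unfolding om_reflm[symmetric] scaleR_matrix_vmult
  by (simp add: gen_def spec_reflm vector_smult_assoc)

lemma F_minus: "F s (f - g) = F s f - F s g"
  by (auto simp: F_def grp_def spec_diff)

lemma F_F [simp]: "F s (F t g) = F (s + t) g"
  by (auto simp: F_def grp_add)

lemma F_0 [simp]: "F 0 g = g"
  by (auto simp: F_def)

lemma nrm_F [simp]: "nrm M k (F s g) = nrm M k g"
  by (intro nrm_cong) (simp add: F_def)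

lemma nrm_F_diff: "nrm M k (F s g - g) \<le> \<bar>s\<bar> * nrm M (Suc k) g"
proof (rule nrm_le)
  fix l
  have "norm ((F s g - g) l) \<le> \<bar>s\<bar> * om l * norm (g l)"
    unfolding F_def minus_apply using om_ge_1[of l] by (intro norm_grp_diff_le) auto
  then have "om l ^ k * norm ((F s g - g) l) \<le> om l ^ k * (\<bar>s\<bar> * om l * norm (g l))"
    using om_ge_1[of l] by (intro mult_left_mono) auto
  then show "om l ^ k * norm ((F s g - g) l) \<le> \<bar>s\<bar> * (om l ^ Suc k * norm (g l))"
    by (simp add: mult_ac)
qed auto

lemma nrm_F_second_diff: "nrm M k (F s g + F (- s) g - g - g) \<le> s\<^sup>2 * nrm M (k + 2) g"
proof (rule nrm_le)
  fix l
  have "norm ((F s g + F (- s) g - g - g) l) \<le> s\<^sup>2 * (om l)\<^sup>2 * norm (g l)"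
    unfolding F_def minus_apply plus_fun_apply using om_ge_1[of l] by (intro norm_grp_second_diff) auto
  then have "om l ^ k * norm ((F s g + F (- s) g - g - g) l) \<le> om l ^ k * (s\<^sup>2 * (om l)\<^sup>2 * norm (g l))"
    using om_ge_1[of l] by (intro mult_left_mono) auto
  then show "om l ^ k * norm ((F s g + F (- s) g - g - g) l) \<le> s\<^sup>2 * (om l ^ (k + 2) * norm (g l))"
    by (simp add: mult_ac power_add power2_eq_square)
qed auto

end

section \<open>The scheme as an operator on Fourier coefficients\<close>

locale scheme = torus +
  fixes M :: nat and v w :: "nat \<Rightarrow> real" and A :: real
  assumes M: "M > 0" "even M"
    and vper: "\<And>j. v (j + M) = v j" and wper: "\<And>j. w (j + M) = w j"
    and vA: "\<And>i j. i \<le> 2 \<Longrightarrow> \<bar>(dd ^^ i) v j\<bar> \<le> A * ((b - a) / M) ^ i"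
    and wA: "\<And>i j. i \<le> 2 \<Longrightarrow> \<bar>(dd ^^ i) w j\<bar> \<le> A * ((b - a) / M) ^ i"
begin

abbreviation VV :: "(int \<Rightarrow> cvec) \<Rightarrow> int \<Rightarrow> cvec" where
  "VV \<equiv> Vop M v w"

text \<open>The flow of \<open>VV\<close>, computed at the grid points. It is a group, but
  \<open>W 0\<close> is the identity only on \<open>modes M\<close>.\<close>

definition W :: "real \<Rightarrow> (int \<Rightarrow> cvec) \<Rightarrow> int \<Rightarrow> cvec" where
  "W s g = dft M (\<lambda>j. grp (pi/4) (w j - v j) (- v j - w j) s (ev M g j))"

definition CV :: real where "CV = 160 * A"

lemma A_nonneg: "0 \<le> A"
  using vA[of 0 0] by (simp add: order_trans[OF abs_ge_zero])

lemma CV_nonneg: "0 \<le> CV"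
  using A_nonneg by (simp add: CV_def)

lemma nrm_VV: "k \<le> 2 \<Longrightarrow> nrm M k (VV g) \<le> CV * nrm M k g"
  unfolding CV_def by (rule nrm_Vop_le[OF M _ vper wper vA wA])

lemma ev_plus: "ev M (f + g) j = ev M f j + ev M g j"
  using ev_add[of M f g j] by (simp add: plus_fun_def)

lemma ev_minus: "ev M (f - g) j = ev M f j - ev M g j"
  using ev_diff[of M f g j] by (simp add: fun_diff_def)

lemma ev_scaleR: "ev M (\<lambda>l. r *\<^sub>R g l) j = r *\<^sub>R ev M g j"
  by (simp add: ev_def scaleR_vmult vmult.sum_right vector_smult_assoc mult.commute)

lemma VV_minus: "VV (f - g) = VV f - VV g"
  by (auto simp: Vop_def ev_minus pot_def gen_def spec_diff dft_diff)

lemma W_plus: "W s (f + g) = W s f + W s g"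
  by (auto simp: W_def ev_plus grp_def spec_add dft_add)

lemma W_minus: "W s (f - g) = W s f - W s g"
  by (auto simp: W_def ev_minus grp_def spec_diff dft_diff)

lemma W_scaleR: "W s (\<lambda>l. r *\<^sub>R g l) = (\<lambda>l. r *\<^sub>R W s g l)"
  unfolding fun_eq_iff by (simp add: W_def ev_scaleR grp_def) (simp add: scaleR_vmult spec_scale dft_scale)

lemma W_W [simp]: "W s (W t g) = W (s + t) g"
  unfolding W_def by (rule ext, rule dft_cong) (simp add: ev_dft[OF M] grp_add)

text \<open>Unitarity at each grid point together with Parseval gives isometry in the unweighted
  norm, the one in which errors are added up.\<close>

lemma nrm_W [simp]: "nrm M 0 (W s g) = nrm M 0 g"
  unfolding nrm_0 W_def parseval[OF M] using M by (simp add: L2_ev)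

lemma nrm_W_diff: "nrm M 0 (W s g - g) \<le> \<bar>s\<bar> * CV * nrm M 0 g"
proof -
  let ?U = "\<lambda>j. grp (pi/4) (w j - v j) (- v j - w j) s (ev M g j) - ev M g j"
  have "\<bar>w j - v j\<bar> \<le> CV" "\<bar>- v j - w j\<bar> \<le> CV" for j
    using vA[of 0 j] wA[of 0 j] A_nonneg unfolding CV_def by auto
  then have le: "norm (?U j) \<le> (\<bar>s\<bar> * CV) * norm (ev M g j)" for j
    by (rule norm_grp_diff_le)
  have "nrm M 0 (W s g - g) = nrm M 0 (dft M ?U)"
    unfolding W_def by (intro nrm_cong) (simp add: dft_diff dft_ev[OF M])
  also have "\<dots> = L2_set (\<lambda>j. norm (?U j)) {..<M} / sqrt M"
    by (simp add: nrm_0 parseval[OF M])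
  also have "\<dots> \<le> L2_set (\<lambda>j. (\<bar>s\<bar> * CV) * norm (ev M g j)) {..<M} / sqrt M"
    using le by (intro divide_right_mono L2_set_mono) auto
  also have "\<dots> = \<bar>s\<bar> * CV * L2_set (\<lambda>j. norm (ev M g j)) {..<M} / sqrt M"
    using CV_nonneg by (subst L2_set_right_distrib) auto
  also have "\<dots> = \<bar>s\<bar> * CV * nrm M 0 g"
    unfolding nrm_0 L2_ev[OF M] using M by simp
  finally show ?thesis .
qed

text \<open>The rule for \<open>grp\<close> at each grid point, carried through two finite sums.
  Derivatives are required only on \<open>modes M\<close>, the coefficients that \<open>ev\<close>
  reads.\<close>

lemma has_vector_derivative_W:
  assumes f: "\<And>l. l \<in> modes M \<Longrightarrow> ((\<lambda>s. f s l) has_vector_derivative f' l) (at x within S)"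
    and g: "(g has_real_derivative g') (at x within S)"
  shows "((\<lambda>s. W (g s) (f s) l) has_vector_derivative
     W (g x) (\<lambda>l. f' l + g' *\<^sub>R VV (f x) l) l) (at x within S)"
proof -
  have e: "((\<lambda>s. ev M (f s) j) has_vector_derivative ev M f' j) (at x within S)" for j
    unfolding ev_def
    by (intro has_vector_derivative_sum bounded_linear.has_vector_derivative[OF vmult.bounded_linear_right] f)
  have "((\<lambda>s. W (g s) (f s) l) has_vector_derivative
     dft M (\<lambda>j. grp (pi/4) (w j - v j) (- v j - w j) (g x)
        (ev M f' j + g' *\<^sub>R gen (pi/4) (w j - v j) (- v j - w j) (ev M (f x) j))) l) (at x within S)"
    unfolding W_def dft_rt
    by (intro has_vector_derivative_sum bounded_linear.has_vector_derivative[OF vmult.bounded_linear_right]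
        has_vector_derivative_grp e g)
  moreover have "ev M (\<lambda>l. f' l + g' *\<^sub>R VV (f x) l) j
      = ev M f' j + g' *\<^sub>R gen (pi/4) (w j - v j) (- v j - w j) (ev M (f x) j)" if "j < M" for j
    unfolding ev_add ev_scaleR using that by (simp add: Vop_def ev_dft[OF M] pot_def)
  then have "dft M (\<lambda>j. grp (pi/4) (w j - v j) (- v j - w j) (g x)
        (ev M f' j + g' *\<^sub>R gen (pi/4) (w j - v j) (- v j - w j) (ev M (f x) j))) l
    = W (g x) (\<lambda>l. f' l + g' *\<^sub>R VV (f x) l) l"
    unfolding W_def by (intro dft_cong) simp
  ultimately show ?thesis by simp
qed

text \<open>The potential conjugated by the free flow over time \<open>s\<close>, minus its value at
  s = 0: the defect caused by freezing the potential.\<close>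

definition DV :: "real \<Rightarrow> (int \<Rightarrow> cvec) \<Rightarrow> int \<Rightarrow> cvec" where
  "DV s g = F (- s) (VV (F s g)) - VV g"

lemma DV_minus: "DV s (f - g) = DV s f - DV s g"
  by (simp add: DV_def F_minus VV_minus)

text \<open>\<open>F s - 1\<close> is split off once on each side of \<open>VV\<close>; each term
  pays |s| and one weight.\<close>

lemma nrm_DV: "nrm M 0 (DV s g) \<le> 2 * CV * \<bar>s\<bar> * nrm M 1 g"
proof -
  have "DV s g = (F (- s) (VV (F s g)) - VV (F s g)) + VV (F s g - g)"
    by (simp add: DV_def VV_minus)
  then have "nrm M 0 (DV s g) \<le> nrm M 0 (F (- s) (VV (F s g)) - VV (F s g)) + nrm M 0 (VV (F s g - g))"
    using nrm_triangle by metis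
  also have "nrm M 0 (F (- s) (VV (F s g)) - VV (F s g)) \<le> \<bar>s\<bar> * nrm M 1 (VV (F s g))"
    using nrm_F_diff[of M 0 "-s" "VV (F s g)"] by simp
  also have "\<dots> \<le> \<bar>s\<bar> * (CV * nrm M 1 g)"
    using nrm_VV[of 1 "F s g"] by (intro mult_left_mono) auto
  also have "nrm M 0 (VV (F s g - g)) \<le> CV * (\<bar>s\<bar> * nrm M 1 g)"
    using nrm_VV[of 0 "F s g - g"] mult_left_mono[OF nrm_F_diff[of M 0 s g] CV_nonneg] by simp
  finally show ?thesis by (simp add: mult_ac)
qed

text \<open>The second difference of the conjugated potential is rearranged so that each factor
  \<open>F s - 1\<close> costs one derivative; no commutator has to be estimated.\<close>

lemma nrm_DV_sym: "nrm M 0 (DV s g + DV (- s) g) \<le> 4 * CV * s\<^sup>2 * nrm M 2 g"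
proof -
  define p where "p t = F t g - g" for t
  define q where "q = F s g + F (- s) g - g - g"
  define r where "r = F s (VV g) + F (- s) (VV g) - VV g - VV g"
  have id: "DV s g + DV (- s) g = (F (- s) (VV (p s)) - VV (p s)) + (F s (VV (p (- s))) - VV (p (- s)))
     + r + VV q"
  proof -
    have "VV q = VV (F s g) + VV (F (- s) g) - VV g - VV g"
    proof -
      \<comment> \<open>Written with differences only, to match \<open>VV_minus\<close>.\<close>
      have "q = F s g - (g - F (- s) g) - g" by (simp add: q_def)
      then show ?thesis by (simp only: VV_minus) simp
    qed
    then show ?thesis
      by (simp add: DV_def p_def r_def VV_minus F_minus)
  qed
  have 1: "nrm M 0 (F (- t) (VV (p t)) - VV (p t)) \<le> CV * s\<^sup>2 * nrm M 2 g" if "\<bar>t\<bar> = \<bar>s\<bar>" for t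
  proof -
    have "nrm M 0 (F (- t) (VV (p t)) - VV (p t)) \<le> \<bar>s\<bar> * nrm M 1 (VV (p t))"
      using nrm_F_diff[of M 0 "-t" "VV (p t)"] that by simp
    also have "\<dots> \<le> \<bar>s\<bar> * (CV * nrm M 1 (p t))"
      using nrm_VV[of 1 "p t"] by (intro mult_left_mono) auto
    also have "\<dots> \<le> \<bar>s\<bar> * (CV * (\<bar>s\<bar> * nrm M 2 g))"
      using nrm_F_diff[of M 1 t g] that CV_nonneg
      by (intro mult_left_mono) (auto simp: p_def numeral_2_eq_2)
    also have "\<dots> = CV * (\<bar>s\<bar> * \<bar>s\<bar>) * nrm M 2 g" by (simp only: mult_ac)
    finally show ?thesis by (simp add: power2_eq_square)
  qed
  have 2: "nrm M 0 r \<le> CV * s\<^sup>2 * nrm M 2 g"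
  proof -
    have "nrm M 0 r \<le> s\<^sup>2 * nrm M 2 (VV g)"
      using nrm_F_second_diff[of M 0 s "VV g"] unfolding r_def add_0 .
    also have "\<dots> \<le> s\<^sup>2 * (CV * nrm M 2 g)"
      using nrm_VV[of 2 g] by (intro mult_left_mono) auto
    finally show ?thesis by (simp add: mult_ac)
  qed
  have 3: "nrm M 0 (VV q) \<le> CV * s\<^sup>2 * nrm M 2 g"
  proof -
    have "nrm M 0 (VV q) \<le> CV * nrm M 0 q" by (rule nrm_VV) simp
    also have "\<dots> \<le> CV * (s\<^sup>2 * nrm M 2 g)"
      using nrm_F_second_diff[of M 0 s g] CV_nonneg by (intro mult_left_mono) (auto simp: q_def numeral_2_eq_2)
    finally show ?thesis by (simp add: mult_ac)
  qed
  have t4: "nrm M 0 (x1 + x2 + x3 + x4) \<le> nrm M 0 x1 + nrm M 0 x2 + nrm M 0 x3 + nrm M 0 x4" for x1 x2 x3 x4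
    using nrm_triangle[of M 0 "x1 + x2 + x3" x4] nrm_triangle[of M 0 "x1 + x2" x3] nrm_triangle[of M 0 x1 x2]
    by linarith
  show ?thesis
    unfolding id
    using t4[of "F (- s) (VV (p s)) - VV (p s)" "F s (VV (p (- s))) - VV (p (- s))" r "VV q"]
      1[of s] 1[of "-s"] 2 3 by simp
qed

text \<open>In the frame \<open>F (c - s) (\<psi> s)\<close> centred at the midpoint \<open>c\<close>, the Strang step freezes the
  conjugated potential at \<open>s = c\<close>.  Pairing the times \<open>c + \<sigma>\<close> and \<open>c - \<sigma>\<close> cancels the
  first-order term of the defect.\<close>

lemma strang_step:
  fixes \<psi> p \<rho> :: "real \<Rightarrow> int \<Rightarrow> cvec"
  assumes \<tau>: "0 \<le> \<tau>" and \<epsilon>: "0 \<le> \<epsilon>" "\<epsilon> \<le> 1" and \<delta>: "\<delta> \<le> 1"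
    and \<psi>: "\<And>s l. s \<in> {t0..t0+\<tau>} \<Longrightarrow> l \<in> modes M \<Longrightarrow> ((\<lambda>s. \<psi> s l) has_vector_derivative
        (gen (th l) (- om l) (om l) (\<psi> s l) + (\<epsilon> *\<^sub>R p s l + \<rho> s l))) (at s within {t0..t0+\<tau>})"
    and p: "\<And>s. s \<in> {t0..t0+\<tau>} \<Longrightarrow> nrm M 1 (p s) \<le> P"
    and Q: "\<And>s. s \<in> {t0..t0+\<tau>} \<Longrightarrow> nrm M 2 (\<psi> s) \<le> Q"
    and R: "\<And>s. s \<in> {t0..t0+\<tau>} \<Longrightarrow> nrm M 0 (p s - VV (\<psi> s)) \<le> R"
    and \<rho>: "\<And>s. s \<in> {t0..t0+\<tau>} \<Longrightarrow> nrm M 1 (\<rho> s) \<le> \<delta>"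
  shows "nrm M 0 (\<psi> (t0 + \<tau>) - F (\<tau>/2) (W (\<epsilon> * \<tau>) (F (\<tau>/2) (\<psi> t0))))
     \<le> \<tau> * (\<epsilon> * ((CV * (P + 1) + CV\<^sup>2 * Q + CV * Q) * \<tau>\<^sup>2 + R) + \<delta>)"
proof -
  define c where "c = t0 + \<tau> / 2"
  let ?I = "{t0..t0+\<tau>}"
  define u where "u s = F (c - s) (\<psi> s)" for s
  define u' where "u' s = F (c - s) (\<lambda>l. \<epsilon> *\<^sub>R p s l + \<rho> s l)" for s
  define z where "z s = W (- \<epsilon> * s) (u s)" for s
  define e where "e s = F (c - s) (\<lambda>l. \<epsilon> *\<^sub>R (p s - VV (\<psi> s)) l + \<rho> s l)" for s
  define Z where "Z s = (\<lambda>l. \<epsilon> *\<^sub>R DV (s - c) (u s) l) + e s" for s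
  have t0I: "t0 \<in> ?I" using \<tau> by simp
  have P0: "0 \<le> P" and Q0: "0 \<le> Q" and R0: "0 \<le> R" and \<delta>0: "0 \<le> \<delta>"
    using p[OF t0I] Q[OF t0I] R[OF t0I] \<rho>[OF t0I] by (auto intro: order_trans[OF nrm_nonneg])
  have du: "((\<lambda>s. u s l) has_vector_derivative u' s l) (at s within ?I)" if "s \<in> ?I" "l \<in> modes M" for s l
  proof -
    have "((\<lambda>s. c - s) has_real_derivative -1) (at s within ?I)"
      by (auto intro!: derivative_eq_intros)
    from has_vector_derivative_grp[OF \<psi>[OF that] this, of "th l" "- om l" "om l"]
    show ?thesis by (simp add: u_def u'_def F_def)
  qed
  have dz: "((\<lambda>s. z s l) has_vector_derivative W (- \<epsilon> * s) (Z s) l) (at s within ?I)"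
    if s: "s \<in> ?I" for s l
  proof -
    have "((\<lambda>s. - \<epsilon> * s) has_real_derivative - \<epsilon>) (at s within ?I)"
      by (auto intro!: derivative_eq_intros)
    from has_vector_derivative_W[OF du[OF s] this]
    have "((\<lambda>s. z s l) has_vector_derivative W (- \<epsilon> * s) (\<lambda>l. u' s l + (- \<epsilon>) *\<^sub>R VV (u s) l) l) (at s within ?I)"
      by (simp add: z_def)
    moreover have "(\<lambda>l. u' s l + (- \<epsilon>) *\<^sub>R VV (u s) l) = Z s"
    proof
      fix l
      have "F (s - c) (u s) = \<psi> s" by (simp add: u_def)
      then show "u' s l + (- \<epsilon>) *\<^sub>R VV (u s) l = Z s l"
        by (simp add: Z_def e_def u'_def DV_def F_def grp_def spec_add spec_diff scaleR_vmult spec_scale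
            vmult.diff_right)
    qed
    ultimately show ?thesis by simp
  qed
  have ne: "nrm M 0 (e s) \<le> \<epsilon> * R + \<delta>" if "s \<in> ?I" for s
  proof -
    have "nrm M 0 (e s) \<le> nrm M 0 (\<lambda>l. \<epsilon> *\<^sub>R (p s - VV (\<psi> s)) l) + nrm M 0 (\<rho> s)"
      using nrm_triangle[of M 0 "\<lambda>l. \<epsilon> *\<^sub>R (p s - VV (\<psi> s)) l" "\<rho> s"] by (simp add: e_def plus_fun_def)
    also have "\<dots> \<le> \<epsilon> * R + \<delta>"
      unfolding nrm_scale using mult_left_mono[OF R[OF that] \<epsilon>(1)] \<rho>[OF that] nrm_mono[of 0 1 M "\<rho> s"] \<epsilon>(1)
      by (simp add: fun_diff_def)
    finally show ?thesis .
  qed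
  \<comment> \<open>The free generator has dropped out of u'; \<epsilon> <= 1 and \<delta> <= 1 make
    the Lipschitz constant of \<open>u\<close> independent of both.\<close>
  have nu': "nrm M 1 (u' s) \<le> P + 1" if "s \<in> ?I" for s
  proof -
    have "nrm M 1 (u' s) \<le> nrm M 1 (\<lambda>l. \<epsilon> *\<^sub>R p s l) + nrm M 1 (\<rho> s)"
      using nrm_triangle[of M 1 "\<lambda>l. \<epsilon> *\<^sub>R p s l" "\<rho> s"] by (simp add: u'_def plus_fun_def)
    also have "\<dots> \<le> 1 * P + 1"
      unfolding nrm_scale using p[OF that] \<rho>[OF that] \<epsilon> \<delta>
      by (intro add_mono mult_mono) auto
    finally show ?thesis by simp
  qed
  have udiff: "nrm M 1 (u (c + \<sigma>) - u c) \<le> \<bar>\<sigma>\<bar> * (P + 1)" if "\<bar>\<sigma>\<bar> \<le> \<tau> / 2" for \<sigma>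
  proof -
    have gen: "nrm M 1 (u y - u x) \<le> (y - x) * (P + 1)" if "x \<in> ?I" "y \<in> ?I" "x \<le> y" for x y
      unfolding nrm_def minus_apply
    proof (rule L2_set_mean_value[OF finite_modes that(3)])
      show "((\<lambda>s. u s l) has_vector_derivative u' s l) (at s within {x..y})" if "s \<in> {x..y}" "l \<in> modes M" for s l
        by (rule has_vector_derivative_within_subset[OF du]) (use that \<open>x \<in> ?I\<close> \<open>y \<in> ?I\<close> in auto)
      show "L2_set (\<lambda>l. om l ^ 1 * norm (u' s l)) (modes M) \<le> P + 1" if "s \<in> {x..y}" for s
        using nu'[of s] that \<open>x \<in> ?I\<close> \<open>y \<in> ?I\<close> by (simp add: nrm_def)
      show "0 \<le> om l ^ 1" for l using om_ge_1[of l] by simp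
    qed
    show ?thesis
    proof (cases "\<sigma> \<ge> 0")
      case True
      then show ?thesis using gen[of c "c + \<sigma>"] that by (simp add: c_def)
    next
      case False
      then show ?thesis using gen[of "c + \<sigma>" c] that nrm_minus_commute[of M 1 "u (c + \<sigma>)" "u c"]
        by (simp add: c_def)
    qed
  qed
  have nuc: "nrm M 2 (u c) \<le> Q" using Q[of c] \<tau> by (simp add: u_def c_def)
  have nuc1: "nrm M 1 (u c) \<le> Q" using nuc nrm_mono[of 1 2 M "u c"] by simp
  \<comment> \<open>The three summands come from replacing u (c +- \<sigma>) by u c, from dropping
    \<open>?W\<close>, and from the symmetric sum \<open>nrm_DV_sym\<close>.\<close>
  define K where "K = 4 * CV * (P + 1) + 4 * CV\<^sup>2 * Q + 4 * CV * Q"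
  have K0: "0 \<le> K" using P0 Q0 CV_nonneg by (simp add: K_def)
  have bd: "nrm M 0 (W (- \<epsilon> * (c + \<sigma>)) (Z (c + \<sigma>)) + W (- \<epsilon> * (c - \<sigma>)) (Z (c - \<sigma>)))
      \<le> \<epsilon> * K * \<sigma>\<^sup>2 + 2 * (\<epsilon> * R + \<delta>)" if \<sigma>: "0 \<le> \<sigma>" "\<sigma> \<le> \<tau> / 2" for \<sigma>
  proof -
    let ?p = "c + \<sigma>" and ?m = "c - \<sigma>"
    let ?W = "W (2 * \<epsilon> * \<sigma>)"
    have I: "?p \<in> ?I" "?m \<in> ?I" using \<sigma> by (auto simp: c_def field_simps)
    define X where "X = DV \<sigma> (u ?p) + ?W (DV (- \<sigma>) (u ?m))"
    \<comment> \<open>A common isometry is pulled out of both defects. What remains on the second is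
      a flow over 2 \<epsilon> \<sigma>, which is within O(\<sigma>) of the identity.\<close>
    have "W (- \<epsilon> * ?m) (Z ?m) = W (- \<epsilon> * ?p) (?W (Z ?m))"
      by (simp add: algebra_simps)
    then have "nrm M 0 (W (- \<epsilon> * ?p) (Z ?p) + W (- \<epsilon> * ?m) (Z ?m)) = nrm M 0 (Z ?p + ?W (Z ?m))"
      by (metis W_plus nrm_W)
    also have "Z ?p + ?W (Z ?m) = (\<lambda>l. \<epsilon> *\<^sub>R X l) + (e ?p + ?W (e ?m))"
      by (rule ext) (simp add: Z_def X_def W_plus W_scaleR algebra_simps)
    also have "nrm M 0 \<dots> \<le> nrm M 0 (\<lambda>l. \<epsilon> *\<^sub>R X l) + (nrm M 0 (e ?p) + nrm M 0 (?W (e ?m)))"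
      by (intro order_trans[OF nrm_triangle] add_left_mono nrm_triangle)
    also have "\<dots> \<le> \<epsilon> * nrm M 0 X + 2 * (\<epsilon> * R + \<delta>)"
      using ne[OF I(1)] ne[OF I(2)] \<epsilon> by (simp add: nrm_scale)
    also have "nrm M 0 X \<le> K * \<sigma>\<^sup>2"
    proof -
      define y where "y = DV (- \<sigma>) (u c)"
      \<comment> \<open>The first three terms are products of two factors of size O(\<sigma>); the
        last is the second difference of the conjugated potential at the midpoint.\<close>
      have "X = DV \<sigma> (u ?p - u c) + ?W (DV (- \<sigma>) (u ?m - u c)) + (?W y - y) + (DV \<sigma> (u c) + y)"
        by (simp add: X_def y_def DV_minus W_minus)
      then have "nrm M 0 X \<le> nrm M 0 (DV \<sigma> (u ?p - u c)) + nrm M 0 (?W (DV (- \<sigma>) (u ?m - u c)))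
          + nrm M 0 (?W y - y) + nrm M 0 (DV \<sigma> (u c) + y)"
        by (smt (verit) nrm_triangle)
      also have "\<dots> \<le> 2 * CV * \<sigma> * (\<sigma> * (P + 1)) + 2 * CV * \<sigma> * (\<sigma> * (P + 1))
          + 4 * CV\<^sup>2 * \<sigma>\<^sup>2 * Q + 4 * CV * \<sigma>\<^sup>2 * Q"
      proof (intro add_mono)
        show "nrm M 0 (DV \<sigma> (u ?p - u c)) \<le> 2 * CV * \<sigma> * (\<sigma> * (P + 1))"
          using nrm_DV[of \<sigma> "u ?p - u c"] udiff[of \<sigma>] \<sigma> CV_nonneg
          by (smt (verit) mult_left_mono mult_nonneg_nonneg abs_of_nonneg)
        have "nrm M 1 (u ?m - u c) \<le> \<sigma> * (P + 1)" using udiff[of "- \<sigma>"] \<sigma> by simp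
        then have "2 * CV * \<sigma> * nrm M 1 (u ?m - u c) \<le> 2 * CV * \<sigma> * (\<sigma> * (P + 1))"
          using \<sigma> CV_nonneg by (intro mult_left_mono) auto
        then show "nrm M 0 (?W (DV (- \<sigma>) (u ?m - u c))) \<le> 2 * CV * \<sigma> * (\<sigma> * (P + 1))"
          using nrm_DV[of "- \<sigma>" "u ?m - u c"] \<sigma> by simp
        have y: "nrm M 0 y \<le> 2 * CV * \<sigma> * Q"
        proof -
          have "nrm M 0 y \<le> 2 * CV * \<sigma> * nrm M 1 (u c)"
            using nrm_DV[of "- \<sigma>" "u c"] \<sigma> by (simp add: y_def)
          also have "\<dots> \<le> 2 * CV * \<sigma> * Q" using nuc1 \<sigma> CV_nonneg by (intro mult_left_mono) auto
          finally show ?thesis .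
        qed
        have "nrm M 0 (?W y - y) \<le> \<bar>2 * \<epsilon> * \<sigma>\<bar> * CV * nrm M 0 y" by (rule nrm_W_diff)
        also have "\<dots> \<le> (2 * 1 * \<sigma>) * CV * (2 * CV * \<sigma> * Q)"
          using y \<epsilon> \<sigma> CV_nonneg Q0 by (intro mult_mono) (auto simp: mult_left_le_one_le)
        finally show "nrm M 0 (?W y - y) \<le> 4 * CV\<^sup>2 * \<sigma>\<^sup>2 * Q" by (simp add: power2_eq_square mult_ac)
        have "nrm M 0 (DV \<sigma> (u c) + y) \<le> 4 * CV * \<sigma>\<^sup>2 * nrm M 2 (u c)"
          unfolding y_def by (rule nrm_DV_sym)
        also have "\<dots> \<le> 4 * CV * \<sigma>\<^sup>2 * Q" using nuc CV_nonneg by (intro mult_left_mono) auto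
        finally show "nrm M 0 (DV \<sigma> (u c) + y) \<le> 4 * CV * \<sigma>\<^sup>2 * Q" .
      qed
      also have "\<dots> = K * \<sigma>\<^sup>2" by (simp add: K_def power2_eq_square algebra_simps)
      finally show ?thesis .
    qed
    finally show ?thesis using \<epsilon> by (simp add: mult_left_mono mult.assoc plus_fun_def)
  qed
  \<comment> \<open>The mean value bound is applied in \<sigma> to z (c + \<sigma>) - z (c -
    \<sigma>), which is 0 at \<sigma> = 0 and whose derivative is the paired sum just
    estimated.\<close>
  have "nrm M 0 (\<lambda>l. (z (c + \<tau>/2) l - z (c - \<tau>/2) l) - (z (c + 0) l - z (c - 0) l))
     \<le> (\<tau>/2 - 0) * (\<epsilon> * K * (\<tau>/2)\<^sup>2 + 2 * (\<epsilon> * R + \<delta>))"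
    unfolding nrm_def
  proof (rule L2_set_mean_value[where y="\<lambda>\<sigma> l. z (c + \<sigma>) l - z (c - \<sigma>) l" and
        y'="\<lambda>\<sigma>. W (- \<epsilon> * (c + \<sigma>)) (Z (c + \<sigma>)) + W (- \<epsilon> * (c - \<sigma>)) (Z (c - \<sigma>))"])
    fix \<sigma> assume \<sigma>: "\<sigma> \<in> {0..\<tau>/2}"
    have sub: "(\<lambda>\<sigma>. c + \<sigma>) ` {0..\<tau>/2} \<subseteq> ?I" "(\<lambda>\<sigma>. c - \<sigma>) ` {0..\<tau>/2} \<subseteq> ?I"
      by (auto simp: c_def field_simps)
    show "((\<lambda>\<sigma>. z (c + \<sigma>) l - z (c - \<sigma>) l) has_vector_derivative
        (W (- \<epsilon> * (c + \<sigma>)) (Z (c + \<sigma>)) + W (- \<epsilon> * (c - \<sigma>)) (Z (c - \<sigma>))) l) (at \<sigma> within {0..\<tau>/2})" for l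
    proof -
      have 1: "((\<lambda>\<sigma>. c + \<sigma>) has_vector_derivative 1) (at \<sigma> within {0..\<tau>/2})"
        "((\<lambda>\<sigma>. c - \<sigma>) has_vector_derivative -1) (at \<sigma> within {0..\<tau>/2})"
        by (auto intro!: derivative_eq_intros)
      have I: "c + \<sigma> \<in> ?I" "c - \<sigma> \<in> ?I" using \<sigma> by (auto simp: c_def field_simps)
      note zp = has_vector_derivative_within_subset[OF dz[OF I(1)] sub(1), of l]
      note zm = has_vector_derivative_within_subset[OF dz[OF I(2)] sub(2), of l]
      show ?thesis
        using has_vector_derivative_diff[OF vector_diff_chain_within[OF 1(1) zp] vector_diff_chain_within[OF 1(2) zm]]
        by (simp add: o_def)
    qed
    have "nrm M 0 (W (- \<epsilon> * (c + \<sigma>)) (Z (c + \<sigma>)) + W (- \<epsilon> * (c - \<sigma>)) (Z (c - \<sigma>)))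
      \<le> \<epsilon> * K * \<sigma>\<^sup>2 + 2 * (\<epsilon> * R + \<delta>)" using bd[of \<sigma>] \<sigma> by simp
    also have "\<dots> \<le> \<epsilon> * K * (\<tau>/2)\<^sup>2 + 2 * (\<epsilon> * R + \<delta>)"
      using \<sigma> \<epsilon> K0 by (intro add_right_mono mult_left_mono power_mono) auto
    finally show "L2_set (\<lambda>l. om l ^ 0 * norm ((W (- \<epsilon> * (c + \<sigma>)) (Z (c + \<sigma>)) + W (- \<epsilon> * (c - \<sigma>)) (Z (c - \<sigma>))) l)) (modes M)
        \<le> \<epsilon> * K * (\<tau>/2)\<^sup>2 + 2 * (\<epsilon> * R + \<delta>)"
      by (simp add: nrm_def)
  qed (use \<tau> in auto)
  also have "(\<lambda>l. (z (c + \<tau>/2) l - z (c - \<tau>/2) l) - (z (c + 0) l - z (c - 0) l)) = z (t0 + \<tau>) - z t0"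
    by (simp add: c_def fun_eq_iff add.commute[of \<tau>])
  also have "nrm M 0 (z (t0 + \<tau>) - z t0)
      = nrm M 0 (F (\<tau>/2) (W (\<epsilon> * (t0 + \<tau>)) (z (t0 + \<tau>) - z t0)))"
    by simp
  also have "F (\<tau>/2) (W (\<epsilon> * (t0 + \<tau>)) (z (t0 + \<tau>) - z t0))
      = F (\<tau>/2) (W 0 (F (- \<tau>/2) (\<psi> (t0 + \<tau>)))) - F (\<tau>/2) (W (\<epsilon> * \<tau>) (F (\<tau>/2) (\<psi> t0)))"
    by (simp add: z_def u_def c_def W_minus F_minus algebra_simps)
  \<comment> \<open>\<open>W 0\<close> acts as the identity only on \<open>modes M\<close>, so it is
    removed under the norm and not as an equation of functions.\<close>
  also have "nrm M 0 \<dots> = nrm M 0 (\<psi> (t0 + \<tau>) - F (\<tau>/2) (W (\<epsilon> * \<tau>) (F (\<tau>/2) (\<psi> t0))))"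
  proof (rule nrm_cong)
    fix l assume "l \<in> modes M"
    then have "F (\<tau>/2) (W 0 (F (- \<tau>/2) (\<psi> (t0 + \<tau>)))) l = F (\<tau>/2) (F (- \<tau>/2) (\<psi> (t0 + \<tau>))) l"
      unfolding F_def[of "\<tau>/2"] W_def by (simp add: dft_ev[OF M])
    then show "norm ((F (\<tau>/2) (W 0 (F (- \<tau>/2) (\<psi> (t0 + \<tau>)))) - F (\<tau>/2) (W (\<epsilon> * \<tau>) (F (\<tau>/2) (\<psi> t0)))) l)
       = norm ((\<psi> (t0 + \<tau>) - F (\<tau>/2) (W (\<epsilon> * \<tau>) (F (\<tau>/2) (\<psi> t0)))) l)" by simp
  qed
  also have "(\<tau>/2 - 0) * (\<epsilon> * K * (\<tau>/2)\<^sup>2 + 2 * (\<epsilon> * R + \<delta>)) = \<tau> * (\<epsilon> * (K / 8 * \<tau>\<^sup>2 + R) + \<delta>)"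
    by (simp add: power2_eq_square algebra_simps)
  \<comment> \<open>K / 8 is weakened to K / 4 so that the factor 4 in \<open>K\<close>
    cancels.\<close>
  also have "\<dots> \<le> \<tau> * (\<epsilon> * (K / 4 * \<tau>\<^sup>2 + R) + \<delta>)"
    using \<tau> \<epsilon> K0 by (intro mult_left_mono add_right_mono mult_right_mono) auto
  also have "K / 4 = CV * (P + 1) + CV\<^sup>2 * Q + CV * Q" by (simp add: K_def)
  finally show ?thesis .
qed

end

subsection \<open>Difference bounds for smooth periodic functions\<close>

text \<open>Differences with a continuous argument, so that they can be differentiated;
  \<open>dd_pow_dx\<close> returns to grid functions.\<close>

definition dx :: "real \<Rightarrow> (real \<Rightarrow> 'a::ab_group_add) \<Rightarrow> real \<Rightarrow> 'a" where
  "dx h f x = f (x + h) - f x"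

lemma dd_pow_dx: "(dd ^^ k) (\<lambda>j. f (x + real j * h)) j = (dx h ^^ k) f (x + real j * h)"
  by (induction k arbitrary: j) (simp_all add: dd_def dx_def algebra_simps)

lemma has_vector_derivative_shift:
  fixes f :: "real \<Rightarrow> 'a::real_normed_vector"
  assumes "(f has_vector_derivative d) (at (x + h))"
  shows "((\<lambda>x. f (x + h)) has_vector_derivative d) (at x)"
proof -
  have "((\<lambda>x. x + h) has_vector_derivative 1) (at x)"
    by (auto intro!: derivative_eq_intros)
  from vector_diff_chain_at[OF this assms] show ?thesis by (simp add: o_def)
qed

lemma dx_pow_derivative:
  fixes f :: "real \<Rightarrow> 'a::real_normed_vector"
  assumes "\<And>x. (f has_vector_derivative f' x) (at x)"
  shows "((dx h ^^ k) f has_vector_derivative (dx h ^^ k) f' x) (at x)"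
proof (induction k arbitrary: x)
  case 0
  then show ?case using assms by simp
next
  case (Suc k)
  have "((\<lambda>x. (dx h ^^ k) f (x + h)) has_vector_derivative (dx h ^^ k) f' (x + h)) (at x)"
    by (rule has_vector_derivative_shift[OF Suc])
  from has_vector_derivative_diff[OF this Suc[of x]]
  show ?case by (simp add: dx_def[abs_def])
qed

lemma vector_mean_value_bound:
  fixes f :: "real \<Rightarrow> 'a::real_normed_vector"
  assumes "x \<le> y" and f: "\<And>z. (f has_vector_derivative f' z) (at z)"
    and B: "\<And>z. z \<in> {x..y} \<Longrightarrow> norm (f' z) \<le> B"
  shows "norm (f y - f x) \<le> (y - x) * B"
proof -
  have "norm (f y - f x) \<le> B * norm (y - x)"
  proof (rule differentiable_bound[of "{x..y}" f "\<lambda>z r. r *\<^sub>R f' z"])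
    show "(f has_derivative (\<lambda>r. r *\<^sub>R f' z)) (at z within {x..y})" for z
      using has_vector_derivative_at_within[OF f] by (simp add: has_vector_derivative_def)
    show "onorm (\<lambda>r. r *\<^sub>R f' z) \<le> B" if "z \<in> {x..y}" for z
      using B[OF that] order_trans[OF norm_ge_zero B[OF that]]
      by (intro onorm_bound) (auto intro: mult_left_mono simp: mult.commute[of B])
  qed (use assms(1) in auto)
  then show ?thesis using assms(1) by (simp add: mult.commute)
qed

text \<open>Each mean value inequality trades one difference for h and one derivative. The bound on
  \<open>D k\<close> is asked for only on the span of the stencil, so that B may depend on the
  location.\<close>

lemma dx_pow_bound:
  fixes D :: "nat \<Rightarrow> real \<Rightarrow> 'a::real_normed_vector"
  assumes "\<And>i z. i < k \<Longrightarrow> (D i has_vector_derivative D (Suc i) z) (at z)"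
    and "\<And>y. y \<in> {x..x + real k * h} \<Longrightarrow> norm (D k y) \<le> B" and h: "0 \<le> h"
  shows "norm ((dx h ^^ k) (D 0) x) \<le> h ^ k * B"
  using assms(1,2)
proof (induction k arbitrary: D x)
  case 0
  then show ?case by simp
next
  case (Suc k)
  have "norm ((dx h ^^ k) (D 0) (x + h) - (dx h ^^ k) (D 0) x) \<le> (x + h - x) * (h ^ k * B)"
  proof (rule vector_mean_value_bound[where f'="(dx h ^^ k) (D 1)"])
    show "((dx h ^^ k) (D 0) has_vector_derivative (dx h ^^ k) (D 1) z) (at z)" for z
      by (rule dx_pow_derivative) (use Suc.prems(1)[of 0] in simp)
    fix y assume y: "y \<in> {x..x + h}"
    show "norm ((dx h ^^ k) (D 1) y) \<le> h ^ k * B"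
    proof (rule Suc.IH[of "\<lambda>i. D (Suc i)" y, unfolded One_nat_def[symmetric]])
      show "norm (D (Suc k) y') \<le> B" if "y' \<in> {y..y + real k * h}" for y'
        by (rule Suc.prems(2)) (use that y in \<open>auto simp: algebra_simps\<close>)
    qed (use Suc.prems(1) in auto)
  qed (use h in auto)
  then show ?case by (simp add: dx_def[of h "(dx h ^^ k) (D 0)"] mult_ac)
qed

lemma periodic_representative:
  fixes f :: "real \<Rightarrow> 'a"
  assumes per: "\<And>x. f (x + p) = f x" and "p > 0"
  obtains y where "y \<in> {a..a + p}" "f y = f x"
proof -
  have nat: "f (x + real n * p) = f x" for x n
  proof (induction n)
    case (Suc n)
    have "f (x + real (Suc n) * p) = f ((x + real n * p) + p)" by (simp add: algebra_simps)
    then show ?case using per Suc by simp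
  qed simp
  have int: "f (x + of_int n * p) = f x" for n
  proof (cases "n \<ge> 0")
    case True
    then show ?thesis using nat[of x "nat n"] by simp
  next
    case False
    then show ?thesis using nat[of "x + of_int n * p" "nat (- n)"] by simp
  qed
  let ?n = "\<lfloor>(x - a) / p\<rfloor>"
  have "of_int ?n * p \<le> x - a" "x - a < (of_int ?n + 1) * p"
    using floor_divide_lower[OF assms(2)] floor_divide_upper[OF assms(2)] by auto
  then have "x + of_int (- ?n) * p \<in> {a..a + p}" by (auto simp: algebra_simps)
  then show ?thesis using that int by blast
qed

lemma derivative_periodic:
  fixes f :: "real \<Rightarrow> 'a::real_normed_vector"
  assumes per: "\<And>x. f (x + p) = f x" and d: "\<And>x. (f has_vector_derivative f' x) (at x)"
  shows "f' (x + p) = f' x"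
proof -
  have "((\<lambda>x. f (x + p)) has_vector_derivative f' (x + p)) (at x)"
    by (rule has_vector_derivative_shift[OF d])
  then have "(f has_vector_derivative f' (x + p)) (at x)" by (simp add: per)
  then show ?thesis using d vector_derivative_unique_at by blast
qed

lemma derivatives_periodic:
  fixes D :: "nat \<Rightarrow> real \<Rightarrow> 'a::real_normed_vector"
  assumes per: "\<And>x. D 0 (x + p) = D 0 x"
    and d: "\<And>i x. i < n \<Longrightarrow> (D i has_vector_derivative D (Suc i) x) (at x)"
  shows "k \<le> n \<Longrightarrow> D k (x + p) = D k x"
proof (induction k arbitrary: x)
  case (Suc k)
  show ?case by (rule derivative_periodic[of "D k"]) (use Suc d in auto)
qed (simp add: per)

text \<open>Below order m, derivatives are bounded by compactness and periodicity. At order m, only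
  m - 1 differences are turned into derivatives of \<open>dx h f\<close>; the Lipschitz constant
  supplies the last factor h.\<close>

lemma W_inf_per_dx_bound:
  assumes ab: "a < b" and m: "m \<ge> 1" and f: "W_inf_per a b m f"
  obtains A where "0 \<le> A" "\<And>k h x. k \<le> m \<Longrightarrow> 0 \<le> h \<Longrightarrow> \<bar>(dx h ^^ k) f x\<bar> \<le> A * h ^ k"
proof -
  obtain D L where D0: "D 0 = f" and per: "\<And>x. f (x + (b - a)) = f x"
    and dD: "\<And>k x. k < m - 1 \<Longrightarrow> (D k has_vector_derivative D (Suc k) x) (at x)"
    and L: "\<And>x y. \<bar>D (m - 1) x - D (m - 1) y\<bar> \<le> L * \<bar>x - y\<bar>"
    using f unfolding W_inf_per_def has_real_derivative_iff_has_vector_derivative by metis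
  have L0: "0 \<le> L" using L[of 1 0] by simp
  have perD: "D k (x + (b - a)) = D k x" if "k \<le> m - 1" for k x
    by (rule derivatives_periodic[of D "b - a" "m - 1"]) (use D0 per dD that in auto)
  have cont: "continuous_on UNIV (D k)" if "k \<le> m - 1" for k
  proof (cases "k = m - 1")
    case True
    have "L-lipschitz_on UNIV (D k)"
      using L L0 by (auto simp: lipschitz_on_def dist_real_def True)
    then show ?thesis by (rule lipschitz_on_continuous_on)
  next
    case False
    then have "k < m - 1" using that by simp
    then show ?thesis using dD by (meson continuous_at_imp_continuous_on has_vector_derivative_continuous)
  qed
  have "\<exists>B. \<forall>x. \<bar>D k x\<bar> \<le> B" if "k \<le> m - 1" for k
  proof -
    have "compact (D k ` {a..b})"
      by (intro compact_continuous_image continuous_on_subset[OF cont[OF that]]) auto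
    then obtain B where B: "\<And>y. y \<in> {a..b} \<Longrightarrow> \<bar>D k y\<bar> \<le> B"
      by (metis compact_imp_bounded bounded_real imageI)
    have "\<bar>D k x\<bar> \<le> B" for x
      using periodic_representative[of "D k" "b - a" a x] perD[OF that] ab B
      by (metis add_diff_cancel_left' diff_add_cancel add.commute diff_gt_0_iff_gt)
    then show ?thesis by blast
  qed
  then obtain B where B: "\<And>k x. k \<le> m - 1 \<Longrightarrow> \<bar>D k x\<bar> \<le> B k" by metis
  define A where "A = L + (\<Sum>k\<le>m. \<bar>B k\<bar>)"
  have A0: "0 \<le> A" using L0 by (auto simp: A_def intro!: add_nonneg_nonneg sum_nonneg)
  have BA: "B k \<le> A" if "k \<le> m" for k
    using member_le_sum[of k "{..m}" "\<lambda>k. \<bar>B k\<bar>"] that L0 by (simp add: A_def)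
  have "\<bar>(dx h ^^ k) f x\<bar> \<le> A * h ^ k" if k: "k \<le> m" and h: "0 \<le> h" for k h x
  proof (cases "k = m")
    case False
    have "norm ((dx h ^^ k) (D 0) x) \<le> h ^ k * B k"
      by (rule dx_pow_bound) (use False k h dD B in auto)
    also have "\<dots> \<le> h ^ k * A" using BA[OF k] h by (intro mult_left_mono) auto
    finally show ?thesis by (simp add: D0 mult.commute)
  next
    case True
    have "norm ((dx h ^^ (m - 1)) (dx h (D 0)) x) \<le> h ^ (m - 1) * (L * h)"
    proof (rule dx_pow_bound[of "m - 1" "\<lambda>i. dx h (D i)"])
      show "(dx h (D i) has_vector_derivative dx h (D (Suc i)) z) (at z)" if "i < m - 1" for i z
        using dx_pow_derivative[of "D i" "D (Suc i)" 1 h z] dD[OF that] by simp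
      show "norm (dx h (D (m - 1)) y) \<le> L * h" for y
        using L[of "y + h" y] h by (simp add: dx_def)
    qed (rule h)
    also have "(dx h ^^ (m - 1)) (dx h (D 0)) = (dx h ^^ m) f"
      using m by (cases m) (simp_all add: funpow_swap1 D0)
    also have "h ^ (m - 1) * (L * h) = L * h ^ m" using m by (cases m) simp_all
    also have "\<dots> \<le> A * h ^ m"
      using h L0 by (intro mult_right_mono) (auto simp: A_def intro!: sum_nonneg)
    finally show ?thesis using True by simp
  qed
  then show ?thesis using that A0 by blast
qed

text \<open>Optimisation at s = sqrt (q / p). If p or q vanishes there is no optimal s, and n = 0
  follows by letting s tend to infinity or to 0.\<close>

lemma le_mult_of_le_AM_GM:
  fixes n p q :: real
  assumes "\<And>s. s > 0 \<Longrightarrow> n \<le> (s * p + q / s) / 2" "0 \<le> p" "0 \<le> q" "0 \<le> n"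
  shows "n\<^sup>2 \<le> p * q"
proof (cases "p = 0 \<or> q = 0")
  case True
  have "n \<le> 0"
  proof (rule field_le_epsilon)
    fix e :: real assume "e > 0"
    show "n \<le> 0 + e"
    proof (cases "p = 0")
      case True
      \<comment> \<open>The choice s = (q + 1) / e remains positive when q = 0.\<close>
      have "n \<le> (q / ((q + 1) / e)) / 2" using assms(1)[of "(q + 1) / e"] True \<open>e > 0\<close> assms(3) by simp
      also have "\<dots> \<le> e" using \<open>e > 0\<close> assms(3) by (simp add: field_simps)
      finally show ?thesis by simp
    next
      case False
      then have "q = 0" using \<open>p = 0 \<or> q = 0\<close> by simp
      then show ?thesis using assms(1)[of "e / p"] False assms(2) \<open>e > 0\<close> by simp
    qed
  qed
  then show ?thesis using assms by simp
next
  case False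
  then have pq: "p > 0" "q > 0" using assms by auto
  have s: "sqrt (q / p) > 0" using pq by simp
  have "sqrt (q / p) * p = sqrt (p * q)" "q / sqrt (q / p) = sqrt (p * q)"
    using pq by (simp_all add: real_sqrt_divide real_sqrt_mult field_simps)
  then have "n \<le> sqrt (p * q)" using assms(1)[OF s] by simp
  then have "n\<^sup>2 \<le> (sqrt (p * q))\<^sup>2" using assms(4) by (intro power_mono)
  then show ?thesis using pq by simp
qed

text \<open>The modulus is stated through a monotone energy \<open>G\<close> on two periods, so that it can be summed over
  overlapping grid intervals that cross the period boundary.  Its proof keeps the Cauchy--Schwarz
  inequality in AM-GM form, which is additive over adjacent intervals.\<close>

lemma sobolev_modulus:
  fixes f g :: "real \<Rightarrow> 'a::banach"
  assumes ab: "a < b" and per: "\<And>x. f (x + (b - a)) = f x"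
    and g: "g integrable_on {a..b}" and g2: "(\<lambda>x. (norm (g x))\<^sup>2) integrable_on {a..b}"
    and f: "\<And>x. x \<in> {a..b} \<Longrightarrow> f x = f a + integral {a..x} g"
    and K: "integral {a..b} (\<lambda>x. (norm (g x))\<^sup>2) \<le> K\<^sup>2"
  obtains G where "\<And>x. x \<in> {a..b + (b - a)} \<Longrightarrow> 0 \<le> G x \<and> G x \<le> 2 * K\<^sup>2"
    "\<And>y z. a \<le> y \<Longrightarrow> y \<le> z \<Longrightarrow> z \<le> b + (b - a) \<Longrightarrow> G y \<le> G z"
    "\<And>y z. a \<le> y \<Longrightarrow> y \<le> z \<Longrightarrow> z \<le> b + (b - a) \<Longrightarrow> (norm (f z - f y))\<^sup>2 \<le> (z - y) * (G z - G y)"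
proof -
  let ?g2 = "\<lambda>x. (norm (g x))\<^sup>2"
  define H where "H x = integral {a..x} ?g2" for x
  \<comment> \<open>Cumulative energy, continued into the second period; the branches agree at
    \<open>b\<close> because \<open>H a = 0\<close>.\<close>
  define G where "G x = (if x \<le> b then H x else H b + H (x - (b - a)))" for x
  have g2': "?g2 integrable_on {y..z}" if "a \<le> y" "z \<le> b" for y z
    by (rule integrable_on_subinterval[OF g2]) (use that in auto)
  have g': "g integrable_on {y..z}" if "a \<le> y" "z \<le> b" for y z
    by (rule integrable_on_subinterval[OF g]) (use that in auto)
  have Hdiff: "H z - H y = integral {y..z} ?g2" if "a \<le> y" "y \<le> z" "z \<le> b" for y z
    using Henstock_Kurzweil_Integration.integral_combine[of a y z ?g2] that g2'[of a z] by (simp add: H_def)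
  have fdiff: "f z - f y = integral {y..z} g" if "a \<le> y" "y \<le> z" "z \<le> b" for y z
    using Henstock_Kurzweil_Integration.integral_combine[of a y z g] that g'[of a z] f[of y] f[of z]
    by (simp add: algebra_simps)
  have Hmono: "H y \<le> H z" if "a \<le> y" "y \<le> z" "z \<le> b" for y z
    using Hdiff[OF that] integral_nonneg[OF g2'[of y z]] that by simp
  have Ha: "H a = 0" by (simp add: H_def)
  have H0: "0 \<le> H x" if "a \<le> x" "x \<le> b" for x using Hmono[of a x] that Ha by simp
  have HK: "H x \<le> K\<^sup>2" if "a \<le> x" "x \<le> b" for x
    using Hmono[of x b] that K by (simp add: H_def)
  have lin1: "norm (f z - f y) \<le> (s * (z - y) + (H z - H y) / s) / 2"
    if "a \<le> y" "y \<le> z" "z \<le> b" "s > 0" for y z s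
  proof -
    have "norm (integral {y..z} g) \<le> integral {y..z} (\<lambda>x. s / 2 + ?g2 x * (1 / (2 * s)))"
    proof (rule Henstock_Kurzweil_Integration.integral_norm_bound_integral)
      show "g integrable_on {y..z}" using g'[of y z] that by simp
      show "(\<lambda>x. s / 2 + ?g2 x * (1 / (2 * s))) integrable_on {y..z}"
        using g2'[of y z] that by (intro integrable_add integrable_on_mult_left) auto
      fix x
      have "0 \<le> (s - norm (g x))\<^sup>2" by simp
      then show "norm (g x) \<le> s / 2 + ?g2 x * (1 / (2 * s))"
        using that(4) by (simp add: power2_eq_square field_simps)
    qed
    also have "\<dots> = s / 2 * (z - y) + (H z - H y) * (1 / (2 * s))"
      using g2'[of y z] that
      by (subst integral_add) (auto simp: Hdiff intro!: integrable_on_mult_left)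
    also have "\<dots> = (s * (z - y) + (H z - H y) / s) / 2" using that(4) by (simp add: field_simps)
    finally show ?thesis using fdiff that by simp
  qed
  have perm: "f x = f (x - (b - a))" for x using per[of "x - (b - a)"] by simp
  have GH: "G x = H x" if "x \<le> b" for x using that by (simp add: G_def)
  have GH': "G x = H b + H (x - (b - a))" if "b \<le> x" for x
    using that Ha by (cases "x = b") (auto simp: G_def)
  have lin: "norm (f z - f y) \<le> (s * (z - y) + (G z - G y) / s) / 2"
    if "a \<le> y" "y \<le> z" "z \<le> b + (b - a)" "s > 0" for y z s
  proof -
    consider "z \<le> b" | "b \<le> y" | "y \<le> b" "b \<le> z" by linarith
    then show ?thesis
    proof cases
      case 1
      then show ?thesis using lin1[of y z s] that by (simp add: GH)
    next
      case 2
      then show ?thesis using lin1[of "y - (b - a)" "z - (b - a)" s] that perm[of y] perm[of z] by (simp add: GH')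
    next
      case 3
      have fb: "f b = f a" using per[of a] by simp
      have "norm (f z - f y) \<le> norm (f z - f b) + norm (f b - f y)"
        using norm_triangle_ineq[of "f z - f b" "f b - f y"] by simp
      also have "norm (f b - f y) \<le> (s * (b - y) + (H b - H y) / s) / 2" using lin1[of y b s] that 3 by simp
      also have "norm (f z - f b) \<le> (s * (z - b) + H (z - (b - a)) / s) / 2"
        using lin1[of a "z - (b - a)" s] that 3 perm[of z] Ha by (simp add: fb)
      finally show ?thesis using that 3 by (simp add: GH GH' algebra_simps add_divide_distrib diff_divide_distrib)
    qed
  qed
  have mono: "G y \<le> G z" if "a \<le> y" "y \<le> z" "z \<le> b + (b - a)" for y z
  proof -
    consider "z \<le> b" | "b \<le> y" | "y \<le> b" "b \<le> z" by linarith
    then show ?thesis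
    proof cases
      case 1
      then show ?thesis using Hmono[of y z] that by (simp add: GH)
    next
      case 2
      then show ?thesis using Hmono[of "y - (b - a)" "z - (b - a)"] that by (simp add: GH')
    next
      case 3
      then show ?thesis using Hmono[of y b] H0[of "z - (b - a)"] that by (simp add: GH GH')
    qed
  qed
  show ?thesis
  proof (rule that)
    show "0 \<le> G x \<and> G x \<le> 2 * K\<^sup>2" if "x \<in> {a..b + (b - a)}" for x
    proof (cases "x \<le> b")
      case True
      then show ?thesis using H0[of x] HK[of x] that by (simp add: GH)
    next
      case False
      then show ?thesis using H0[of b] H0[of "x - (b - a)"] HK[of b] HK[of "x - (b - a)"] that ab by (simp add: GH')
    qed
    show "G y \<le> G z" if "a \<le> y" "y \<le> z" "z \<le> b + (b - a)" for y z by (rule mono[OF that])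
    show "(norm (f z - f y))\<^sup>2 \<le> (z - y) * (G z - G y)" if "a \<le> y" "y \<le> z" "z \<le> b + (b - a)" for y z
      by (rule le_mult_of_le_AM_GM) (use lin[OF that] mono[OF that] that in auto)
  qed
qed

text \<open>A shift by m is m shifts by one, each of which telescopes. Below, g is the cumulative
  energy, and a cell is counted by at most m overlapping stencils.\<close>

lemma sum_shift_telescope_le:
  fixes g :: "nat \<Rightarrow> real"
  assumes "\<And>j. j \<le> N + m \<Longrightarrow> 0 \<le> g j \<and> g j \<le> C"
  shows "(\<Sum>j<N. g (j + m) - g j) \<le> real m * C"
  using assms
proof (induction m)
  case (Suc m)
  have "(\<Sum>j<N. g (j + Suc m) - g j) = (\<Sum>j<N. g (j + m) - g j) + (\<Sum>j<N. g (Suc j + m) - g (j + m))"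
    by (simp flip: sum.distrib)
  also have "(\<Sum>j<N. g (Suc j + m) - g (j + m)) = g (N + m) - g m"
    using sum_lessThan_telescope[of "\<lambda>j. g (j + m)" N] by simp
  also have "\<dots> \<le> C" using Suc.prems[of "N + m"] Suc.prems[of m] by simp
  finally show ?case using Suc.IH Suc.prems by (simp add: algebra_simps)
qed simp

text \<open>The conclusion of \<open>sobolev_modulus\<close> with the energy function hidden; 2 K^2
  bounds the energy over two periods.\<close>

definition energy_modulus :: "real \<Rightarrow> real \<Rightarrow> real \<Rightarrow> (real \<Rightarrow> 'a::real_normed_vector) \<Rightarrow> bool" where
  "energy_modulus a b K f \<longleftrightarrow> (\<exists>G. (\<forall>x\<in>{a..b + (b - a)}. 0 \<le> G x \<and> G x \<le> 2 * K\<^sup>2)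
       \<and> (\<forall>y z. a \<le> y \<longrightarrow> y \<le> z \<longrightarrow> z \<le> b + (b - a) \<longrightarrow> G y \<le> G z
            \<and> (norm (f z - f y))\<^sup>2 \<le> (z - y) * (G z - G y)))"

lemma energy_modulusE:
  assumes "energy_modulus a b K f"
  obtains G where "\<And>x. x \<in> {a..b + (b - a)} \<Longrightarrow> 0 \<le> G x \<and> G x \<le> 2 * K\<^sup>2"
    "\<And>y z. a \<le> y \<Longrightarrow> y \<le> z \<Longrightarrow> z \<le> b + (b - a) \<Longrightarrow> G y \<le> G z \<and> (norm (f z - f y))\<^sup>2 \<le> (z - y) * (G z - G y)"
  using assms unfolding energy_modulus_def by blast

text \<open>The energy of each derivative gives the modulus of the one below. The uniform bound is
  the one-dimensional Sobolev embedding: the value at x is compared with the value at y through the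
  modulus, then averaged over y in one period.\<close>

lemma H_per_bounded_derivatives:
  assumes ab: "a < b" and m: "m \<ge> 2" and H: "H_per_bounded a b m K u"
  shows "\<exists>D. D 0 = u \<and> (\<forall>k<m-1. \<forall>x. (D k has_vector_derivative D (Suc k) x) (at x))
    \<and> (\<forall>k\<le>m-1. energy_modulus a b K (D k) \<and>
        (\<forall>x. norm (D k x) \<le> sqrt (2 * K\<^sup>2 / (b - a) + 4 * (b - a) * K\<^sup>2)))"
proof -
  obtain D where D0: "D 0 = u" and per: "\<And>x. u (x + (b - a)) = u x"
    and dD: "\<And>k x. k < m - 1 \<Longrightarrow> (D k has_vector_derivative D (Suc k) x) (at x)"
    and im: "D m integrable_on {a..b}" "(\<lambda>x. (norm (D m x))\<^sup>2) integrable_on {a..b}"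
    and rep: "\<And>x. x \<in> {a..b} \<Longrightarrow> D (m - 1) x = D (m - 1) a + integral {a..x} (D m)"
    and K: "(\<Sum>k\<le>m. integral {a..b} (\<lambda>x. (norm (D k x))\<^sup>2)) \<le> K\<^sup>2"
    using H unfolding H_per_bounded_def by metis
  have perD: "D k (x + (b - a)) = D k x" if "k \<le> m - 1" for k x
    by (rule derivatives_periodic[of D "b - a" "m - 1"]) (use D0 per dD that in auto)
  have cont: "continuous_on {a..b} (D k)" if "k \<le> m - 1" for k
  proof (cases "k = m - 1")
    case True
    have "continuous_on {a..b} (\<lambda>x. D (m - 1) a + integral {a..x} (D m))"
      by (intro continuous_intros indefinite_integral_continuous_1 im)
    then show ?thesis unfolding True by (rule continuous_on_eq) (rule rep[symmetric])
  next
    case False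
    then have "k < m - 1" using that by simp
    then show ?thesis using dD
      by (meson continuous_at_imp_continuous_on has_vector_derivative_continuous)
  qed
  have int2: "(\<lambda>x. (norm (D k x))\<^sup>2) integrable_on {a..b}" if "k \<le> m" for k
  proof (cases "k = m")
    case False
    then show ?thesis using cont[of k] that by (intro integrable_continuous_interval continuous_intros) auto
  qed (use im in simp)
  have K1: "integral {a..b} (\<lambda>x. (norm (D k x))\<^sup>2) \<le> K\<^sup>2" if "k \<le> m" for k
  proof -
    have "integral {a..b} (\<lambda>x. (norm (D k x))\<^sup>2) \<le> (\<Sum>k\<le>m. integral {a..b} (\<lambda>x. (norm (D k x))\<^sup>2))"
      by (rule member_le_sum) (use that int2 in \<open>auto intro!: integral_nonneg\<close>)
    then show ?thesis using K by simp
  qed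
  have G': "energy_modulus a b K (D (k - 1))" if k: "1 \<le> k" "k \<le> m" for k
  proof -
    have int1: "D k integrable_on {a..b}"
    proof (cases "k = m")
      case False
      then show ?thesis using cont[of k] k by (intro integrable_continuous_interval) auto
    qed (use im in simp)
    have rep1: "D (k - 1) x = D (k - 1) a + integral {a..x} (D k)" if x: "x \<in> {a..b}" for x
    proof (cases "k = m")
      case False
      have "(D k has_integral (D (k - 1) x - D (k - 1) a)) {a..x}"
      proof (rule fundamental_theorem_of_calculus)
        show "(D (k - 1) has_vector_derivative D k y) (at y within {a..x})" for y
          using dD[of "k - 1" y] k False by (auto intro: has_vector_derivative_at_within)
      qed (use x in simp)
      then show ?thesis by (simp add: integral_unique)
    qed (use rep[OF x] in simp)
    have k1: "k - 1 \<le> m - 1" using k by simp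
    from sobolev_modulus[OF ab perD[OF k1] int1 int2[OF k(2)] rep1 K1[OF k(2)]]
    obtain G where "\<And>x. x \<in> {a..b + (b - a)} \<Longrightarrow> 0 \<le> G x \<and> G x \<le> 2 * K\<^sup>2"
      "\<And>y z. a \<le> y \<Longrightarrow> y \<le> z \<Longrightarrow> z \<le> b + (b - a) \<Longrightarrow> G y \<le> G z"
      "\<And>y z. a \<le> y \<Longrightarrow> y \<le> z \<Longrightarrow> z \<le> b + (b - a) \<Longrightarrow> (norm (D (k - 1) z - D (k - 1) y))\<^sup>2 \<le> (z - y) * (G z - G y)"
      by metis
    then show ?thesis unfolding energy_modulus_def by (intro exI[of _ G]) auto
  qed
  have G: "energy_modulus a b K (D k)" if "k \<le> m - 1" for k
    using G'[of "Suc k"] that m by simp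
  have sup: "norm (D k x) \<le> sqrt (2 * K\<^sup>2 / (b - a) + 4 * (b - a) * K\<^sup>2)" if k: "k \<le> m - 1" for k x
  proof -
    obtain G where G0: "\<And>x. x \<in> {a..b + (b - a)} \<Longrightarrow> 0 \<le> G x \<and> G x \<le> 2 * K\<^sup>2"
      and G1: "\<And>y z. a \<le> y \<Longrightarrow> y \<le> z \<Longrightarrow> z \<le> b + (b - a) \<Longrightarrow> G y \<le> G z \<and> (norm (D k z - D k y))\<^sup>2 \<le> (z - y) * (G z - G y)"
      using energy_modulusE[OF G[OF k]] by blast
    have osc: "(norm (D k z - D k y))\<^sup>2 \<le> (b - a) * (2 * K\<^sup>2)" if "y \<in> {a..b}" "z \<in> {a..b}" "y \<le> z" for y z
    proof -
      have "(norm (D k z - D k y))\<^sup>2 \<le> (z - y) * (G z - G y)" using G1[of y z] that by simp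
      also have "\<dots> \<le> (b - a) * (2 * K\<^sup>2)"
        using that G0[of y] G0[of z] G1[of y z] by (intro mult_mono) auto
      finally show ?thesis .
    qed
    obtain x' where x': "x' \<in> {a..b}" "D k x' = D k x"
      using periodic_representative[of "D k" "b - a" a x] perD[OF k] ab by auto
    have pt: "(norm (D k x'))\<^sup>2 \<le> 2 * (norm (D k y))\<^sup>2 + 4 * (b - a) * K\<^sup>2" if "y \<in> {a..b}" for y
    proof -
      have o: "(norm (D k x' - D k y))\<^sup>2 \<le> (b - a) * (2 * K\<^sup>2)"
        using osc[OF that x'(1)] osc[OF x'(1) that] by (cases "y \<le> x'") (auto simp: norm_minus_commute)
      have "norm (D k x') \<le> norm (D k y) + norm (D k x' - D k y)"
        by (metis norm_triangle_sub)
      then have "(norm (D k x'))\<^sup>2 \<le> (norm (D k y) + norm (D k x' - D k y))\<^sup>2" by (intro power_mono) auto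
      also have "\<dots> \<le> 2 * (norm (D k y))\<^sup>2 + 2 * (norm (D k x' - D k y))\<^sup>2"
        using sum_squares_bound[of "norm (D k y)" "norm (D k x' - D k y)"] by (simp add: power2_sum)
      finally show ?thesis using o by (simp add: algebra_simps)
    qed
    have "integral {a..b} (\<lambda>y. (norm (D k x'))\<^sup>2) \<le> integral {a..b} (\<lambda>y. (norm (D k y))\<^sup>2 * 2 + 4 * (b - a) * K\<^sup>2)"
      using int2[of k] k pt by (intro integral_le integrable_add integrable_on_mult_left) (auto simp: mult.commute[of _ 2])
    also have "\<dots> = integral {a..b} (\<lambda>y. (norm (D k y))\<^sup>2) * 2 + (b - a) * (4 * (b - a) * K\<^sup>2)"
      using int2[of k] k ab by (subst integral_add) (auto intro!: integrable_on_mult_left)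
    also have "\<dots> \<le> K\<^sup>2 * 2 + (b - a) * (4 * (b - a) * K\<^sup>2)" using K1[of k] k by simp
    finally have "(b - a) * (norm (D k x))\<^sup>2 \<le> 2 * K\<^sup>2 + (b - a) * (4 * (b - a) * K\<^sup>2)"
      using ab x' by simp
    then have "(norm (D k x))\<^sup>2 \<le> 2 * K\<^sup>2 / (b - a) + 4 * (b - a) * K\<^sup>2"
      using ab by (simp add: field_simps)
    then show ?thesis by (rule real_le_rsqrt)
  qed
  show ?thesis using D0 dD G sup by blast
qed

text \<open>\<open>B\<close> is obtained before u and N, hence is uniform in time, in the grid and
  in epsilon. Below order m the bounds are pointwise; at order m the stencil energies are summed.
  The Taylor remainder is of order h^(3/2), because the first derivative is Hoelder continuous with
  exponent 1/2.\<close>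

lemma H_per_bounded_grid:
  assumes ab: "a < b" and m: "m \<ge> 2"
  obtains B where "0 < B"
    "\<And>u N k. H_per_bounded a b m K u \<Longrightarrow> m \<le> N \<Longrightarrow> k \<le> m \<Longrightarrow>
       L2_set (\<lambda>j. norm ((dd ^^ k) (\<lambda>j. u (grid a b N j)) j)) {..<N} \<le> B * sqrt N * ((b - a) / N) ^ k"
    "\<And>u x. H_per_bounded a b m K u \<Longrightarrow> norm (u x) \<le> B"
    "\<And>u u' x h. H_per_bounded a b m K u \<Longrightarrow> (u has_vector_derivative u') (at x) \<Longrightarrow>
       x \<in> {a..b} \<Longrightarrow> 0 \<le> h \<Longrightarrow> h \<le> b - a \<Longrightarrow> norm (u (x + h) - u x - h *\<^sub>R u') \<le> h * (B * sqrt h)"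
proof -
  define S where "S = sqrt (2 * K\<^sup>2 / (b - a) + 4 * (b - a) * K\<^sup>2)"
  define B where "B = 1 + S + sqrt (2 * K\<^sup>2) + sqrt (2 * real m * K\<^sup>2 / (b - a))"
  have S0: "0 \<le> S" using ab by (simp add: S_def)
  have nn: "0 \<le> sqrt (2 * K\<^sup>2)" "0 \<le> sqrt (2 * real m * K\<^sup>2 / (b - a))" using ab by auto
  have B: "S \<le> B" "sqrt (2 * K\<^sup>2) \<le> B" "sqrt (2 * real m * K\<^sup>2 / (b - a)) \<le> B" "0 < B"
    using S0 nn unfolding B_def by linarith+
  show ?thesis
  proof (rule that[OF B(4)])
    fix u N k assume H: "H_per_bounded a b m K u" and N: "m \<le> N" and k: "k \<le> m"
    obtain D where D0: "D 0 = u"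
      and dD: "\<And>k x. k < m - 1 \<Longrightarrow> (D k has_vector_derivative D (Suc k) x) (at x)"
      and G: "\<And>k. k \<le> m - 1 \<Longrightarrow> energy_modulus a b K (D k)"
      and sup: "\<And>k x. k \<le> m - 1 \<Longrightarrow> norm (D k x) \<le> S"
      using H_per_bounded_derivatives[OF ab m H, folded S_def] by blast
    define h where "h = (b - a) / N"
    have N0: "N > 0" using N m by simp
    have h0: "0 < h" using ab N0 by (simp add: h_def)
    have hN: "real N * h = b - a" using N0 by (simp add: h_def)
    have gr: "(dd ^^ k) (\<lambda>j. u (grid a b N j)) j = (dx h ^^ k) u (a + real j * h)" for j k
      unfolding grid_def h_def by (rule dd_pow_dx)
    show "L2_set (\<lambda>j. norm ((dd ^^ k) (\<lambda>j. u (grid a b N j)) j)) {..<N} \<le> B * sqrt N * ((b - a) / N) ^ k"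
    proof (cases "k = m")
      case False
      have "norm ((dx h ^^ k) u x) \<le> h ^ k * S" for x
        unfolding D0[symmetric] by (rule dx_pow_bound) (use False k dD sup h0 in auto)
      then have "L2_set (\<lambda>j. norm ((dd ^^ k) (\<lambda>j. u (grid a b N j)) j)) {..<N} \<le> L2_set (\<lambda>j. h ^ k * S) {..<N}"
        unfolding gr by (intro L2_set_mono) auto
      also have "\<dots> = sqrt N * (h ^ k * S)" using h0 S0 by (simp add: L2_set_constant)
      also have "\<dots> \<le> sqrt N * (h ^ k * B)" using h0 B by (intro mult_left_mono) auto
      finally show ?thesis by (simp add: h_def mult_ac)
    next
      case True
      obtain G where G0: "\<And>x. x \<in> {a..b + (b - a)} \<Longrightarrow> 0 \<le> G x \<and> G x \<le> 2 * K\<^sup>2"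
        and G1: "\<And>y z. a \<le> y \<Longrightarrow> y \<le> z \<Longrightarrow> z \<le> b + (b - a) \<Longrightarrow> G y \<le> G z \<and> (norm (D (m - 1) z - D (m - 1) y))\<^sup>2 \<le> (z - y) * (G z - G y)"
        using energy_modulusE[OF G[of "m - 1"]] by blast
      define g where "g j = G (a + real j * h)" for j :: nat
      have inI: "a + real j * h \<in> {a..b + (b - a)}" if "j \<le> N + m" for j
      proof -
        \<comment> \<open>This is where m <= N enters: all stencils stay within two periods.\<close>
        have "real j * h \<le> real (2 * N) * h" using that N h0 by (intro mult_right_mono) auto
        also have "\<dots> = 2 * (b - a)" using hN by simp
        finally show ?thesis using h0 by simp
      qed
      \<comment> \<open>m - 1 differences become derivatives; the last one, of
        \<open>D (m - 1)\<close>, is bounded by the energy of the whole stencil, since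
        \<open>G\<close> is monotone.\<close>
      have pt: "(norm ((dx h ^^ m) u (a + real j * h)))\<^sup>2 \<le> h ^ (2 * m - 1) * (g (j + m) - g j)" if j: "j < N" for j
      proof -
        let ?x = "a + real j * h"
        let ?q = "h * (g (j + m) - g j)"
        have xm: "?x + real m * h = a + real (j + m) * h" by (simp add: algebra_simps)
        have upper: "a + real (j + m) * h \<le> b + (b - a)" using inI[of "j + m"] j by auto
        have "norm ((dx h ^^ (m - 1)) (dx h (D 0)) ?x) \<le> h ^ (m - 1) * sqrt ?q"
        proof (rule dx_pow_bound[of "m - 1" "\<lambda>i. dx h (D i)"])
          show "(dx h (D i) has_vector_derivative dx h (D (Suc i)) z) (at z)" if "i < m - 1" for i z
            using dx_pow_derivative[of "D i" "D (Suc i)" 1 h z] dD[OF that] by simp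
          fix y assume y: "y \<in> {?x..?x + real (m - 1) * h}"
          have yh: "y + h \<le> a + real (j + m) * h"
            using y xm m by (simp add: of_nat_diff algebra_simps)
          have ya: "a \<le> y" using y h0 by (smt (verit) atLeastAtMost_iff mult_nonneg_nonneg of_nat_0_le_iff)
          have "(norm (dx h (D (m - 1)) y))\<^sup>2 \<le> h * (G (y + h) - G y)"
            using G1[of y "y + h"] ya yh upper h0 by (simp add: dx_def)
          also have "\<dots> \<le> ?q"
          proof (rule mult_left_mono)
            have "G (y + h) \<le> g (j + m)" using G1[of "y + h" "a + real (j + m) * h"] yh upper ya h0
              by (simp add: g_def)
            moreover have "g j \<le> G y" using G1[of ?x y] y yh upper h0 by (simp add: g_def)
            ultimately show "G (y + h) - G y \<le> g (j + m) - g j" by simp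
          qed (use h0 in simp)
          finally show "norm (dx h (D (m - 1)) y) \<le> sqrt ?q" by (rule real_le_rsqrt)
        qed (use h0 in simp)
        moreover have "(dx h ^^ (m - 1)) (dx h (D 0)) = (dx h ^^ m) u"
          using m by (cases m) (simp_all add: funpow_swap1 D0)
        ultimately have "norm ((dx h ^^ m) u ?x) \<le> h ^ (m - 1) * sqrt ?q" by simp
        then have "(norm ((dx h ^^ m) u ?x))\<^sup>2 \<le> (h ^ (m - 1) * sqrt ?q)\<^sup>2" by (intro power_mono) auto
        also have "0 \<le> ?q"
          using G1[of ?x "a + real (j + m) * h"] upper h0 by (intro mult_nonneg_nonneg) (auto simp: g_def algebra_simps)
        then have "(h ^ (m - 1) * sqrt ?q)\<^sup>2 = (h ^ (m - 1))\<^sup>2 * ?q" by (simp add: power_mult_distrib)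
        also have "\<dots> = h ^ (2 * m - 1) * (g (j + m) - g j)"
        proof -
          have "2 * m - 1 = 2 * (m - 1) + 1" using m by simp
          then show ?thesis by (simp only: power_add power_mult power_even_eq power_one_right mult_ac) 
        qed
        finally show ?thesis .
      qed
      have "(\<Sum>j<N. (norm ((dx h ^^ m) u (a + real j * h)))\<^sup>2) \<le> (\<Sum>j<N. h ^ (2 * m - 1) * (g (j + m) - g j))"
        by (intro sum_mono pt) auto
      also have "\<dots> = h ^ (2 * m - 1) * (\<Sum>j<N. g (j + m) - g j)" by (simp add: sum_distrib_left)
      also have "\<dots> \<le> h ^ (2 * m - 1) * (real m * (2 * K\<^sup>2))"
        using h0 G0 inI by (intro mult_left_mono sum_shift_telescope_le) (auto simp: g_def)
      \<comment> \<open>The missing power of h is supplied by N h = b - a, whence the factor sqrt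
        N.\<close>
      also have "\<dots> = (sqrt (2 * real m * K\<^sup>2 / (b - a)) * sqrt N * h ^ m)\<^sup>2"
      proof -
        have "h ^ (2 * m) = h * h ^ (2 * m - 1)" using m by (cases m) auto
        then have "(sqrt (2 * real m * K\<^sup>2 / (b - a)) * sqrt N * h ^ m)\<^sup>2 = (2 * real m * K\<^sup>2 / (b - a)) * (real N * h) * h ^ (2 * m - 1)"
          using ab by (simp add: power_mult_distrib power_even_eq flip: power_mult)
        then show ?thesis unfolding hN using ab by simp
      qed
      also have "\<dots> \<le> (B * sqrt N * h ^ m)\<^sup>2"
        using B nn h0 by (intro power_mono mult_right_mono mult_nonneg_nonneg) auto
      finally have "L2_set (\<lambda>j. norm ((dx h ^^ m) u (a + real j * h))) {..<N} \<le> B * sqrt N * h ^ m"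
        unfolding L2_set_def using B h0 by (intro real_le_lsqrt sum_nonneg) auto
      then show ?thesis unfolding gr True by (simp add: h_def)
    qed
  next
    fix u x assume H: "H_per_bounded a b m K u"
    show "norm (u x) \<le> B"
      using H_per_bounded_derivatives[OF ab m H, folded S_def] B(1) by (meson le0 order_trans)
  next
    fix u u' x h assume H: "H_per_bounded a b m K u" and u': "(u has_vector_derivative u') (at x)"
      and x: "x \<in> {a..b}" and h: "0 \<le> h" "h \<le> b - a"
    obtain D where D0: "D 0 = u"
      and dD: "\<And>k x. k < m - 1 \<Longrightarrow> (D k has_vector_derivative D (Suc k) x) (at x)"
      and G: "\<And>k. k \<le> m - 1 \<Longrightarrow> energy_modulus a b K (D k)"
      using H_per_bounded_derivatives[OF ab m H] by blast
    have m1: "1 \<le> m - 1" using m by simp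
    have d0: "(u has_vector_derivative D 1 z) (at z)" for z using dD[of 0 z] D0 m by simp
    then have u'D: "u' = D 1 x" using vector_derivative_unique_at[OF u'] by blast
    obtain G where G0: "\<And>x. x \<in> {a..b + (b - a)} \<Longrightarrow> 0 \<le> G x \<and> G x \<le> 2 * K\<^sup>2"
      and G1: "\<And>y z. a \<le> y \<Longrightarrow> y \<le> z \<Longrightarrow> z \<le> b + (b - a) \<Longrightarrow> G y \<le> G z \<and> (norm (D 1 z - D 1 y))\<^sup>2 \<le> (z - y) * (G z - G y)"
      using energy_modulusE[OF G[OF m1]] by blast
    have "norm ((u (x + h) - (x + h) *\<^sub>R u') - (u x - x *\<^sub>R u')) \<le> (x + h - x) * (B * sqrt h)"
    proof (rule vector_mean_value_bound[where f="\<lambda>z. u z - z *\<^sub>R u'" and f'="\<lambda>z. D 1 z - u'"])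
      show "((\<lambda>z. u z - z *\<^sub>R u') has_vector_derivative D 1 z - u') (at z)" for z
        using has_vector_derivative_diff[OF d0[of z] has_vector_derivative_scaleR[of "\<lambda>z. z" 1 z UNIV "\<lambda>_. u'" 0]]
        by simp
      fix z assume z: "z \<in> {x..x + h}"
      have zx: "a \<le> x" "x \<le> z" "z \<le> b + (b - a)" using z x h by auto
      have "(norm (D 1 z - u'))\<^sup>2 \<le> (z - x) * (G z - G x)" unfolding u'D using G1[OF zx] by simp
      also have "\<dots> \<le> h * (2 * K\<^sup>2)"
        using z zx G0[of x] G0[of z] G1[OF zx] by (intro mult_mono) auto
      finally have "norm (D 1 z - u') \<le> sqrt (h * (2 * K\<^sup>2))" by (rule real_le_rsqrt)
      also have "\<dots> = sqrt (2 * K\<^sup>2) * sqrt h" by (simp add: real_sqrt_mult)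
      also have "\<dots> \<le> B * sqrt h" using B h by (intro mult_right_mono) auto
      finally show "norm (D 1 z - u') \<le> B * sqrt h" .
    qed (use h in simp)
    then show "norm (u (x + h) - u x - h *\<^sub>R u') \<le> h * (B * sqrt h)"
      by (simp add: algebra_simps)
  qed
qed

subsection \<open>The scheme and the equation on a fine grid\<close>

lemma grid_periodic: "N > 0 \<Longrightarrow> grid a b N (j + N) = grid a b N j + (b - a)"
  by (simp add: grid_def field_simps)

lemma grid_refine: "q > 0 \<Longrightarrow> M > 0 \<Longrightarrow> grid a b (q * M) (q * j) = grid a b M j"
  by (simp add: grid_def field_simps)

lemma grid_mem: "a < b \<Longrightarrow> j \<le> N \<Longrightarrow> N > 0 \<Longrightarrow> grid a b N j \<in> {a..b}"
proof -
  assume "a < b" "j \<le> N" "N > 0"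
  then have "real j * ((b - a) / N) \<le> real N * ((b - a) / N)" by (intro mult_right_mono) auto
  then show ?thesis using \<open>a < b\<close> \<open>N > 0\<close> by (simp add: grid_def)
qed

text \<open>Used at the end, to pass from mean-square errors on fine grids to
  \<open>L2_norm\<close>. Uniform continuity gives an error h e per cell.\<close>

lemma riemann_sum_tendsto:
  fixes f :: "real \<Rightarrow> real"
  assumes ab: "a < b" and f: "continuous_on {a..b} f"
  shows "(\<lambda>N. (b - a) / real N * (\<Sum>j<N. f (grid a b N j))) \<longlonglongrightarrow> integral {a..b} f"
proof (rule LIMSEQ_I)
  fix r :: real assume r: "r > 0"
  define e where "e = r / 2 / (b - a)"
  have e: "e > 0" using r ab by (simp add: e_def)
  have "uniformly_continuous_on {a..b} f"
    using f compact_uniformly_continuous by blast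
  then obtain d where d: "d > 0" "\<And>x y. x \<in> {a..b} \<Longrightarrow> y \<in> {a..b} \<Longrightarrow> dist y x < d \<Longrightarrow> dist (f y) (f x) < e"
    using e unfolding uniformly_continuous_on_def by meson
  obtain N0 where N0: "(b - a) / d < real N0" using reals_Archimedean2 by blast
  have "norm ((b - a) / real N * (\<Sum>j<N. f (grid a b N j)) - integral {a..b} f) < r" if N: "N \<ge> max 1 N0" for N
  proof -
    define h where "h = (b - a) / N"
    have Npos: "N > 0" using N by simp
    have h: "0 < h" "real N * h = b - a" using ab Npos by (auto simp: h_def)
    have hd: "h < d" using N0 N Npos d(1) by (simp add: h_def field_simps) (smt (verit) mult_less_cancel_right_pos of_nat_le_iff mult_left_mono)
    let ?x = "\<lambda>j. grid a b N j"
    have x_Suc: "?x (Suc j) = ?x j + h" for j by (simp add: grid_def h_def distrib_right add_divide_distrib)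
    have step: "\<bar>h * (\<Sum>j<n. f (?x j)) - integral {a..?x n} f\<bar> \<le> real n * (h * e)" if "n \<le> N" for n
      using that
    proof (induction n)
      case 0
      then show ?case by (simp add: grid_def)
    next
      case (Suc n)
      have xs: "a \<le> ?x n" "?x n \<le> ?x (Suc n)" "?x (Suc n) \<le> b"
        using grid_mem[OF ab, of n N] grid_mem[OF ab, of "Suc n" N] Suc.prems Npos h x_Suc by auto
      have int: "f integrable_on {y..z}" if "a \<le> y" "z \<le> b" for y z
        using continuous_on_subset[OF f] that by (intro integrable_continuous_interval) auto
      have "\<bar>h * f (?x n) - integral {?x n..?x (Suc n)} f\<bar> \<le> h * e"
      proof -
        have "integral {?x n..?x (Suc n)} (\<lambda>y. f (?x n) - f y) = h * f (?x n) - integral {?x n..?x (Suc n)} f"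
          using int[of "?x n" "?x (Suc n)"] xs h by (subst integral_diff) (auto simp: x_Suc)
        moreover have "norm (integral {?x n..?x (Suc n)} (\<lambda>y. f (?x n) - f y)) \<le> e * (?x (Suc n) - ?x n)"
        proof (rule integral_bound)
          show "continuous_on {?x n..?x (Suc n)} (\<lambda>y. f (?x n) - f y)"
            using continuous_on_subset[OF f] xs by (intro continuous_intros) auto
          show "norm (f (?x n) - f y) \<le> e" if "y \<in> {?x n..?x (Suc n)}" for y
            using d(2)[of y "?x n"] that xs hd x_Suc by (auto simp: dist_real_def)
        qed (use xs in auto)
        ultimately show ?thesis by (simp add: x_Suc mult.commute)
      qed
      moreover have "integral {a..?x n} f + integral {?x n..?x (Suc n)} f = integral {a..?x (Suc n)} f"
        by (rule Henstock_Kurzweil_Integration.integral_combine) (use xs int in auto)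
      ultimately show ?case using Suc by (simp add: algebra_simps)
    qed
    have "?x N = b" using Npos by (simp add: grid_def)
    then have "\<bar>h * (\<Sum>j<N. f (?x j)) - integral {a..b} f\<bar> \<le> (real N * h) * e" using step[of N] by simp
    also have "\<dots> = r / 2"
    proof -
      have "c * (r / 2 / c) = r / 2" if "c \<noteq> 0" for c using that by simp
      from this[of "b - a"] show ?thesis unfolding h(2) e_def using ab by argo
    qed
    also have "\<dots> < r" using r by simp
    finally show ?thesis by (simp add: h_def)
  qed
  then show "\<exists>no. \<forall>N\<ge>no. norm ((b - a) / real N * (\<Sum>j<N. f (grid a b N j)) - integral {a..b} f) < r" by blast
qed

lemma dft_matrix: "dft M (\<lambda>j. B *v U j) l = B *v dft M U l"
proof -
  have "dft M (\<lambda>j. B *v U j) l = (\<Sum>j<M. B *v ((rt M (- (int j * l)) / of_nat M) *s U j))"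
    by (simp add: dft_rt vec.scale)
  then show ?thesis unfolding dft_rt by (simp add: vec.sum)
qed

lemma norm_dft_le:
  assumes "M > 0" "\<And>j. j < M \<Longrightarrow> norm (U j) \<le> c"
  shows "norm (dft M U l) \<le> c"
proof -
  have "norm (dft M U l) \<le> (\<Sum>j<M. c / M)"
    unfolding dft_rt
    by (rule sum_norm_le) (use assms in \<open>auto simp: norm_vmult norm_divide divide_right_mono\<close>)
  then show ?thesis using assms(1) by simp
qed

lemma has_vector_derivative_dft:
  assumes "\<And>j. j < M \<Longrightarrow> ((\<lambda>s. U s j) has_vector_derivative U' j) (at x within S)"
  shows "((\<lambda>s. dft M (U s) l) has_vector_derivative dft M U' l) (at x within S)"
  unfolding dft_rt
  by (intro has_vector_derivative_sum bounded_linear.has_vector_derivative[OF vmult.bounded_linear_right] assms) auto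

lemma cmod_cis_taylor: "cmod (cis x - 1 - \<i> * of_real x) \<le> x\<^sup>2"
proof -
  have pos: "cmod (cis x - 1 - \<i> * of_real x) \<le> x\<^sup>2" if "0 \<le> x" for x
  proof -
    have "norm ((cis x - \<i> * of_real x) - (cis 0 - \<i> * of_real 0)) \<le> (x - 0) * x"
    proof (rule vector_mean_value_bound[OF that, where f'="\<lambda>x. \<i> * cis x - \<i>"])
      have "((\<lambda>z. \<i> * complex_of_real z) has_vector_derivative \<i>) (at z)" for z
        by (auto intro!: derivative_eq_intros)
      then show "((\<lambda>z. cis z - \<i> * of_real z) has_vector_derivative \<i> * cis z - \<i>) (at z)" for z
        by (intro has_vector_derivative_diff has_vector_derivative_cis)
      fix z assume z: "z \<in> {0..x}"
      have "\<i> * cis z - \<i> = \<i> * (cis z - 1)" by (simp add: algebra_simps)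
      then have "norm (\<i> * cis z - \<i>) = cmod (cis z - 1)" by (simp add: norm_mult)
      then show "norm (\<i> * cis z - \<i>) \<le> x" using cmod_cis_diff_1[of z] z by simp
    qed
    then show ?thesis by (simp add: power2_eq_square algebra_simps)
  qed
  show ?thesis
  proof (cases "0 \<le> x")
    case False
    have "cis x - 1 - \<i> * of_real x = cnj (cis (- x) - 1 - \<i> * of_real (- x))" by (simp add: cis_cnj)
    then have "cmod (cis x - 1 - \<i> * of_real x) = cmod (cis (- x) - 1 - \<i> * of_real (- x))"
      by (simp only: complex_mod_cnj)
    then show ?thesis using pos[of "- x"] False by simp
  qed (rule pos)
qed

lemma pot_diff: "pot v w (x - y) = pot v w x - pot v w y"
  by (simp add: pot_def gen_def spec_diff)

lemma exp_mu_grid: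
  assumes "a < b" "N > 0"
  shows "exp (\<i> * of_real (mu a b l * (grid a b N j - a))) = rt N (int j * l)"
proof -
  have "mu a b l * (grid a b N j - a) = 2 * pi * real_of_int (int j * l) / real N"
    using assms by (simp add: mu_def grid_def)
  then show ?thesis by (simp add: rt_def cis_conv_exp)
qed

lemma mexp_pot:
  "mexp (smat (- \<i> * of_real s) (v *\<^sub>R mat 1 - w *\<^sub>R sigma1)) *v u = grp (pi/4) (w - v) (- v - w) s u"
proof -
  have "smat (- \<i> * of_real s) (v *\<^sub>R mat 1 - w *\<^sub>R sigma1)
      = smat (- \<i> * of_real (s * v)) (mat 1) + smat (\<i> * of_real (s * w)) (reflm (pi/4))"
    unfolding sigma1_reflm vec_eq_iff
    by (simp add: smat_def scaleR_conv_of_real[where 'a=complex] algebra_simps)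
  from mexp_spec[OF this] show ?thesis
    unfolding grp_def cis_conv_exp by (simp add: algebra_simps)
qed

context torus
begin

lemma free_flow_grid:
  "M > 0 \<Longrightarrow> free_flow a b M s U (grid a b M j) = ev M (F s (dft M U)) j"
  unfolding free_flow_def ev_def by (simp only: exp_mu_grid[OF ab] mexp_F)

text \<open>Zero padding: on the finer grid the interpolant has the same coefficients and none
  outside \<open>modes M\<close>.\<close>

lemma interp_grid:
  assumes "M > 0" "q > 0"
  shows "interp a b M U (grid a b (q * M) j) = ev (q * M) (\<lambda>l. if l \<in> modes M then dft M U l else 0) j"
proof -
  have "interp a b M U (grid a b (q * M) j) = (\<Sum>l\<in>modes M. rt (q * M) (int j * l) *s dft M U l)"
    unfolding interp_def using exp_mu_grid[OF ab, of "q * M"] assms by (simp only: nat_0_less_mult_iff)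
  also have "\<dots> = (\<Sum>l\<in>modes (q * M). rt (q * M) (int j * l) *s (if l \<in> modes M then dft M U l else 0))"
    by (rule sum.mono_neutral_cong_left) (use modes_subset[OF assms(2), of M] in auto)
  finally show ?thesis by (simp add: ev_def)
qed

end

context scheme
begin

text \<open>A step ends with grid values of a trigonometric polynomial with frequencies in
  \<open>modes M\<close>, so the next transform returns its coefficients exactly.\<close>

lemma dft_tsfp_step:
  assumes v: "\<And>j. v j = V (grid a b M j)" and w: "\<And>j. w j = A1 (grid a b M j)" and l: "l \<in> modes M"
  shows "dft M (tsfp_step a b M \<epsilon> \<tau> V A1 U) l = F (\<tau>/2) (W (\<epsilon> * \<tau>) (F (\<tau>/2) (dft M U))) l"
proof -
  have "tsfp_step a b M \<epsilon> \<tau> V A1 U = ev M (F (\<tau>/2) (dft M (\<lambda>j. grp (pi/4) (w j - v j) (- v j - w j) (\<epsilon> * \<tau>)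
       (ev M (F (\<tau>/2) (dft M U)) j))))"
    unfolding tsfp_step_def Let_def mexp_pot v w free_flow_grid[OF M(1)] ..
  then show ?thesis unfolding W_def by (simp add: dft_ev[OF M l])
qed

end

text \<open>The Sobolev assumptions on the potentials and the solution enter only through their
  consequences for differences, with two constants \<open>A\<close> and \<open>B\<close>.\<close>

locale dirac = torus +
  fixes m :: nat and V A1 :: "real \<Rightarrow> real" and A B \<epsilon> Tend :: real
    and Phi0 :: "real \<Rightarrow> cvec" and Phi :: "real \<Rightarrow> real \<Rightarrow> cvec"
  assumes m: "m \<ge> 2" and \<epsilon>: "0 < \<epsilon>" "\<epsilon> \<le> 1"
    and Vper: "\<And>x. V (x + (b - a)) = V x" and A1per: "\<And>x. A1 (x + (b - a)) = A1 x"
    and VA: "\<And>k h x. k \<le> m \<Longrightarrow> 0 \<le> h \<Longrightarrow> \<bar>(dx h ^^ k) V x\<bar> \<le> A * h ^ k"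
    and A1A: "\<And>k h x. k \<le> m \<Longrightarrow> 0 \<le> h \<Longrightarrow> \<bar>(dx h ^^ k) A1 x\<bar> \<le> A * h ^ k"
    and sol: "dirac_solution a b \<epsilon> V A1 Tend Phi0 Phi"
    and B0: "0 < B"
    and PhiL2: "\<And>t N k. t \<in> {0..Tend} \<Longrightarrow> m \<le> N \<Longrightarrow> k \<le> m \<Longrightarrow>
       L2_set (\<lambda>j. norm ((dd ^^ k) (\<lambda>j. Phi t (grid a b N j)) j)) {..<N} \<le> B * sqrt N * ((b - a) / N) ^ k"
    and Phisup: "\<And>t x. t \<in> {0..Tend} \<Longrightarrow> norm (Phi t x) \<le> B"
    and Phitaylor: "\<And>t u' x h. t \<in> {0..Tend} \<Longrightarrow> (Phi t has_vector_derivative u') (at x) \<Longrightarrow>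
       x \<in> {a..b} \<Longrightarrow> 0 \<le> h \<Longrightarrow> h \<le> b - a \<Longrightarrow> norm (Phi t (x + h) - Phi t x - h *\<^sub>R u') \<le> h * (B * sqrt h)"
begin

lemma A_ge_0: "0 \<le> A"
  using VA[of 0 0 0] by (simp add: order_trans[OF abs_ge_zero])

lemma dd_V: "k \<le> m \<Longrightarrow> \<bar>(dd ^^ k) (\<lambda>j. V (grid a b N j)) j\<bar> \<le> A * ((b - a) / N) ^ k"
  unfolding grid_def dd_pow_dx using ab by (intro VA) auto

lemma dd_A1: "k \<le> m \<Longrightarrow> \<bar>(dd ^^ k) (\<lambda>j. A1 (grid a b N j)) j\<bar> \<le> A * ((b - a) / N) ^ k"
  unfolding grid_def dd_pow_dx using ab by (intro A1A) auto

lemma scheme_grid: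
  assumes "M > 0" "even M"
  shows "scheme a b M (\<lambda>j. V (grid a b M j)) (\<lambda>j. A1 (grid a b M j)) A"
  by unfold_locales (use assms m dd_V dd_A1 in \<open>auto simp: grid_periodic Vper A1per\<close>)

lemma Phiper: "t \<in> {0..Tend} \<Longrightarrow> Phi t (x + (b - a)) = Phi t x"
  using sol by (simp add: dirac_solution_def)

section \<open>The sampled solution and its discrete equation\<close>

definition PG :: "nat \<Rightarrow> real \<Rightarrow> nat \<Rightarrow> cvec" where
  "PG N t j = Phi t (grid a b N j)"

definition QG :: "nat \<Rightarrow> real \<Rightarrow> nat \<Rightarrow> cvec" where
  "QG N t j = pot (V (grid a b N j)) (A1 (grid a b N j)) (PG N t j)"

lemma PG_periodic: "N > 0 \<Longrightarrow> t \<in> {0..Tend} \<Longrightarrow> PG N t (j + N) = PG N t j"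
  by (simp add: PG_def grid_periodic Phiper)

lemma QG_periodic: "N > 0 \<Longrightarrow> t \<in> {0..Tend} \<Longrightarrow> QG N t (j + N) = QG N t j"
  by (simp add: QG_def grid_periodic Vper A1per PG_periodic)

lemma dd_PG: "t \<in> {0..Tend} \<Longrightarrow> m \<le> N \<Longrightarrow> k \<le> m \<Longrightarrow>
    L2_set (\<lambda>j. norm ((dd ^^ k) (PG N t) j)) {..<N} \<le> B * sqrt N * ((b - a) / N) ^ k"
  using PhiL2 by (simp add: PG_def[abs_def])

definition B' :: real where "B' = 2 ^ Suc m * A * B"

lemma dd_QG:
  assumes "t \<in> {0..Tend}" "m \<le> N" "k \<le> m"
  shows "L2_set (\<lambda>j. norm ((dd ^^ k) (QG N t) j)) {..<N} \<le> B' * sqrt N * ((b - a) / N) ^ k"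
proof -
  have "L2_set (\<lambda>j. norm ((dd ^^ k) (QG N t) j)) {..<N} \<le> 2 ^ Suc k * A * (B * sqrt N) * ((b - a) / N) ^ k"
    unfolding QG_def[abs_def]
    by (rule dd_pow_pot) (use assms dd_V dd_A1 dd_PG ab in auto)
  also have "\<dots> = 2 ^ Suc k * (A * (B * sqrt N) * ((b - a) / N) ^ k)" by simp
  also have "\<dots> \<le> 2 ^ Suc m * (A * (B * sqrt N) * ((b - a) / N) ^ k)"
    using assms A_ge_0 B0 ab by (intro mult_right_mono power_increasing) auto
  finally show ?thesis by (simp add: B'_def mult_ac)
qed

text \<open>A choice of the derivative that \<open>dirac_solution\<close> provides only
  existentially; uniqueness identifies it with the one in the equation.\<close>

definition Dx :: "real \<Rightarrow> real \<Rightarrow> cvec" where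
  "Dx t x = (SOME d. (Phi t has_vector_derivative d) (at x))"

lemma Phi_x: "t \<in> {0..Tend} \<Longrightarrow> (Phi t has_vector_derivative Dx t x) (at x)"
  unfolding Dx_def using sol someI_ex[of "\<lambda>d. (Phi t has_vector_derivative d) (at x)"]
  unfolding dirac_solution_def by blast

lemma Phi_t:
  assumes t: "t \<in> {0..Tend}"
  shows "((\<lambda>s. Phi s x) has_vector_derivative
     (- (sigma1 *v Dx t x) - \<i> *s (sigma3 *v Phi t x) + \<epsilon> *\<^sub>R pot (V x) (A1 x) (Phi t x))) (at t within {0..Tend})"
proof -
  obtain Dt D where Dt: "((\<lambda>s. Phi s x) has_vector_derivative Dt) (at t within {0..Tend})"
    and D: "(Phi t has_vector_derivative D) (at x)"
    and eq: "\<i> *s Dt = (- \<i>) *s (sigma1 *v D) + sigma3 *v Phi t x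
                  + \<epsilon> *\<^sub>R ((V x *\<^sub>R mat 1 - A1 x *\<^sub>R sigma1) *v Phi t x)"
    using sol t unfolding dirac_solution_def by blast
  have DD: "D = Dx t x" using vector_derivative_unique_at[OF D Phi_x[OF t]] .
  have mv: "(V x *\<^sub>R mat 1 - A1 x *\<^sub>R sigma1) *v u = V x *\<^sub>R u - A1 x *\<^sub>R (sigma1 *v u)" for u :: cvec
    by (simp add: matrix_vector_mult_diff_rdistrib scaleR_matrix_vmult scaleR_vmult)
  have "Dt = (- \<i>) *s (\<i> *s Dt)" by (simp add: vector_smult_assoc)
  also have "\<dots> = - (sigma1 *v Dx t x) - \<i> *s (sigma3 *v Phi t x) + \<epsilon> *\<^sub>R pot (V x) (A1 x) (Phi t x)"
    unfolding eq mv DD pot_sigma1 scaleR_vmult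
    by (simp add: vmult.add_right vmult.diff_right vector_smult_assoc mult_ac)
  finally show ?thesis using Dt by simp
qed

text \<open>The transform of the sampled derivative is not the spectral derivative of the sampled
  solution; \<open>rho\<close> is this discrepancy. The remaining terms are pointwise in x and pass
  through \<open>dft\<close> exactly.\<close>

definition rho :: "nat \<Rightarrow> real \<Rightarrow> int \<Rightarrow> cvec" where
  "rho N t l = - (sigma1 *v (dft N (\<lambda>j. Dx t (grid a b N j)) l - (\<i> * of_real (mu a b l)) *s dft N (PG N t) l))"

lemma dft_PG_derivative:
  assumes t: "t \<in> {0..Tend}"
  shows "((\<lambda>s. dft N (PG N s) l) has_vector_derivative
    (gen (th l) (- om l) (om l) (dft N (PG N t) l) + (\<epsilon> *\<^sub>R dft N (QG N t) l + rho N t l))) (at t within {0..Tend})"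
proof -
  let ?x = "grid a b N"
  have "((\<lambda>s. dft N (PG N s) l) has_vector_derivative
     dft N (\<lambda>j. - (sigma1 *v Dx t (?x j)) - \<i> *s (sigma3 *v Phi t (?x j)) + \<epsilon> *\<^sub>R pot (V (?x j)) (A1 (?x j)) (Phi t (?x j))) l)
     (at t within {0..Tend})"
    by (rule has_vector_derivative_dft) (simp add: PG_def Phi_t[OF t])
  also have "dft N (\<lambda>j. - (sigma1 *v Dx t (?x j)) - \<i> *s (sigma3 *v Phi t (?x j)) + \<epsilon> *\<^sub>R pot (V (?x j)) (A1 (?x j)) (Phi t (?x j))) l
     = - (sigma1 *v dft N (\<lambda>j. Dx t (?x j)) l) - \<i> *s (sigma3 *v dft N (PG N t) l) + \<epsilon> *\<^sub>R dft N (QG N t) l"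
  proof -
    have neg: "- u = (-1) *s (u :: cvec)" for u by (simp add: vec_eq_iff)
    show ?thesis
      unfolding neg[of "sigma1 *v _"] scaleR_vmult
      by (simp only: dft_add dft_diff dft_scale dft_matrix QG_def[abs_def] PG_def[abs_def])
  qed
  also have "\<dots> = gen (th l) (- om l) (om l) (dft N (PG N t) l) + (\<epsilon> *\<^sub>R dft N (QG N t) l + rho N t l)"
  proof -
    have "(mu a b l *\<^sub>R sigma1 + sigma3) *v u = of_real (mu a b l) *s (sigma1 *v u) + sigma3 *v u" for u :: cvec
      by (simp add: matrix_vector_mult_add_rdistrib scaleR_matrix_vmult)
    then show ?thesis
      unfolding gen_F rho_def
      by (simp add: matrix_vector_mult_diff_distrib vec.scale vmult.add_right vector_smult_assoc mult_ac)
  qed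
  finally show ?thesis .
qed

text \<open>The forward difference is transformed in two ways: as (rt N l - 1) times the
  coefficient, and by Taylor expansion of the solution. Expanding rt N l = cis (mu h) leaves an
  error mu^2 h^2, the solution one of h^(3/2); division by h gives the bound.\<close>

lemma norm_rho_le:
  assumes t: "t \<in> {0..Tend}" and N: "N > 0"
  shows "norm (rho N t l) \<le> B * sqrt ((b - a) / N) + B * (mu a b l)\<^sup>2 * ((b - a) / N)"
proof -
  define h where "h = (b - a) / N"
  have h: "0 < h" "h \<le> b - a" using ab N by (auto simp: h_def divide_le_eq)
  let ?x = "grid a b N" and ?\<mu> = "mu a b l" and ?c = "dft N (PG N t) l"
  have x_Suc: "?x (Suc j) = ?x j + h" for j by (simp add: grid_def h_def distrib_right add_divide_distrib)
  let ?E = "\<lambda>j. dd (PG N t) j - h *\<^sub>R Dx t (?x j)"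
  have E: "norm (?E j) \<le> h * (B * sqrt h)" if "j < N" for j
    using Phitaylor[OF t Phi_x[OF t], of "?x j" h] grid_mem[OF ab, of j N] that N h
    by (simp add: dd_def PG_def x_Suc)
  have rt: "rt N l = cis (?\<mu> * h)" using ab N by (simp add: rt_def mu_def h_def)
  have "dft N ?E l = (rt N l - 1) *s ?c - of_real h *s dft N (\<lambda>j. Dx t (?x j)) l"
    by (simp only: dft_diff scaleR_vmult dft_scale dft_dd[OF N, of "PG N t", OF PG_periodic[OF N t]])
  then have eq: "of_real h *s (dft N (\<lambda>j. Dx t (?x j)) l - (\<i> * of_real ?\<mu>) *s ?c)
      = (cis (?\<mu> * h) - 1 - \<i> * of_real (?\<mu> * h)) *s ?c - dft N ?E l"
    by (simp add: rt vmult.diff_left vmult.diff_right vector_smult_assoc mult_ac)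
  have "norm (of_real h *s (dft N (\<lambda>j. Dx t (?x j)) l - (\<i> * of_real ?\<mu>) *s ?c))
      \<le> norm ((cis (?\<mu> * h) - 1 - \<i> * of_real (?\<mu> * h)) *s ?c) + norm (dft N ?E l)"
    unfolding eq by (rule norm_triangle_ineq4)
  also have "\<dots> \<le> (?\<mu> * h)\<^sup>2 * B + h * (B * sqrt h)"
    unfolding norm_vmult
  proof (intro add_mono mult_mono cmod_cis_taylor)
    show "norm ?c \<le> B" by (rule norm_dft_le[OF N]) (simp add: PG_def Phisup[OF t])
    show "norm (dft N ?E l) \<le> h * (B * sqrt h)" by (rule norm_dft_le[OF N E])
  qed auto
  finally have "cmod (of_real h) * norm (dft N (\<lambda>j. Dx t (?x j)) l - (\<i> * of_real ?\<mu>) *s ?c)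
      \<le> (?\<mu> * h)\<^sup>2 * B + h * (B * sqrt h)"
    unfolding norm_vmult .
  then have "h * norm (dft N (\<lambda>j. Dx t (?x j)) l - (\<i> * of_real ?\<mu>) *s ?c)
      \<le> h * (B * sqrt h + B * ?\<mu>\<^sup>2 * h)"
    using h by (simp add: power2_eq_square algebra_simps)
  then have "norm (dft N (\<lambda>j. Dx t (?x j)) l - (\<i> * of_real ?\<mu>) *s ?c) \<le> B * sqrt h + B * ?\<mu>\<^sup>2 * h"
    using h by simp
  then show ?thesis by (simp add: rho_def norm_sigma1 h_def)
qed

text \<open>A crude sum over the coarse modes: it may grow with M but tends to 0 in N for fixed
  M.\<close>

definition delta :: "nat \<Rightarrow> nat \<Rightarrow> real" where
  "delta M N = (\<Sum>l\<in>modes M. om l * (B * sqrt ((b - a) / N) + B * (mu a b l)\<^sup>2 * ((b - a) / N)))"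

lemma nrm_rho_le:
  assumes "t \<in> {0..Tend}" "N > 0"
  shows "nrm M 1 (rho N t) \<le> delta M N"
proof -
  have "nrm M 1 (rho N t) \<le> (\<Sum>l\<in>modes M. om l * norm (rho N t l))"
    unfolding nrm_def using om_ge_1
    by (simp, intro L2_set_le_sum) (auto intro!: mult_nonneg_nonneg intro: order_trans[OF zero_le_one])
  also have "\<dots> \<le> delta M N"
    unfolding delta_def using om_ge_1
    by (intro sum_mono mult_left_mono norm_rho_le assms) (auto intro: order_trans[OF zero_le_one])
  finally show ?thesis .
qed

lemma delta_tendsto: "(\<lambda>N. delta M N) \<longlonglongrightarrow> 0"
proof -
  have h: "(\<lambda>N. (b - a) / real N) \<longlonglongrightarrow> 0" by (rule lim_const_over_n)
  have "(\<lambda>N. delta M N) \<longlonglongrightarrow> (\<Sum>l\<in>modes M. om l * (B * sqrt 0 + B * (mu a b l)\<^sup>2 * 0))"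
    unfolding delta_def by (intro tendsto_intros h)
  then show ?thesis by simp
qed

section \<open>Constants, accumulation of the local errors, and the limit of the fine grid\<close>

lemma weight_le:
  fixes M :: nat
  assumes "M > 0" "0 \<le> c"
  shows "(2 / M) ^ m * (c * ((b - a) / 4) ^ m) \<le> c * ((b - a) / M) ^ m"
proof -
  have "(2 / M) ^ m * (c * ((b - a) / 4) ^ m) = c * ((2 / M) * ((b - a) / 4)) ^ m"
    by (simp only: power_mult_distrib mult_ac)
  also have "\<dots> \<le> c * ((b - a) / M) ^ m"
    using assms ab by (intro mult_left_mono power_mono) (auto simp: field_simps)
  finally show ?thesis .
qed

text \<open>\<open>CR\<close> is the aliasing of the potential term (2 B') plus the pointwise
  potential (2 A) applied to the aliasing of the solution (2 B). \<open>CP\<close> and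
  \<open>CQ\<close> are the constants of \<open>sobolev_dft\<close> at orders 1 and 2, and
  \<open>CS\<close> is that of \<open>strang_step\<close> with \<open>CV\<close> = 160 A.\<close>

definition CR :: real where "CR = 2 * B' + 4 * A * B"
definition CP :: real where "CP = 2 * (1 + pi / 2) * B'"
definition CQ :: real where "CQ = 4 * (1 + (pi / 2)\<^sup>2) * B"
definition CS :: real where "CS = 160 * A * (CP + 1) + (160 * A)\<^sup>2 * CQ + 160 * A * CQ"

lemma B'_ge_0: "0 \<le> B'" using A_ge_0 B0 by (simp add: B'_def)

text \<open>The left side is the Riemann sum of the L2 error. By Parseval it splits at
  \<open>modes M\<close>: inside, the initial aliasing 2 B h^m and the accumulated local errors;
  outside, the tail B h^m of the solution alone. This explains 3 B.\<close>

lemma fine_grid_error: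
  assumes M: "M > 0" "even M" and q: "q \<ge> m" and \<tau>: "0 < \<tau>" and n: "real n * \<tau> \<le> Tend"
    and \<delta>: "delta M (q * M) \<le> 1"
  shows "sqrt ((b - a) / real (q * M) * (\<Sum>j<q * M. (norm (Phi (real n * \<tau>) (grid a b (q * M) j)
        - interp a b M (tsfp a b M \<epsilon> \<tau> V A1 Phi0 n) (grid a b (q * M) j)))\<^sup>2))
     \<le> sqrt (b - a) * (3 * B * ((b - a) / M) ^ m
       + real n * \<tau> * (\<epsilon> * (CS * \<tau>\<^sup>2 + CR * ((b - a) / M) ^ m) + delta M (q * M)))"
proof -
  let ?N = "q * M" and ?h = "(b - a) / M"
  let ?\<delta> = "delta M ?N"
  have q0: "q > 0" using q m by simp
  have N: "?N > 0" "even ?N" using M q0 by auto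
  have "m * 1 \<le> q * M" using q M by (intro mult_mono) auto
  then have mN: "m \<le> ?N" by simp
  have h: "0 < ?h" using ab M by simp
  interpret scheme a b M "\<lambda>j. V (grid a b M j)" "\<lambda>j. A1 (grid a b M j)" A
    by (rule scheme_grid[OF M])
  define \<psi> where "\<psi> t = dft ?N (PG ?N t)" for t
  define g where "g k = dft M (tsfp a b M \<epsilon> \<tau> V A1 Phi0 k)" for k
  have refine: "(\<lambda>j. PG ?N t (q * j)) = PG M t" "(\<lambda>j. QG ?N t (q * j)) = QG M t" for t
    using q0 M by (auto simp: PG_def QG_def grid_refine)
  have W0: "L2_set (\<lambda>l. \<bar>real_of_int l\<bar> ^ m * norm (\<psi> t l)) (modes ?N) \<le> B * ((b - a) / 4) ^ m"
    if t: "t \<in> {0..Tend}" for t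
    unfolding \<psi>_def by (rule sobolev_dft_weight[OF N, of "PG ?N t", OF PG_periodic[OF N(1) t]]) (rule dd_PG[OF t mN], simp)
  have W1: "L2_set (\<lambda>l. \<bar>real_of_int l\<bar> ^ m * norm (dft ?N (QG ?N t) l)) (modes ?N) \<le> B' * ((b - a) / 4) ^ m"
    if t: "t \<in> {0..Tend}" for t
    by (rule sobolev_dft_weight[OF N, of "QG ?N t", OF QG_periodic[OF N(1) t]]) (rule dd_QG[OF t mN], simp)
  have aliasP: "nrm M 0 (dft M (PG M t) - \<psi> t) \<le> 2 * B * ?h ^ m" if t: "t \<in> {0..Tend}" for t
  proof -
    have "nrm M 0 (dft M (PG M t) - \<psi> t) \<le> 2 * (2 / M) ^ m * (B * ((b - a) / 4) ^ m)"
      using dft_alias[OF M q0, of m "PG ?N t", OF _ W0[OF t, unfolded \<psi>_def]] m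
      by (simp add: nrm_0 \<psi>_def refine)
    then show ?thesis using weight_le[OF M(1), of B] B0 by linarith
  qed
  have aliasQ: "nrm M 0 (dft M (QG M t) - dft ?N (QG ?N t)) \<le> 2 * B' * ?h ^ m" if t: "t \<in> {0..Tend}" for t
  proof -
    have "nrm M 0 (dft M (QG M t) - dft ?N (QG ?N t)) \<le> 2 * (2 / M) ^ m * (B' * ((b - a) / 4) ^ m)"
      using dft_alias[OF M q0, of m "QG ?N t", OF _ W1[OF t]] m by (simp add: nrm_0 refine)
    then show ?thesis using weight_le[OF M(1), of B'] B'_ge_0 by linarith
  qed
  have sub: "nrm M k f \<le> nrm ?N k f" for k f
    unfolding nrm_def L2_set_def
    by (intro real_sqrt_le_mono sum_mono2 modes_subset[OF q0]) auto
  have P: "nrm M 1 (dft ?N (QG ?N t)) \<le> CP" if t: "t \<in> {0..Tend}" for t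
  proof -
    have "nrm ?N 1 (dft ?N (QG ?N t)) \<le> 2 ^ 1 * (1 + (pi / 2) ^ 1) * B'"
      by (rule sobolev_dft[OF N, of "QG ?N t", OF QG_periodic[OF N(1) t]])
         (use dd_QG[OF t mN, of 0] dd_QG[OF t mN, of 1] m in auto)
    then show ?thesis using sub[of 1 "dft ?N (QG ?N t)"] by (simp add: CP_def)
  qed
  have Q: "nrm M 2 (\<psi> t) \<le> CQ" if t: "t \<in> {0..Tend}" for t
  proof -
    have "nrm ?N 2 (\<psi> t) \<le> 2 ^ 2 * (1 + (pi / 2) ^ 2) * B" unfolding \<psi>_def
      by (rule sobolev_dft[OF N, of "PG ?N t", OF PG_periodic[OF N(1) t]])
         (use dd_PG[OF t mN, of 0] dd_PG[OF t mN, of 2] m in auto)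
    then show ?thesis using sub[of 2 "\<psi> t"] by (simp add: CQ_def)
  qed
  \<comment> \<open>The coarse transform of the potential term serves as the intermediate quantity:
    one difference is its own aliasing, the other the potential applied to the aliasing of the
    solution.\<close>
  have R: "nrm M 0 (dft ?N (QG ?N t) - VV (\<psi> t)) \<le> CR * ?h ^ m" if t: "t \<in> {0..Tend}" for t
  proof -
    let ?U = "\<lambda>j. PG M t j - ev M (\<psi> t) j"
    have "nrm M 0 (dft M (QG M t) - VV (\<psi> t)) = nrm M 0 (dft M (\<lambda>j. pot (V (grid a b M j)) (A1 (grid a b M j)) (?U j)))"
      by (intro nrm_cong) (simp add: Vop_def QG_def[abs_def] pot_diff dft_diff)
    also have "\<dots> = L2_set (\<lambda>j. norm (pot (V (grid a b M j)) (A1 (grid a b M j)) (?U j))) {..<M} / sqrt M"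
      by (simp add: nrm_0 parseval[OF M])
    also have "\<dots> \<le> L2_set (\<lambda>j. 2 * A * norm (?U j)) {..<M} / sqrt M"
    proof (intro divide_right_mono L2_set_mono)
      fix j
      have "\<bar>V (grid a b M j)\<bar> \<le> A" "\<bar>A1 (grid a b M j)\<bar> \<le> A"
        using VA[of 0 0] A1A[of 0 0] by auto
      then show "norm (pot (V (grid a b M j)) (A1 (grid a b M j)) (?U j)) \<le> 2 * A * norm (?U j)"
        unfolding pot_def by (intro norm_gen_le) auto
    qed auto
    also have "\<dots> = 2 * A * (L2_set (\<lambda>j. norm (?U j)) {..<M} / sqrt M)"
      using A_ge_0 by (subst L2_set_right_distrib[symmetric]) auto
    also have "L2_set (\<lambda>j. norm (?U j)) {..<M} / sqrt M = nrm M 0 (dft M ?U)"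
      by (simp add: nrm_0 parseval[OF M])
    also have "nrm M 0 (dft M ?U) = nrm M 0 (dft M (PG M t) - \<psi> t)"
      by (intro nrm_cong) (simp add: dft_diff dft_ev[OF M])
    also have "2 * A * nrm M 0 (dft M (PG M t) - \<psi> t) \<le> 2 * A * (2 * B * ?h ^ m)"
      using aliasP[OF t] A_ge_0 by (intro mult_left_mono) auto
    finally have "nrm M 0 (dft M (QG M t) - VV (\<psi> t)) \<le> 4 * A * B * ?h ^ m" by (simp add: fun_diff_def)
    then show ?thesis
      using aliasQ[OF t] nrm_triangle3[of M 0 "dft ?N (QG ?N t)" "VV (\<psi> t)" "dft M (QG M t)"]
        nrm_minus_commute[of M 0 "dft ?N (QG ?N t)" "dft M (QG M t)"]
      by (simp add: CR_def algebra_simps)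
  qed
  have main: "nrm M 0 (\<psi> (real k * \<tau>) - g k) \<le> 2 * B * ?h ^ m + real k * \<tau> * (\<epsilon> * (CS * \<tau>\<^sup>2 + CR * ?h ^ m) + ?\<delta>)"
    if "real k * \<tau> \<le> Tend" for k
    using that
  proof (induction k)
    case 0
    \<comment> \<open>The scheme starts from coarse samples, \<open>\<psi> 0\<close> from fine ones,
      so there is an aliasing error already at time 0.\<close>
    have "g 0 = dft M (PG M 0)"
      using sol by (simp add: g_def tsfp_def PG_def[abs_def] dirac_solution_def)
    then show ?case using aliasP[of 0] 0 nrm_minus_commute[of M 0 "\<psi> 0" "g 0"] by (simp add: fun_diff_def)
  next
    case (Suc k)
    let ?t0 = "real k * \<tau>"
    have t1: "real (Suc k) * \<tau> = ?t0 + \<tau>" by (simp add: algebra_simps)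
    have subI: "{?t0..?t0 + \<tau>} \<subseteq> {0..Tend}" using Suc.prems \<tau> unfolding t1 by auto
    define S where "S f = F (\<tau>/2) (W (\<epsilon> * \<tau>) (F (\<tau>/2) f))" for f
    have step: "nrm M 0 (\<psi> (?t0 + \<tau>) - S (\<psi> ?t0))
       \<le> \<tau> * (\<epsilon> * ((CV * (CP + 1) + CV\<^sup>2 * CQ + CV * CQ) * \<tau>\<^sup>2 + CR * ?h ^ m) + ?\<delta>)"
      unfolding S_def
    proof (rule strang_step[where p="\<lambda>t. dft ?N (QG ?N t)" and \<rho>="rho ?N"])
      show "((\<lambda>s. \<psi> s l) has_vector_derivative gen (th l) (- om l) (om l) (\<psi> s l) + (\<epsilon> *\<^sub>R dft ?N (QG ?N s) l + rho ?N s l))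
         (at s within {?t0..?t0 + \<tau>})" if "s \<in> {?t0..?t0 + \<tau>}" for s l
        unfolding \<psi>_def
        by (rule has_vector_derivative_within_subset[OF dft_PG_derivative subI]) (rule subsetD[OF subI that])
    qed (use \<tau> \<epsilon> \<delta> in \<open>simp_all only: P Q R nrm_rho_le[OF _ N(1)] subsetD[OF subI] less_imp_le\<close>)
    \<comment> \<open>\<open>S\<close> is one step of the scheme on coefficients; being linear and
      isometric, it propagates the error without growth.\<close>
    have gS: "nrm M 0 (S (\<psi> ?t0) - g (Suc k)) = nrm M 0 (\<psi> ?t0 - g k)"
    proof -
      have "nrm M 0 (S (\<psi> ?t0) - g (Suc k)) = nrm M 0 (S (\<psi> ?t0) - S (g k))"
        by (intro nrm_cong) (simp add: g_def tsfp_def S_def dft_tsfp_step)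
      also have "S (\<psi> ?t0) - S (g k) = S (\<psi> ?t0 - g k)" by (simp add: S_def F_minus W_minus)
      finally show ?thesis by (simp add: S_def fun_diff_def)
    qed
    have IH: "nrm M 0 (\<psi> ?t0 - g k) \<le> 2 * B * ?h ^ m + ?t0 * (\<epsilon> * (CS * \<tau>\<^sup>2 + CR * ?h ^ m) + ?\<delta>)"
      using Suc.IH Suc.prems \<tau> unfolding t1 by (simp add: fun_diff_def)
    have "nrm M 0 (\<psi> (?t0 + \<tau>) - g (Suc k)) \<le> \<tau> * (\<epsilon> * (CS * \<tau>\<^sup>2 + CR * ?h ^ m) + ?\<delta>)
        + (2 * B * ?h ^ m + ?t0 * (\<epsilon> * (CS * \<tau>\<^sup>2 + CR * ?h ^ m) + ?\<delta>))"
      using nrm_triangle3[of M 0 "\<psi> (?t0 + \<tau>)" "g (Suc k)" "S (\<psi> ?t0)"] step gS IH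
      by (simp add: CS_def CV_def)
    then show ?case unfolding t1 by (simp add: fun_diff_def algebra_simps)
  qed
  define t where "t = real n * \<tau>"
  have t: "t \<in> {0..Tend}" using n \<tau> by (simp add: t_def)
  let ?X = "\<lambda>j. Phi t (grid a b ?N j) - interp a b M (tsfp a b M \<epsilon> \<tau> V A1 Phi0 n) (grid a b ?N j)"
  let ?d = "\<lambda>l. norm (\<psi> t l - (if l \<in> modes M then g n l else 0))"
  have "L2_set (\<lambda>j. norm (?X j)) {..<?N} / sqrt ?N = L2_set (\<lambda>l. norm (dft ?N ?X l)) (modes ?N)"
    by (simp add: parseval[OF N])
  also have "\<dots> = L2_set ?d (modes ?N)"
    by (intro L2_set_cong refl)
       (simp add: dft_diff interp_grid[OF M(1) q0] dft_ev[OF N] \<psi>_def g_def PG_def[abs_def] del: of_nat_mult)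
  also have "\<dots> \<le> L2_set ?d (modes M) + L2_set ?d (modes ?N - modes M)"
  proof -
    have "(\<Sum>l\<in>modes ?N. (?d l)\<^sup>2) = (\<Sum>l\<in>modes M. (?d l)\<^sup>2) + (\<Sum>l\<in>modes ?N - modes M. (?d l)\<^sup>2)"
      using sum.subset_diff[OF modes_subset[OF q0, of M] finite_modes, of "\<lambda>l. (?d l)\<^sup>2"] by linarith
    then show ?thesis unfolding L2_set_def by (simp only:) (intro sqrt_add_le_add_sqrt sum_nonneg; simp)
  qed
  also have "L2_set ?d (modes M) = nrm M 0 (\<psi> t - g n)"
    unfolding nrm_0 by (intro L2_set_cong) auto
  also have "L2_set ?d (modes ?N - modes M) = L2_set (\<lambda>l. norm (\<psi> t l)) (modes ?N - modes M)"
    by (intro L2_set_cong) auto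
  also have "nrm M 0 (\<psi> t - g n) + L2_set (\<lambda>l. norm (\<psi> t l)) (modes ?N - modes M)
     \<le> (2 * B * ?h ^ m + t * (\<epsilon> * (CS * \<tau>\<^sup>2 + CR * ?h ^ m) + ?\<delta>)) + B * ?h ^ m"
    using main[OF n, folded t_def] order_trans[OF dft_tail[OF M W0[OF t]] weight_le[OF M(1)]] B0
    by (intro add_mono) auto
  finally have "L2_set (\<lambda>j. norm (?X j)) {..<?N} / sqrt ?N
      \<le> 3 * B * ?h ^ m + t * (\<epsilon> * (CS * \<tau>\<^sup>2 + CR * ?h ^ m) + ?\<delta>)" by simp
  then have "sqrt (b - a) * (L2_set (\<lambda>j. norm (?X j)) {..<?N} / sqrt ?N)
      \<le> sqrt (b - a) * (3 * B * ?h ^ m + t * (\<epsilon> * (CS * \<tau>\<^sup>2 + CR * ?h ^ m) + ?\<delta>))"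
    using ab by (intro mult_left_mono) auto
  moreover have "sqrt ((b - a) / real ?N * (\<Sum>j<?N. (norm (?X j))\<^sup>2)) = sqrt (b - a) * (L2_set (\<lambda>j. norm (?X j)) {..<?N} / sqrt ?N)"
    unfolding L2_set_def by (simp add: real_sqrt_mult real_sqrt_divide)
  ultimately show ?thesis unfolding t_def by simp
qed

text \<open>The limit q to infinity at fixed M, \<tau> and n: eventually q >= m and
  \<open>delta\<close> is below 1, and in the limit \<open>delta\<close> vanishes from the
  bound.\<close>

lemma L2_error:
  assumes M: "M > 0" "even M" and \<tau>: "0 < \<tau>" and n: "real n * \<tau> \<le> Tend"
  shows "L2_norm a b (\<lambda>x. Phi (real n * \<tau>) x - interp a b M (tsfp a b M \<epsilon> \<tau> V A1 Phi0 n) x)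
     \<le> sqrt (b - a) * (3 * B * ((b - a) / M) ^ m
       + real n * \<tau> * (\<epsilon> * (CS * \<tau>\<^sup>2 + CR * ((b - a) / M) ^ m)))"
proof -
  let ?f = "\<lambda>x. Phi (real n * \<tau>) x - interp a b M (tsfp a b M \<epsilon> \<tau> V A1 Phi0 n) x"
  have t: "real n * \<tau> \<in> {0..Tend}" using n \<tau> by simp
  have "continuous_on {a..b} (Phi (real n * \<tau>))"
    using Phi_x[OF t] by (meson continuous_at_imp_continuous_on has_vector_derivative_continuous)
  moreover have "continuous_on {a..b} (interp a b M (tsfp a b M \<epsilon> \<tau> V A1 Phi0 n))"
    unfolding interp_def[abs_def]
    by (intro continuous_on_sum vmult.continuous_on continuous_intros)
  ultimately have "continuous_on {a..b} (\<lambda>x. (norm (?f x))\<^sup>2)" by (intro continuous_intros)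
  from riemann_sum_tendsto[OF ab this]
  have "(\<lambda>N. sqrt ((b - a) / real N * (\<Sum>j<N. (norm (?f (grid a b N j)))\<^sup>2))) \<longlonglongrightarrow> L2_norm a b ?f"
    unfolding L2_norm_def by (rule tendsto_real_sqrt)
  moreover have sub: "filterlim (\<lambda>q. q * M) at_top sequentially"
    using M(1) by (intro filterlim_subseq) (auto simp: strict_mono_def)
  ultimately have lim: "(\<lambda>q. sqrt ((b - a) / real (q * M) * (\<Sum>j<q * M. (norm (?f (grid a b (q * M) j)))\<^sup>2))) \<longlonglongrightarrow> L2_norm a b ?f"
    by (rule filterlim_compose)
  have dlim: "(\<lambda>q. delta M (q * M)) \<longlonglongrightarrow> 0"
    using filterlim_compose[OF delta_tendsto sub] .
  have "(\<lambda>q. sqrt (b - a) * (3 * B * ((b - a) / M) ^ m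
       + real n * \<tau> * (\<epsilon> * (CS * \<tau>\<^sup>2 + CR * ((b - a) / M) ^ m) + delta M (q * M))))
     \<longlonglongrightarrow> sqrt (b - a) * (3 * B * ((b - a) / M) ^ m
       + real n * \<tau> * (\<epsilon> * (CS * \<tau>\<^sup>2 + CR * ((b - a) / M) ^ m) + 0))"
    by (intro tendsto_intros dlim)
  moreover have "eventually (\<lambda>q. sqrt ((b - a) / real (q * M) * (\<Sum>j<q * M. (norm (?f (grid a b (q * M) j)))\<^sup>2))
     \<le> sqrt (b - a) * (3 * B * ((b - a) / M) ^ m
       + real n * \<tau> * (\<epsilon> * (CS * \<tau>\<^sup>2 + CR * ((b - a) / M) ^ m) + delta M (q * M)))) sequentially"
  proof -
    have "eventually (\<lambda>q. delta M (q * M) < 1) sequentially"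
      by (rule order_tendstoD(2)[OF dlim]) simp
    then show ?thesis
      using eventually_ge_at_top[of m]
      by eventually_elim (rule fine_grid_error[OF M _ \<tau> n], auto)
  qed
  ultimately show ?thesis using tendsto_le[OF trivial_limit_sequentially _ lim] by simp
qed

end

theorem theorem3p2:
  fixes a b T K :: real and m :: nat and V A1 :: "real \<Rightarrow> real"
    and Phi0 :: "real \<Rightarrow> cvec" and Phi :: "real \<Rightarrow> real \<Rightarrow> real \<Rightarrow> cvec"
  assumes "a < b" and "T > 0" and "m \<ge> 2"
    and "W_inf_per a b m V" and "W_inf_per a b m A1"
    and "\<And>\<epsilon>. 0 < \<epsilon> \<Longrightarrow> \<epsilon> \<le> 1 \<Longrightarrow> dirac_solution a b \<epsilon> V A1 (T / \<epsilon>) Phi0 (Phi \<epsilon>)"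
    and "\<And>\<epsilon> t. 0 < \<epsilon> \<Longrightarrow> \<epsilon> \<le> 1 \<Longrightarrow> t \<in> {0..T / \<epsilon>} \<Longrightarrow> H_per_bounded a b m K (Phi \<epsilon> t)"
  shows "\<exists>C0 C1. C0 > 0 \<and> C1 > 0 \<and>
    (\<forall>\<epsilon> M \<tau> n. 0 < \<epsilon> \<and> \<epsilon> \<le> 1 \<and> M > 0 \<and> even M \<and> \<tau> > 0 \<and> real n \<le> (T / \<epsilon>) / \<tau> \<longrightarrow>
       L2_norm a b (\<lambda>x. Phi \<epsilon> (real n * \<tau>) x - interp a b M (tsfp a b M \<epsilon> \<tau> V A1 Phi0 n) x)
         \<le> (C0 + C1 * \<epsilon> * (real n * \<tau>)) * (((b - a) / real M) ^ m + \<tau>\<^sup>2))"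
proof -
  have m1: "m \<ge> 1" using assms(3) by simp
  obtain AV where AV: "0 \<le> AV" "\<And>k h x. k \<le> m \<Longrightarrow> 0 \<le> h \<Longrightarrow> \<bar>(dx h ^^ k) V x\<bar> \<le> AV * h ^ k"
    using W_inf_per_dx_bound[OF assms(1) m1 assms(4)] by blast
  obtain AA where AA: "0 \<le> AA" "\<And>k h x. k \<le> m \<Longrightarrow> 0 \<le> h \<Longrightarrow> \<bar>(dx h ^^ k) A1 x\<bar> \<le> AA * h ^ k"
    using W_inf_per_dx_bound[OF assms(1) m1 assms(5)] by blast
  \<comment> \<open>Like the bounds on the potentials, \<open>B\<close> is fixed before \<epsilon>;
    the constants below therefore do not depend on it.\<close>
  obtain B where B: "0 < B"
    "\<And>u N k. H_per_bounded a b m K u \<Longrightarrow> m \<le> N \<Longrightarrow> k \<le> m \<Longrightarrow>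
       L2_set (\<lambda>j. norm ((dd ^^ k) (\<lambda>j. u (grid a b N j)) j)) {..<N} \<le> B * sqrt N * ((b - a) / N) ^ k"
    "\<And>u x. H_per_bounded a b m K u \<Longrightarrow> norm (u x) \<le> B"
    "\<And>u u' x h. H_per_bounded a b m K u \<Longrightarrow> (u has_vector_derivative u') (at x) \<Longrightarrow>
       x \<in> {a..b} \<Longrightarrow> 0 \<le> h \<Longrightarrow> h \<le> b - a \<Longrightarrow> norm (u (x + h) - u x - h *\<^sub>R u') \<le> h * (B * sqrt h)"
    using H_per_bounded_grid[OF assms(1,3), of K] by blast
  define A where "A = AV + AA"
  have A0: "0 \<le> A" using AV(1) AA(1) by (simp add: A_def)
  have VA: "\<bar>(dx h ^^ k) V x\<bar> \<le> A * h ^ k" if "k \<le> m" "0 \<le> h" for k h x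
    using AV(2)[OF that, of x] mult_right_mono[of AV A "h ^ k"] AA(1) that unfolding A_def by force
  have AA1: "\<bar>(dx h ^^ k) A1 x\<bar> \<le> A * h ^ k" if "k \<le> m" "0 \<le> h" for k h x
    using AA(2)[OF that, of x] mult_right_mono[of AA A "h ^ k"] AV(1) that unfolding A_def by force
  have dirac: "dirac a b m V A1 A B \<epsilon> (T / \<epsilon>) Phi0 (Phi \<epsilon>)" if "0 < \<epsilon>" "\<epsilon> \<le> 1" for \<epsilon>
    using assms that VA AA1 B by unfold_locales (auto simp: W_inf_per_def)
  define R where "R = dirac.CR m A B"
  define S where "S = dirac.CS m A B"
  define C0 where "C0 = sqrt (b - a) * (3 * B)"
  \<comment> \<open>The summand 1 makes \<open>C1\<close> positive even when the potentials
    vanish.\<close>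
  define C1 where "C1 = sqrt (b - a) * (S + R) + 1"
  \<comment> \<open>The constants of the locale do not mention \<epsilon>, so any instance, here
    \<epsilon> = 1, serves to unfold them.\<close>
  note d1 = dirac[of 1, simplified]
  have RS: "0 \<le> R" "0 \<le> S"
  proof -
    note defs = dirac.CR_def[OF d1] dirac.CS_def[OF d1] dirac.CP_def[OF d1] dirac.CQ_def[OF d1]
    have "0 \<le> dirac.B' m A B" by (rule dirac.B'_ge_0[OF d1])
    then show "0 \<le> R" "0 \<le> S" using A0 B(1) by (simp_all add: R_def S_def defs)
  qed
  show ?thesis
  proof (rule exI[of _ C0], rule exI[of _ C1], intro conjI allI impI; (elim conjE)?)
    show "C0 > 0" using assms(1) B(1) by (simp add: C0_def)
    show "C1 > 0" using assms(1) RS by (simp add: C1_def add_nonneg_pos)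
    fix \<epsilon> :: real and M :: nat and \<tau> :: real and n :: nat
    assume \<epsilon>: "0 < \<epsilon>" "\<epsilon> \<le> 1" and M: "M > 0" "even M" and \<tau>: "0 < \<tau>" and n: "real n \<le> T / \<epsilon> / \<tau>"
    have nt: "real n * \<tau> \<le> T / \<epsilon>" using n by (simp only: pos_le_divide_eq[OF \<tau>])
    let ?h = "((b - a) / real M) ^ m" and ?s = "sqrt (b - a)" and ?t = "real n * \<tau>"
    have pos: "0 \<le> ?h" "0 \<le> ?s" "0 \<le> \<epsilon> * ?t" using assms(1) \<epsilon> \<tau> by auto
    have "L2_norm a b (\<lambda>x. Phi \<epsilon> ?t x - interp a b M (tsfp a b M \<epsilon> \<tau> V A1 Phi0 n) x)
        \<le> ?s * (3 * B * ?h + ?t * (\<epsilon> * (S * \<tau>\<^sup>2 + R * ?h)))"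
      unfolding R_def S_def by (rule dirac.L2_error[OF dirac[OF \<epsilon>] M \<tau> nt])
    also have "\<dots> = C0 * ?h + ?s * (S * \<tau>\<^sup>2 + R * ?h) * (\<epsilon> * ?t)"
      by (simp add: C0_def algebra_simps)
    also have "\<dots> \<le> C0 * (?h + \<tau>\<^sup>2) + C1 * (?h + \<tau>\<^sup>2) * (\<epsilon> * ?t)"
    proof (intro add_mono mult_left_mono mult_right_mono pos)
      have "S * \<tau>\<^sup>2 + R * ?h \<le> (S + R) * (?h + \<tau>\<^sup>2)"
        using RS pos(1) by (simp add: algebra_simps)
      then have "?s * (S * \<tau>\<^sup>2 + R * ?h) \<le> ?s * ((S + R) * (?h + \<tau>\<^sup>2))"
        using pos by (intro mult_left_mono)
      also have "\<dots> \<le> C1 * (?h + \<tau>\<^sup>2)" using pos by (simp add: C1_def algebra_simps)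
      finally show "?s * (S * \<tau>\<^sup>2 + R * ?h) \<le> C1 * (?h + \<tau>\<^sup>2)" .
    qed (use assms(1) B(1) in \<open>auto simp: C0_def\<close>)
    also have "\<dots> = (C0 + C1 * \<epsilon> * ?t) * (?h + \<tau>\<^sup>2)" by (simp add: algebra_simps)
    finally show "L2_norm a b (\<lambda>x. Phi \<epsilon> ?t x - interp a b M (tsfp a b M \<epsilon> \<tau> V A1 Phi0 n) x)
        \<le> (C0 + C1 * \<epsilon> * ?t) * (?h + \<tau>\<^sup>2)" .
  qed
qed

end
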